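(* Let $H$ be a complex Hilbert space, $A:D(A)\subseteq H\to H$ a maximal monotone linear operator, and $M_0,M_1\in L(H)$ with $M_0\neq 0$ selfadjoint and strictly positive definite on its range (i.e. there is $d>0$ with $\langle M_0x|x\rangle\ge d|x|^2$ for all $x\in\operatorname{ran}M_0$), and $\operatorname{Re}M_1\ge c>0$. Then for each $\rho>0$ the operator $\partial_{0,\rho}M_0+M_1+A$ on $H_{\rho,0}(\mathbb{R};H)$ has a boundedly invertible closure, and the solution operator $\big(\overline{\partial_{0,\rho}M_0+M_1+A}\big)^{-1}$ is exponentially stable with stability rate $\frac{c}{\|M_0\|}$.
   Context: $\operatorname{Re}T=\frac12(T+T^* )$, and $T\ge c$ means $\operatorname{Re}\langle Tx|x\rangle\ge c|x|^2$ for all $x\in H$. For $\rho\in\mathbb{R}$, $H_{\rho,0}(\mathbb{R};H)$ is the Hilbert space of (classes of) measurable $f:\mathbb{R}\to H$ with $\int|f(t)|^2e^{-2\rho t}\,\mathrm{d}t<\infty$, inner product $\int\langle f(t)|g(t)\rangle e^{-2\rho t}\,\mathrm{d}t$. $\partial_{0,\rho}$ is the closure in $H_{\rho,0}(\mathbb{R};H)$ of the derivative on $C_c^\infty(\mathbb{R};H)$; $M_0,M_1,A$ act pointwise in time. A solution operator $S_\rho\in L(H_{\rho,0}(\mathbb{R};H))$ is exponentially stable with stability rate $\nu_0>0$ if for each $0\le\nu<\nu_0$ and each $f\in H_{-\nu,0}(\mathbb{R};H)\cap H_{\rho,0}(\mathbb{R};H)$ one has $S_\rho f\in\bigcap_{-\nu<\mu\le\rho}H_{\mu,0}(\mathbb{R};H)$.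 *)

theory Defs
  imports "HOL-Analysis.Analysis"
begin

class chilbert = banach +
  fixes scaleC :: "complex \<Rightarrow> 'a \<Rightarrow> 'a"
    and cinner :: "'a \<Rightarrow> 'a \<Rightarrow> complex"
  assumes scaleC_add_right: "scaleC a (x + y) = scaleC a x + scaleC a y"
    and scaleC_add_left: "scaleC (a + b) x = scaleC a x + scaleC b x"
    and scaleC_scaleC: "scaleC a (scaleC b x) = scaleC (a * b) x"
    and scaleC_one: "scaleC 1 x = x"
    and scaleC_of_real: "scaleC (complex_of_real r) x = scaleR r x"
    and cinner_commute: "cinner x y = cnj (cinner y x)"
    and cinner_add_left: "cinner (x + y) z = cinner x z + cinner y z"
    and cinner_scaleC_left: "cinner (scaleC a x) y = a * cinner x y"
    and cinner_norm: "cinner x x = complex_of_real ((norm x)\<^sup>2)"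

definition bounded_clinear :: "('a::chilbert \<Rightarrow> 'a) \<Rightarrow> bool" where
  "bounded_clinear M \<longleftrightarrow>
     (\<forall>x y. M (x + y) = M x + M y) \<and> (\<forall>a x. M (scaleC a x) = scaleC a (M x)) \<and>
     (\<exists>K. \<forall>x. norm (M x) \<le> norm x * K)"

definition linear_op :: "'a::chilbert set \<Rightarrow> ('a \<Rightarrow> 'a) \<Rightarrow> bool" where
  "linear_op DA A \<longleftrightarrow> 0 \<in> DA \<and>
     (\<forall>x\<in>DA. \<forall>y\<in>DA. x + y \<in> DA \<and> A (x + y) = A x + A y) \<and>
     (\<forall>a. \<forall>x\<in>DA. scaleC a x \<in> DA \<and> A (scaleC a x) = scaleC a (A x))"

definition monotone_rel :: "('a::chilbert \<times> 'a) set \<Rightarrow> bool" where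
  "monotone_rel G \<longleftrightarrow> (\<forall>(x, u)\<in>G. \<forall>(y, v)\<in>G. Re (cinner (u - v) (x - y)) \<ge> 0)"

definition maximal_monotone :: "'a::chilbert set \<Rightarrow> ('a \<Rightarrow> 'a) \<Rightarrow> bool" where
  "maximal_monotone DA A \<longleftrightarrow>
     monotone_rel {(x, A x) | x. x \<in> DA} \<and>
     (\<forall>G. {(x, A x) | x. x \<in> DA} \<subseteq> G \<and> monotone_rel G \<longrightarrow> G = {(x, A x) | x. x \<in> DA})"

text \<open>Strong (Bochner) measurability, via Pettis: Borel measurable and essentially
  separably valued.  Elements of \<open>H_{\<rho>,0}\<close> are handled through representatives;
  all notions below are invariant under a.e. modification.\<close>
definition smeas :: "(real \<Rightarrow> 'a::chilbert) \<Rightarrow> bool" where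
  "smeas f \<longleftrightarrow> f \<in> borel_measurable lborel \<and>
     (\<exists>D. countable D \<and> (AE t in lborel. f t \<in> closure D))"

definition L2w :: "real \<Rightarrow> (real \<Rightarrow> 'a::chilbert) set" where
  "L2w \<rho> = {f. smeas f \<and> integrable lborel (\<lambda>t. (norm (f t))\<^sup>2 * exp (- 2 * \<rho> * t))}"

definition normw :: "real \<Rightarrow> (real \<Rightarrow> 'a::chilbert) \<Rightarrow> real" where
  "normw \<rho> f = sqrt (\<integral>t. (norm (f t))\<^sup>2 * exp (- 2 * \<rho> * t) \<partial>lborel)"

definition gclos :: "real \<Rightarrow> ((real \<Rightarrow> 'a::chilbert) \<times> (real \<Rightarrow> 'a)) set
                      \<Rightarrow> ((real \<Rightarrow> 'a) \<times> (real \<Rightarrow> 'a)) set" where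
  "gclos \<rho> G = {(u, v). u \<in> L2w \<rho> \<and> v \<in> L2w \<rho> \<and>
      (\<exists>s. (\<forall>n. s n \<in> G) \<and>
           (\<lambda>n. normw \<rho> (\<lambda>t. fst (s n) t - u t)) \<longlonglongrightarrow> 0 \<and>
           (\<lambda>n. normw \<rho> (\<lambda>t. snd (s n) t - v t)) \<longlonglongrightarrow> 0)}"

definition test_fun :: "(real \<Rightarrow> 'a::chilbert) \<Rightarrow> bool" where
  "test_fun \<phi> \<longleftrightarrow>
     (\<exists>D :: nat \<Rightarrow> real \<Rightarrow> 'a. D 0 = \<phi> \<and>
        (\<forall>n t. (D n has_vector_derivative D (Suc n) t) (at t))) \<and>
     bounded {t. \<phi> t \<noteq> 0}"

definition dgraph :: "real \<Rightarrow> ((real \<Rightarrow> 'a::chilbert) \<times> (real \<Rightarrow> 'a)) set" where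
  "dgraph \<rho> = gclos \<rho> {(\<phi>, \<lambda>t. vector_derivative \<phi> (at t)) | \<phi>. test_fun \<phi>}"

definition Agraph :: "real \<Rightarrow> 'a::chilbert set \<Rightarrow> ('a \<Rightarrow> 'a)
                       \<Rightarrow> ((real \<Rightarrow> 'a) \<times> (real \<Rightarrow> 'a)) set" where
  "Agraph \<rho> DA A = {(u, v). u \<in> L2w \<rho> \<and> v \<in> L2w \<rho> \<and>
      (AE t in lborel. u t \<in> DA \<and> v t = A (u t))}"

definition Tgraph :: "real \<Rightarrow> ('a::chilbert \<Rightarrow> 'a) \<Rightarrow> ('a \<Rightarrow> 'a) \<Rightarrow> 'a set \<Rightarrow> ('a \<Rightarrow> 'a)
                       \<Rightarrow> ((real \<Rightarrow> 'a) \<times> (real \<Rightarrow> 'a)) set" where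
  "Tgraph \<rho> M0 M1 DA A = {(u, f). u \<in> L2w \<rho> \<and> f \<in> L2w \<rho> \<and>
      (\<exists>w a. ((\<lambda>t. M0 (u t)), w) \<in> dgraph \<rho> \<and> (u, a) \<in> Agraph \<rho> DA A \<and>
             (AE t in lborel. f t = w t + M1 (u t) + a t))}"

text \<open>A (closed) relation \<open>C\<close> on \<open>H_{\<rho>,0}\<close> is the graph of a boundedly invertible
  operator: it is single-valued (an operator), injective, onto \<open>H_{\<rho>,0}\<close>, and its
  inverse is bounded. Equality in \<open>H_{\<rho>,0}\<close> is equality a.e.\<close>
definition bdd_invertible :: "real \<Rightarrow> ((real \<Rightarrow> 'a::chilbert) \<times> (real \<Rightarrow> 'a)) set \<Rightarrow> bool" where
  "bdd_invertible \<rho> C \<longleftrightarrow>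
     (\<forall>u f g. (u, f) \<in> C \<and> (u, g) \<in> C \<longrightarrow> (AE t in lborel. f t = g t)) \<and>
     (\<forall>u v f g. (u, f) \<in> C \<and> (v, g) \<in> C \<and> (AE t in lborel. f t = g t)
                \<longrightarrow> (AE t in lborel. u t = v t)) \<and>
     (\<forall>f\<in>L2w \<rho>. \<exists>u. (u, f) \<in> C) \<and>
     (\<exists>K. \<forall>(u, f)\<in>C. normw \<rho> u \<le> K * normw \<rho> f)"

text \<open>Exponential stability with rate \<open>\<nu>0\<close> of the solution operator \<open>S_\<rho> = C\<^sup>-\<^sup>1\<close>
  (\<open>S_\<rho> f = u\<close> iff \<open>(u, f) \<in> C\<close>).\<close>
definition exp_stable :: "real \<Rightarrow> ((real \<Rightarrow> 'a::chilbert) \<times> (real \<Rightarrow> 'a)) set \<Rightarrow> real \<Rightarrow> bool" where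
  "exp_stable \<rho> C \<nu>0 \<longleftrightarrow> \<nu>0 > 0 \<and>
     (\<forall>\<nu> u f. 0 \<le> \<nu> \<and> \<nu> < \<nu>0 \<and> f \<in> L2w (- \<nu>) \<and> f \<in> L2w \<rho> \<and> (u, f) \<in> C
        \<longrightarrow> (\<forall>\<mu>. - \<nu> < \<mu> \<and> \<mu> \<le> \<rho> \<longrightarrow> u \<in> L2w \<mu>))"

end

theory Submission
  imports Defs
begin

text \<open>
  Everything takes place in the real Hilbert space with inner product \<open>Re \<langle>x|y\<rangle>\<close>.  Pairing
  \<open>\<partial> M\<^sub>0 u + M\<^sub>1 u + A u = f\<close> with \<open>u\<close> in the space with weight \<open>exp (-2\<mu>t)\<close> gives
  \<open>|f| |u| \<ge> \<mu> \<langle>M\<^sub>0 u|u\<rangle> + c |u|\<^sup>2\<close>, which is coercive as long as \<open>\<mu> > - c / \<parallel>M\<^sub>0\<parallel>\<close>.  For the range, solve the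
  implicit Euler scheme with step \<open>h\<close> for a test function \<open>f\<close>: a finite Neumann series in translates
  of \<open>f\<close> is again a test function, the truncation error decays geometrically in every weight
  \<open>\<mu> > - c / \<parallel>M\<^sub>0\<parallel>\<close>, and the consistency error is \<open>O(h)\<close> because second difference quotients of the
  solution are controlled by those of \<open>f\<close>.  Hence the range is dense, simultaneously in the weights
  \<open>\<rho>\<close> and \<open>\<mu>\<close>, which yields both the inverse and its stability.

  All norms are integrals of differences of Borel functions with values in a possibly nonseparable
  space.  These differences are measurable because a Borel function on the line has separable range:
  otherwise some uncountable Borel set of reals would have only Borel subsets, contradicting the
  perfect set theorem and a diagonal argument over codes of Borel sets.
\<close>

section \<open>Borel functions on the real line have separable range\<close>

definition analytic_real :: "real set \<Rightarrow> bool" where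
  "analytic_real A \<longleftrightarrow> (\<exists>C :: (real \<times> (nat \<Rightarrow> real)) set. closed C \<and> A = fst ` C)"

lemma analytic_real_closed:
  assumes "closed A"
  shows "analytic_real A"
proof -
  have "closed (A \<times> (UNIV :: (nat \<Rightarrow> real) set))" "A = fst ` (A \<times> (UNIV :: (nat \<Rightarrow> real) set))"
    using assms by (simp_all add: closed_Times)
  then show ?thesis unfolding analytic_real_def by blast
qed

lemma analytic_real_UN:
  assumes "\<And>n::nat. analytic_real (A n)"
  shows "analytic_real (\<Union>n. A n)"
proof -
  obtain C :: "nat \<Rightarrow> (real \<times> (nat \<Rightarrow> real)) set"
    where C: "\<And>n. closed (C n)" "\<And>n. A n = fst ` C n"
    using assms unfolding analytic_real_def by metis
  define E where
    "E = {z. snd z 0 \<in> range real} \<inter>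
      (\<Inter>n. {z. \<bar>snd z 0 - real n\<bar> \<ge> 1/2} \<union> (\<lambda>z. (fst z, \<lambda>j. snd z (Suc j))) -` C n)"
  have c0: "continuous_on UNIV (\<lambda>z :: real \<times> (nat \<Rightarrow> real). snd z 0)"
    by (rule continuous_on_product_then_coordinatewise) (intro continuous_intros)
  have "closed ((\<lambda>z :: real \<times> (nat \<Rightarrow> real). snd z 0) -` range real)"
    by (rule closed_vimage[OF closed_of_nat_image c0])
  then have "closed {z :: real \<times> (nat \<Rightarrow> real). snd z 0 \<in> range real}"
    by (simp add: vimage_def)
  moreover have "closed {z :: real \<times> (nat \<Rightarrow> real). \<bar>snd z 0 - real n\<bar> \<ge> 1/2}" for n
    by (intro closed_Collect_le continuous_intros c0)
  moreover have "closed ((\<lambda>z :: real \<times> (nat \<Rightarrow> real). (fst z, \<lambda>j. snd z (Suc j))) -` C n)" for n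
    by (intro closed_vimage C continuous_intros continuous_on_product_then_coordinatewise)
  ultimately have "closed E"
    unfolding E_def by (intro closed_INT ballI closed_Un closed_Int) auto
  moreover have "(\<Union>n. A n) = fst ` E"
  proof (intro equalityI subsetI)
    fix x assume "x \<in> (\<Union>n. A n)"
    then obtain n \<sigma> where "(x, \<sigma>) \<in> C n" using C(2) by auto
    moreover have "\<bar>real n - real m\<bar> \<ge> 1/2" if "m \<noteq> n" for m
    proof -
      have "\<bar>int n - int m\<bar> \<ge> 1" using that by auto
      then have "\<bar>real n - real m\<bar> \<ge> 1" by linarith
      then show ?thesis by simp
    qed
    ultimately have "(x, case_nat (real n) \<sigma>) \<in> E" by (force simp: E_def)
    then show "x \<in> fst ` E" by (metis fst_conv image_eqI)
  next
    fix x assume "x \<in> fst ` E"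
    then obtain \<sigma> where "(x, \<sigma>) \<in> E" by auto
    then obtain n where "\<sigma> 0 = real n" by (auto simp: E_def)
    then have "(x, \<lambda>j. \<sigma> (Suc j)) \<in> C n" using \<open>(x, \<sigma>) \<in> E\<close> by (force simp: E_def)
    then show "x \<in> (\<Union>n. A n)" using C(2) by (metis UN_I UNIV_I fst_conv image_eqI)
  qed
  ultimately show ?thesis unfolding analytic_real_def by blast
qed

lemma analytic_real_INT:
  assumes "\<And>n::nat. analytic_real (A n)"
  shows "analytic_real (\<Inter>n. A n)"
proof -
  obtain C :: "nat \<Rightarrow> (real \<times> (nat \<Rightarrow> real)) set"
    where C: "\<And>n. closed (C n)" "\<And>n. A n = fst ` C n"
    using assms unfolding analytic_real_def by metis
  define E where
    "E = (\<Inter>n. (\<lambda>z :: real \<times> (nat \<Rightarrow> real). (fst z, \<lambda>j. snd z (prod_encode (n, j)))) -` C n)"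
  have "closed ((\<lambda>z :: real \<times> (nat \<Rightarrow> real). (fst z, \<lambda>j. snd z (prod_encode (n, j)))) -` C n)" for n
    by (intro closed_vimage C continuous_intros continuous_on_product_then_coordinatewise)
  then have "closed E"
    unfolding E_def by (intro closed_INT ballI) auto
  moreover have "(\<Inter>n. A n) = fst ` E"
  proof (intro equalityI subsetI)
    fix x assume "x \<in> (\<Inter>n. A n)"
    then have "\<forall>n. \<exists>\<sigma>. (x, \<sigma>) \<in> C n" using C(2) by force
    then obtain \<sigma> where \<sigma>: "\<And>n. (x, \<sigma> n) \<in> C n" by metis
    define \<tau> where "\<tau> m = \<sigma> (fst (prod_decode m)) (snd (prod_decode m))" for m
    have "(\<lambda>j. \<tau> (prod_encode (n, j))) = \<sigma> n" for n by (auto simp: \<tau>_def)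
    then have "(x, \<tau>) \<in> E" using \<sigma> by (auto simp: E_def)
    then show "x \<in> fst ` E" by (metis fst_conv image_eqI)
  next
    fix x assume "x \<in> fst ` E"
    then obtain \<sigma> where "\<And>n. (x, \<lambda>j. \<sigma> (prod_encode (n, j))) \<in> C n" by (auto simp: E_def)
    then show "x \<in> (\<Inter>n. A n)" using C(2) by (metis INT_I fst_conv image_eqI)
  qed
  ultimately show ?thesis unfolding analytic_real_def by blast
qed

lemma analytic_real_greaterThan: "analytic_real {a<..}"
proof -
  have "{a<..} = (\<Union>n. {a + 1 / real (Suc n)..})"
  proof (intro equalityI subsetI)
    fix x assume "x \<in> {a<..}"
    then obtain n where "1 / real (Suc n) < x - a" using nat_approx_posE[of "x - a"] by auto
    then show "x \<in> (\<Union>n. {a + 1 / real (Suc n)..})" by (intro UN_I[of n]) auto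
  next
    fix x assume "x \<in> (\<Union>n. {a + 1 / real (Suc n)..})"
    then obtain n where "a + 1 / real (Suc n) \<le> x" by auto
    moreover have "1 / real (Suc n) > 0" by simp
    ultimately have "a < x" by linarith
    then show "x \<in> {a<..}" by simp
  qed
  then show ?thesis using analytic_real_UN analytic_real_closed closed_atLeast by metis
qed

lemma analytic_real_borel:
  assumes "A \<in> sets borel"
  shows "analytic_real A"
proof -
  have "A \<in> sigma_sets UNIV (range (\<lambda>a::real. {..a}))"
    using assms by (simp add: borel_eq_atMost)
  then have "analytic_real A \<and> analytic_real (- A)"
  proof (induction rule: sigma_sets.induct)
    case (Basic a)
    then show ?case
      using analytic_real_greaterThan analytic_real_closed by (auto simp: Compl_atMost)
  next
    case Empty
    then show ?case using analytic_real_closed by auto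
  next
    case (Compl a)
    then show ?case by (simp add: Compl_eq_Diff_UNIV[symmetric])
  next
    case (Union a)
    then show ?case
      using analytic_real_UN[of a] analytic_real_INT[of "\<lambda>n. - a n"] by (simp add: Compl_UN)
  qed
  then show ?thesis by simp
qed

lemma borel_real_coding:
  obtains code :: "nat set \<Rightarrow> real set" where "sets borel \<subseteq> range code"
proof -
  obtain \<B> :: "(real \<times> (nat \<Rightarrow> real)) set set"
    where B: "countable \<B>" "topological_basis \<B>" using ex_countable_basis by metis
  have ne: "\<B> \<noteq> {}"
    using topological_basisE[OF B(2) open_UNIV UNIV_I] by blast
  define b where "b = from_nat_into \<B>"
  have b: "range b = \<B>" unfolding b_def using B(1) ne by (simp add: range_from_nat_into)
  have "A \<in> range (\<lambda>S. fst ` (- (\<Union>n\<in>S. b n)))" if A: "A \<in> sets borel" for A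
  proof -
    obtain C :: "(real \<times> (nat \<Rightarrow> real)) set" where C: "closed C" "A = fst ` C"
      using analytic_real_borel[OF A] unfolding analytic_real_def by blast
    have "- C = (\<Union>n\<in>{n. b n \<subseteq> - C}. b n)"
    proof (intro equalityI subsetI)
      fix x assume "x \<in> - C"
      then obtain B' where "B' \<in> \<B>" "x \<in> B'" "B' \<subseteq> - C"
        using topological_basisE[OF B(2) open_Compl[OF C(1)]] by blast
      then show "x \<in> (\<Union>n\<in>{n. b n \<subseteq> - C}. b n)" using b by blast
    qed auto
    then have "C = - (\<Union>n\<in>{n. b n \<subseteq> - C}. b n)" by blast
    then show ?thesis using C(2) by blast
  qed
  then show thesis using that by blast
qed

lemma uncountable_real_split:
  fixes U :: "real set"
  assumes "uncountable U"
  obtains a b where "a < b" "uncountable (U \<inter> {..a})" "uncountable (U \<inter> {b..})"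
proof (rule ccontr)
  note th = that
  assume no: "\<not> thesis"
  have *: "countable (U \<inter> {..a}) \<or> countable (U \<inter> {b..})" if ab: "a < b" for a b
    using no ab th[of a b] by blast
  define S where "S = {a. countable (U \<inter> {..a})}"
  have down: "a \<in> S" if "b \<in> S" "a \<le> b" for a b
  proof -
    have "U \<inter> {..a} \<subseteq> U \<inter> {..b}" using that(2) by auto
    then show ?thesis using that(1) countable_subset unfolding S_def by blast
  qed
  have "S \<noteq> {}"
  proof
    assume "S = {}"
    then have "countable (U \<inter> {b..})" for b
      using *[of "b - 1" b] by (auto simp: S_def)
    then have "countable (\<Union>n::nat. U \<inter> {- real n..})" by blast
    moreover have "U \<subseteq> (\<Union>n::nat. U \<inter> {- real n..})"
    proof
      fix x assume "x \<in> U"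
      moreover obtain n :: nat where "- x \<le> real n" using real_arch_simple by blast
      ultimately show "x \<in> (\<Union>n::nat. U \<inter> {- real n..})" by (intro UN_I[of n]) auto
    qed
    ultimately show False using assms countable_subset by blast
  qed
  moreover have "bdd_above S"
  proof (rule ccontr)
    assume "\<not> bdd_above S"
    then have "real n \<in> S" for n using down by (metis bdd_above_def linear)
    then have "countable (\<Union>n::nat. U \<inter> {..real n})" unfolding S_def by blast
    moreover have "U \<subseteq> (\<Union>n::nat. U \<inter> {..real n})"
    proof
      fix x assume "x \<in> U"
      moreover obtain n :: nat where "x \<le> real n" using real_arch_simple by blast
      ultimately show "x \<in> (\<Union>n::nat. U \<inter> {..real n})" by (intro UN_I[of n]) auto
    qed
    ultimately show False using assms countable_subset by blast
  qed
  ultimately have sup: "\<And>a. a < Sup S \<Longrightarrow> a \<in> S" "\<And>a. Sup S < a \<Longrightarrow> a \<notin> S"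
    using down by (meson less_cSupE less_imp_le) (use \<open>bdd_above S\<close> cSup_upper leD in blast)
  define s where "s = Sup S"
  have 1: "countable (U \<inter> {..s - 1 / Suc n})" for n
    using sup(1)[of "s - 1 / Suc n"] by (auto simp: S_def s_def)
  have 2: "countable (U \<inter> {s + 1 / Suc n..})" for n
  proof -
    define \<delta> where "\<delta> = 1 / real (Suc n)"
    have "\<delta> > 0" by (simp add: \<delta>_def)
    then show ?thesis
      using sup(2)[of "s + \<delta> / 2"] *[of "s + \<delta> / 2" "s + \<delta>"] unfolding \<delta>_def[symmetric]
      by (auto simp: S_def s_def)
  qed
  have "U \<subseteq> {s} \<union> (\<Union>n. U \<inter> {..s - 1 / Suc n}) \<union> (\<Union>n. U \<inter> {s + 1 / Suc n..})"
  proof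
    fix x assume x: "x \<in> U"
    show "x \<in> {s} \<union> (\<Union>n. U \<inter> {..s - 1 / Suc n}) \<union> (\<Union>n. U \<inter> {s + 1 / Suc n..})"
    proof (cases "x = s")
      case False
      then obtain n where "1 / real (Suc n) < \<bar>x - s\<bar>"
        using nat_approx_posE[of "\<bar>x - s\<bar>"] by auto
      then have "x \<le> s - 1 / Suc n \<or> x \<ge> s + 1 / Suc n" by (auto simp: abs_if split: if_splits)
      then show ?thesis using x by blast
    qed simp
  qed
  moreover have "countable ({s} \<union> (\<Union>n. U \<inter> {..s - 1 / Suc n}) \<union> (\<Union>n. U \<inter> {s + 1 / Suc n..}))"
    by (rule countable_Un[OF countable_Un[OF _ countable_UN[OF _ 1]] countable_UN[OF _ 2]]) simp_all
  ultimately have "countable U" by (rule countable_subset)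
  then show False using assms by simp
qed

lemma uncountable_projection_small:
  fixes F :: "(real \<times> (nat \<Rightarrow> real)) set"
  assumes "closed F" "uncountable (fst ` F)" "\<epsilon> > 0"
  obtains G where "closed G" "G \<subseteq> F" "uncountable (fst ` G)"
    "\<And>x y. x \<in> G \<Longrightarrow> y \<in> G \<Longrightarrow> dist x y \<le> \<epsilon>"
proof -
  obtain D :: "(real \<times> (nat \<Rightarrow> real)) set"
    where D: "countable D" "\<And>X. open X \<Longrightarrow> X \<noteq> {} \<Longrightarrow> \<exists>d\<in>D. d \<in> X"
    using countable_dense_setE by blast
  have "fst ` F \<subseteq> (\<Union>d\<in>D. fst ` (F \<inter> cball d (\<epsilon>/2)))"
  proof
    fix x assume "x \<in> fst ` F"
    then obtain p where p: "p \<in> F" "x = fst p" by auto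
    obtain d where "d \<in> D" "d \<in> ball p (\<epsilon>/2)"
      using D(2)[of "ball p (\<epsilon>/2)"] assms(3) by auto
    then have "p \<in> F \<inter> cball d (\<epsilon>/2)" using p by (auto simp: dist_commute)
    then show "x \<in> (\<Union>d\<in>D. fst ` (F \<inter> cball d (\<epsilon>/2)))" using p \<open>d \<in> D\<close> by blast
  qed
  then obtain d where "uncountable (fst ` (F \<inter> cball d (\<epsilon>/2)))"
    using assms(2) D(1) by (meson countable_UN countable_subset)
  moreover have "dist x y \<le> \<epsilon>" if "x \<in> F \<inter> cball d (\<epsilon>/2)" "y \<in> F \<inter> cball d (\<epsilon>/2)" for x y
    using that dist_triangle[of x y d] by (auto simp: dist_commute)
  moreover have "closed (F \<inter> cball d (\<epsilon>/2))" using assms(1) by auto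
  ultimately show thesis using that[of "F \<inter> cball d (\<epsilon>/2)"] by blast
qed

lemma uncountable_projection_split:
  fixes F :: "(real \<times> (nat \<Rightarrow> real)) set"
  assumes "closed F" "uncountable (fst ` F)" "\<epsilon> > 0"
  shows "\<exists>G. (\<forall>i::bool. closed (G i) \<and> G i \<subseteq> F \<and> uncountable (fst ` G i) \<and>
      (\<forall>x\<in>G i. \<forall>y\<in>G i. dist x y \<le> \<epsilon>)) \<and> fst ` G True \<inter> fst ` G False = {}"
proof -
  obtain a b where ab: "a < b" "uncountable (fst ` F \<inter> {..a})" "uncountable (fst ` F \<inter> {b..})"
    using uncountable_real_split[OF assms(2)] by blast
  have "fst ` F \<inter> {..a} = fst ` (F \<inter> fst -` {..a})" "fst ` F \<inter> {b..} = fst ` (F \<inter> fst -` {b..})"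
    by auto
  moreover have "closed (F \<inter> fst -` {..a})" "closed (F \<inter> fst -` {b..})"
    using assms(1) by (auto intro!: closed_Int closed_vimage_fst)
  ultimately have F: "closed (F \<inter> fst -` {..a})" "uncountable (fst ` (F \<inter> fst -` {..a}))"
    "closed (F \<inter> fst -` {b..})" "uncountable (fst ` (F \<inter> fst -` {b..}))"
    using ab by auto
  obtain G where
    G: "closed G" "G \<subseteq> F \<inter> fst -` {..a}" "uncountable (fst ` G)" "\<And>x y. x \<in> G \<Longrightarrow> y \<in> G \<Longrightarrow> dist x y \<le> \<epsilon>"
    by (rule uncountable_projection_small[OF F(1,2) assms(3)]) blast
  obtain H where
    H: "closed H" "H \<subseteq> F \<inter> fst -` {b..}" "uncountable (fst ` H)" "\<And>x y. x \<in> H \<Longrightarrow> y \<in> H \<Longrightarrow> dist x y \<le> \<epsilon>"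
    by (rule uncountable_projection_small[OF F(3,4) assms(3)]) blast
  have "fst ` G \<subseteq> {..a}" "fst ` H \<subseteq> {b..}" using G(2) H(2) by auto
  then have "fst ` G \<inter> fst ` H = {}" using ab(1) by fastforce
  then show ?thesis
    using G H by (intro exI[of _ "\<lambda>i. if i then G else H"]) auto
qed

lemma uncountable_analytic_real_inj:
  assumes "analytic_real X" "uncountable X"
  obtains \<psi> :: "(nat \<Rightarrow> bool) \<Rightarrow> real" where "inj \<psi>" "range \<psi> \<subseteq> X"
proof -
  obtain C :: "(real \<times> (nat \<Rightarrow> real)) set" where C: "closed C" "X = fst ` C" using assms(1) unfolding analytic_real_def by blast
  define P where "P F \<longleftrightarrow> closed F \<and> uncountable (fst ` F)" for F :: "(real \<times> (nat \<Rightarrow> real)) set"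
  have "\<forall>F n. \<exists>G. P F \<longrightarrow> (\<forall>i::bool. P (G i) \<and> G i \<subseteq> F \<and>
      (\<forall>x\<in>G i. \<forall>y\<in>G i. dist x y \<le> (1/2)^n)) \<and> fst ` G True \<inter> fst ` G False = {}"
  proof (intro allI)
    fix F :: "(real \<times> (nat \<Rightarrow> real)) set" and n :: nat
    show "\<exists>G. P F \<longrightarrow> (\<forall>i::bool. P (G i) \<and> G i \<subseteq> F \<and>
      (\<forall>x\<in>G i. \<forall>y\<in>G i. dist x y \<le> (1/2)^n)) \<and> fst ` G True \<inter> fst ` G False = {}"
    proof (cases "P F")
      case True
      then have "closed F" "uncountable (fst ` F)" by (auto simp: P_def)
      then have "\<exists>G. (\<forall>i::bool. P (G i) \<and> G i \<subseteq> F \<and>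
        (\<forall>x\<in>G i. \<forall>y\<in>G i. dist x y \<le> (1/2)^n)) \<and> fst ` G True \<inter> fst ` G False = {}"
        using uncountable_projection_split[of F "(1/2)^n"] unfolding P_def by (simp add: conj_ac)
      then show ?thesis by blast
    qed simp
  qed
  then have "\<exists>sp. \<forall>F n. P F \<longrightarrow> (\<forall>i::bool. P (sp F n i) \<and> sp F n i \<subseteq> F \<and>
      (\<forall>x\<in>sp F n i. \<forall>y\<in>sp F n i. dist x y \<le> (1/2)^n)) \<and> fst ` sp F n True \<inter> fst ` sp F n False = {}"
    by (subst (asm) choice_iff) (subst (asm) choice_iff)
  then obtain sp :: "(real \<times> (nat \<Rightarrow> real)) set \<Rightarrow> nat \<Rightarrow> bool \<Rightarrow> (real \<times> (nat \<Rightarrow> real)) set"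
    where sp': "\<forall>F n. P F \<longrightarrow> (\<forall>i::bool. P (sp F n i) \<and> sp F n i \<subseteq> F \<and>
      (\<forall>x\<in>sp F n i. \<forall>y\<in>sp F n i. dist x y \<le> (1/2)^n)) \<and> fst ` sp F n True \<inter> fst ` sp F n False = {}"
    by blast
  have sp: "P F \<Longrightarrow> P (sp F n i)" "P F \<Longrightarrow> sp F n i \<subseteq> F"
    "P F \<Longrightarrow> x \<in> sp F n i \<Longrightarrow> y \<in> sp F n i \<Longrightarrow> dist x y \<le> (1/2)^n"
    "P F \<Longrightarrow> fst ` sp F n True \<inter> fst ` sp F n False = {}" for F n i x y
    using sp'[rule_format, of F n] by blast+
  define Fs where "Fs \<alpha> = rec_nat C (\<lambda>n F. sp F n (\<alpha> n))" for \<alpha> :: "nat \<Rightarrow> bool"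
  have Fs: "Fs \<alpha> 0 = C" "Fs \<alpha> (Suc n) = sp (Fs \<alpha> n) n (\<alpha> n)" for \<alpha> n by (auto simp: Fs_def)
  have PFs: "P (Fs \<alpha> n)" for \<alpha> n
    by (induction n) (use sp(1) C assms(2) in \<open>auto simp: Fs P_def\<close>)
  have dec: "Fs \<alpha> n \<subseteq> Fs \<alpha> m" if "m \<le> n" for \<alpha> m n
    by (rule lift_Suc_antimono_le[of "Fs \<alpha>", OF _ that]) (use sp(2) PFs in \<open>auto simp: Fs\<close>)
  have "\<exists>p. \<forall>n. p \<in> Fs \<alpha> n" for \<alpha>
  proof -
    have "\<exists>n. \<forall>x\<in>Fs \<alpha> n. \<forall>y\<in>Fs \<alpha> n. dist x y < \<epsilon>" if \<epsilon>: "\<epsilon> > 0" for \<epsilon>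
    proof -
      obtain n where n: "(1/2)^n < \<epsilon>" using real_arch_pow_inv[OF \<epsilon>, of "1/2"] by auto
      then have "\<forall>x\<in>Fs \<alpha> (Suc n). \<forall>y\<in>Fs \<alpha> (Suc n). dist x y < \<epsilon>"
        unfolding Fs using sp(3)[OF PFs] by (meson le_less_trans)
      then show ?thesis by blast
    qed
    moreover have "closed (Fs \<alpha> n)" "Fs \<alpha> n \<noteq> {}" for n using PFs[of \<alpha> n] by (auto simp: P_def)
    ultimately show ?thesis using decreasing_closed_nest[of "Fs \<alpha>"] dec by metis
  qed
  then obtain p where p: "\<And>\<alpha> n. p \<alpha> \<in> Fs \<alpha> n" by metis
  have "inj (fst \<circ> p)"
  proof (rule injI, rule ccontr)
    fix \<alpha> \<beta> assume eq: "(fst \<circ> p) \<alpha> = (fst \<circ> p) \<beta>" and "\<alpha> \<noteq> \<beta>"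
    then obtain m where "\<alpha> m \<noteq> \<beta> m" by auto
    define n where "n = (LEAST n. \<alpha> n \<noteq> \<beta> n)"
    have n: "\<alpha> n \<noteq> \<beta> n" "\<And>k. k < n \<Longrightarrow> \<alpha> k = \<beta> k"
      unfolding n_def using LeastI[of "\<lambda>n. \<alpha> n \<noteq> \<beta> n"] \<open>\<alpha> m \<noteq> \<beta> m\<close> not_less_Least by blast+
    have "k \<le> n \<Longrightarrow> Fs \<alpha> k = Fs \<beta> k" for k
      by (induction k) (auto simp: Fs n(2))
    then have "Fs \<alpha> n = Fs \<beta> n" by simp
    moreover have "fst (p \<alpha>) \<in> fst ` sp (Fs \<alpha> n) n (\<alpha> n)" "fst (p \<beta>) \<in> fst ` sp (Fs \<beta> n) n (\<beta> n)"
      using p[of _ "Suc n"] by (auto simp: Fs)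
    ultimately show False using eq n(1) sp(4)[OF PFs, of \<alpha> n] by (cases "\<alpha> n"; cases "\<beta> n") auto
  qed
  moreover have "range (fst \<circ> p) \<subseteq> X" using p[of _ 0] C(2) by (auto simp: Fs)
  ultimately show thesis by (rule that)
qed

lemma uncountable_borel_real_non_borel_subset:
  assumes "X \<in> sets (borel :: real measure)" "uncountable X"
  obtains V where "V \<subseteq> X" "V \<notin> sets borel"
proof -
  obtain code :: "nat set \<Rightarrow> real set" where code: "sets borel \<subseteq> range code"
    using borel_real_coding by blast
  obtain \<psi> :: "(nat \<Rightarrow> bool) \<Rightarrow> real" where \<psi>: "inj \<psi>" "range \<psi> \<subseteq> X"
    using uncountable_analytic_real_inj[OF analytic_real_borel[OF assms(1)] assms(2)] by blast
  define V where "V = {\<psi> \<alpha> |\<alpha>. \<psi> \<alpha> \<notin> code (Collect \<alpha>)}"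
  have "V \<notin> sets borel"
  proof
    assume "V \<in> sets borel"
    then obtain S where "V = code S" using code by blast
    then have "\<psi> (\<lambda>n. n \<in> S) \<in> V \<longleftrightarrow> \<psi> (\<lambda>n. n \<in> S) \<notin> V"
    proof -
      have "\<psi> \<alpha> \<in> V \<longleftrightarrow> \<psi> \<alpha> \<notin> code (Collect \<alpha>)" for \<alpha>
        using \<psi>(1) unfolding V_def by (auto dest: injD)
      from this[of "\<lambda>n. n \<in> S"] show ?thesis using \<open>V = code S\<close> by simp
    qed
    then show False by blast
  qed
  moreover have "V \<subseteq> X" using \<psi>(2) by (auto simp: V_def)
  ultimately show thesis by (rule that[rotated])
qed

lemma nonseparable_imp_uncountable_separated:
  fixes Y :: "'b::metric_space set"
  assumes "\<And>D. countable D \<Longrightarrow> \<not> Y \<subseteq> closure D"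
  obtains Z e where "e > 0" "Z \<subseteq> Y" "uncountable Z"
    "\<And>x y. x \<in> Z \<Longrightarrow> y \<in> Z \<Longrightarrow> x \<noteq> y \<Longrightarrow> dist x y \<ge> e"
proof (rule ccontr)
  note th = that
  assume no: "\<not> thesis"
  define sep where "sep e Z \<longleftrightarrow> Z \<subseteq> Y \<and> (\<forall>x\<in>Z. \<forall>y\<in>Z. x \<noteq> y \<longrightarrow> dist x y \<ge> e)" for e and Z :: "'b set"
  have cnt: "countable Z" if eZ: "sep e Z" "e > 0" for e Z
    using no th[of e Z] eZ unfolding sep_def by blast
  have "\<exists>Z. sep e Z \<and> (\<forall>y\<in>Y. \<exists>z\<in>Z. dist z y < e)" if "e > 0" for e
  proof -
    have "\<exists>M\<in>{Z. sep e Z}. \<forall>X\<in>{Z. sep e Z}. M \<subseteq> X \<longrightarrow> X = M"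
    proof (rule subset_Zorn')
      fix c assume c: "subset.chain {Z. sep e Z} c"
      have cs: "\<And>Z. Z \<in> c \<Longrightarrow> sep e Z" and lin: "\<And>Z1 Z2. Z1 \<in> c \<Longrightarrow> Z2 \<in> c \<Longrightarrow> Z1 \<subseteq> Z2 \<or> Z2 \<subseteq> Z1"
        using c unfolding subset.chain_def by (auto simp: subset_eq)
      have "dist x y \<ge> e" if xy: "x \<in> \<Union>c" "y \<in> \<Union>c" "x \<noteq> y" for x y
      proof -
        obtain Z1 Z2 where Z: "Z1 \<in> c" "Z2 \<in> c" "x \<in> Z1" "y \<in> Z2" using xy by blast
        consider "Z1 \<subseteq> Z2" | "Z2 \<subseteq> Z1" using lin[OF Z(1,2)] by blast
        then show ?thesis
        proof cases
          case 1
          then show ?thesis using cs[OF Z(2)] Z xy(3) unfolding sep_def by blast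
        next
          case 2
          then show ?thesis using cs[OF Z(1)] Z xy(3) unfolding sep_def by blast
        qed
      qed
      moreover have "\<Union>c \<subseteq> Y" using cs unfolding sep_def by blast
      ultimately show "\<Union>c \<in> {Z. sep e Z}" by (simp add: sep_def)
    qed
    then obtain M where M: "sep e M" "\<And>X. sep e X \<Longrightarrow> M \<subseteq> X \<Longrightarrow> X = M" by (auto simp only: mem_Collect_eq)
    have "\<exists>z\<in>M. dist z y < e" if y: "y \<in> Y" for y
    proof (rule ccontr)
      assume n: "\<not> (\<exists>z\<in>M. dist z y < e)"
      then have "sep e (insert y M)"
        using M(1) y by (auto simp: sep_def dist_commute not_less)
      then have "y \<in> M" using M(2) by blast
      then show False using n \<open>e > 0\<close> by auto
    qed
    then show ?thesis using M(1) by blast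
  qed
  then obtain Z where Z: "\<And>e. e > 0 \<Longrightarrow> sep e (Z e)" "\<And>e y. e > 0 \<Longrightarrow> y \<in> Y \<Longrightarrow> \<exists>z\<in>Z e. dist z y < e"
    by metis
  define D where "D = (\<Union>n. Z (1 / real (Suc n)))"
  have "countable D" unfolding D_def by (intro countable_UN cnt[OF Z(1)]) auto
  moreover have "Y \<subseteq> closure D"
  proof
    fix y assume y: "y \<in> Y"
    show "y \<in> closure D"
      unfolding closure_approachable
    proof (intro allI impI)
      fix e :: real assume "e > 0"
      then obtain n where n: "1 / real (Suc n) < e" using nat_approx_posE by blast
      obtain z where "z \<in> Z (1 / real (Suc n))" "dist z y < 1 / real (Suc n)" using Z(2)[of "1 / real (Suc n)" y] y by auto
      then have "z \<in> D" "dist z y < e" using n unfolding D_def by auto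
      then show "\<exists>z\<in>D. dist z y < e" by blast
    qed
  qed
  ultimately show False using assms by blast
qed

text \<open>An uncountable \<open>e\<close>-separated family \<open>Z\<close> of values has a transversal \<open>X\<close> in the domain, which is the
  fixed point set of the Borel map \<open>k\<close> sending the preimage of each ball to its representative.
  Unions of the balls are open, so every subset of \<open>X\<close> is Borel.\<close>

lemma borel_measurable_real_separable_range:
  fixes f :: "real \<Rightarrow> 'b::metric_space"
  assumes "f \<in> borel_measurable borel"
  obtains D where "countable D" "range f \<subseteq> closure D"
proof (rule ccontr)
  note th = that
  assume no: "\<not> thesis"
  have "\<not> range f \<subseteq> closure D" if D: "countable D" for D
    using no D th[of D] by blast
  then obtain Z e where Z: "e > 0" "Z \<subseteq> range f" "uncountable Z"
    "\<And>x y. x \<in> Z \<Longrightarrow> y \<in> Z \<Longrightarrow> x \<noteq> y \<Longrightarrow> dist x y \<ge> e"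
    using nonseparable_imp_uncountable_separated[of "range f"] by (metis (no_types, lifting))
  define \<xi> where "\<xi> = inv_into UNIV f"
  have f\<xi>: "f (\<xi> z) = z" if "z \<in> Z" for z using that Z(2) by (auto simp: \<xi>_def f_inv_into_f)
  define W where "W B = f -` (\<Union>z\<in>{z\<in>Z. \<xi> z \<in> B}. ball z (e/2))" for B
  have Wb: "W B \<in> sets borel" for B
    unfolding W_def by (rule measurable_sets_borel[OF assms]) (auto intro: borel_open)
  define zz where "zz t = (SOME z. z \<in> Z \<and> dist z (f t) < e/2)" for t
  have uniq: "z = z'" if "z \<in> Z" "z' \<in> Z" "dist z (f t) < e/2" "dist z' (f t) < e/2" for z z' t
    using Z(4)[of z z'] that dist_triangle_half_l[of z "f t" e z'] by fastforce
  have zz: "zz t = z" if "z \<in> Z" "dist z (f t) < e/2" for z t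
    unfolding zz_def by (rule some_equality) (use that uniq in auto)
  define k where "k t = (if t \<in> W UNIV then \<xi> (zz t) else t + 1)" for t
  have Wk: "W B = {t \<in> W UNIV. k t \<in> B}" for B
    unfolding k_def by (auto simp: W_def zz)
  have kb: "k \<in> borel_measurable borel"
  proof (rule borel_measurableI)
    fix S :: "real set" assume S: "open S"
    have "k -` S \<inter> space borel = W S \<union> (- W UNIV \<inter> (\<lambda>t. t + 1) -` S)"
      unfolding Wk[of S] by (auto simp: k_def)
    moreover have "(\<lambda>t::real. t + 1) -` S \<in> sets borel"
      by (intro borel_open open_vimage S continuous_intros)
    ultimately show "k -` S \<inter> space borel \<in> sets borel" using Wb by auto
  qed
  define X where "X = {t. k t = t}"
  have "X \<in> sets borel"
  proof -
    have "X = {t \<in> space borel. k t = t}" by (simp add: X_def)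
    also have "\<dots> \<in> sets borel" using kb by measurable
    finally show ?thesis .
  qed
  have X: "X = \<xi> ` Z"
  proof (intro equalityI subsetI)
    fix t assume "t \<in> X"
    then have "t \<in> W UNIV" "\<xi> (zz t) = t" by (auto simp: X_def k_def split: if_splits)
    then show "t \<in> \<xi> ` Z" by (force simp: W_def zz)
  next
    fix t assume "t \<in> \<xi> ` Z"
    then obtain z where "z \<in> Z" "t = \<xi> z" by blast
    then show "t \<in> X" using f\<xi>[of z] zz[of z t] Z(1) by (force simp: X_def k_def W_def)
  qed
  have "inj_on \<xi> Z" using f\<xi> by (metis inj_on_def)
  then have "uncountable X" unfolding X using Z(3) countable_image_inj_on by blast
  then obtain V where V: "V \<subseteq> X" "V \<notin> sets borel"
    using uncountable_borel_real_non_borel_subset[OF \<open>X \<in> sets borel\<close>] by blast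
  have "V = W V \<inter> X"
  proof -
    have "k t = t \<and> t \<in> W UNIV" if "t \<in> X" for t
      using that by (auto simp: X_def k_def split: if_splits)
    then show ?thesis unfolding Wk[of V] using V(1) by auto
  qed
  then show False using V(2) Wb \<open>X \<in> sets borel\<close> by (metis sets.Int)
qed

lemma smeas_iff: "smeas f \<longleftrightarrow> f \<in> borel_measurable borel"
proof
  assume f: "f \<in> borel_measurable borel"
  obtain D where "countable D" "range f \<subseteq> closure D"
    using borel_measurable_real_separable_range[OF f] by blast
  then show "smeas f" using f unfolding smeas_def by (intro conjI exI[of _ D]) auto
qed (simp add: smeas_def)

lemma borel_measurable_continuous_Pair_real:
  fixes f :: "real \<Rightarrow> 'b::metric_space" and g :: "real \<Rightarrow> 'c::metric_space"
    and \<Phi> :: "'b \<Rightarrow> 'c \<Rightarrow> 'd::topological_space"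
  assumes f: "f \<in> borel_measurable borel" and g: "g \<in> borel_measurable borel"
    and \<Phi>: "continuous_on UNIV (\<lambda>z. \<Phi> (fst z) (snd z))"
  shows "(\<lambda>t. \<Phi> (f t) (g t)) \<in> borel_measurable borel"
proof (rule borel_measurableI)
  fix S :: "'d set" assume "open S"
  define U where "U = (\<lambda>z. \<Phi> (fst z) (snd z)) -` S"
  have U: "open U" unfolding U_def by (rule open_vimage[OF \<open>open S\<close> \<Phi>])
  obtain D E where D: "countable D" "range f \<subseteq> closure D" and E: "countable E" "range g \<subseteq> closure E"
    using borel_measurable_real_separable_range[OF f] borel_measurable_real_separable_range[OF g] by metis
  define I where "I = {(d, x, n). d \<in> D \<and> x \<in> E \<and> ball d (1 / real (Suc n)) \<times> ball x (1 / real (Suc n)) \<subseteq> U}"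
  have "I \<subseteq> D \<times> E \<times> UNIV" by (auto simp: I_def)
  then have cI: "countable I" using D E countable_subset by (metis countable_SIGMA countableI_type)
  have "(\<lambda>t. \<Phi> (f t) (g t)) -` S = (\<Union>(d, x, n)\<in>I. f -` ball d (1 / real (Suc n)) \<inter> g -` ball x (1 / real (Suc n)))"
  proof (intro equalityI subsetI)
    fix t assume "t \<in> (\<lambda>t. \<Phi> (f t) (g t)) -` S"
    then have "(f t, g t) \<in> U" by (auto simp: U_def)
    then obtain A B where AB: "open A" "open B" "f t \<in> A" "g t \<in> B" "A \<times> B \<subseteq> U"
      using open_prod_elim[OF U] by (metis mem_Sigma_iff)
    then obtain r s where rs: "r > 0" "s > 0" "ball (f t) r \<subseteq> A" "ball (g t) s \<subseteq> B"
      by (meson open_contains_ball)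
    obtain n where n: "1 / real (Suc n) < min r s / 2" using nat_approx_posE[of "min r s / 2"] rs by auto
    have "f t \<in> closure D" "g t \<in> closure E" using D E by auto
    then obtain d x where d: "d \<in> D" "dist d (f t) < 1 / Suc n" and x: "x \<in> E" "dist x (g t) < 1 / Suc n"
      unfolding closure_approachable by (meson of_nat_0_less_iff zero_less_Suc zero_less_divide_1_iff)
    have "ball d (1 / Suc n) \<subseteq> ball (f t) r" "ball x (1 / Suc n) \<subseteq> ball (g t) s"
    proof (safe)
      fix y assume y: "y \<in> ball d (1 / Suc n)"
      show "y \<in> ball (f t) r"
        using y d(2) n dist_triangle[of "f t" y d] by (simp add: dist_commute del: of_nat_Suc)
    next
      fix y assume y: "y \<in> ball x (1 / Suc n)"
      show "y \<in> ball (g t) s"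
        using y x(2) n dist_triangle[of "g t" y x] by (simp add: dist_commute del: of_nat_Suc)
    qed
    then have "ball d (1 / Suc n) \<times> ball x (1 / Suc n) \<subseteq> U" using rs AB by blast
    then have "(d, x, n) \<in> I" using d x by (auto simp: I_def)
    then show "t \<in> (\<Union>(d, x, n)\<in>I. f -` ball d (1 / real (Suc n)) \<inter> g -` ball x (1 / real (Suc n)))"
      using d x by force
  next
    fix t assume "t \<in> (\<Union>(d, x, n)\<in>I. f -` ball d (1 / real (Suc n)) \<inter> g -` ball x (1 / real (Suc n)))"
    then have "(f t, g t) \<in> U" by (auto simp: I_def)
    then show "t \<in> (\<lambda>t. \<Phi> (f t) (g t)) -` S" by (auto simp: U_def)
  qed
  moreover have "f -` ball d r \<inter> g -` ball x r \<in> sets borel" for d x r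
    by (intro sets.Int measurable_sets_borel[OF f] measurable_sets_borel[OF g]) auto
  then have "(\<Union>i\<in>I. f -` ball (fst i) (1 / real (Suc (snd (snd i)))) \<inter>
      g -` ball (fst (snd i)) (1 / real (Suc (snd (snd i))))) \<in> sets borel"
    by (intro sets.countable_UN'' cI)
  ultimately show "(\<lambda>t. \<Phi> (f t) (g t)) -` S \<inter> space borel \<in> sets borel"
    by (simp add: case_prod_beta)
qed

section \<open>Linear maximal monotone operators\<close>

definition rip :: "'a::chilbert \<Rightarrow> 'a \<Rightarrow> real" where
  "rip x y = Re (cinner x y)"

lemma rip_commute: "rip x y = rip y x"
  unfolding rip_def by (subst cinner_commute) simp

lemma rip_self: "rip x x = (norm x)\<^sup>2"
  unfolding rip_def by (simp add: cinner_norm)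

lemma rip_add_left: "rip (x + y) z = rip x z + rip y z"
  unfolding rip_def by (simp add: cinner_add_left)

lemma rip_scaleR_left: "rip (r *\<^sub>R x) y = r * rip x y"
  unfolding rip_def scaleC_of_real[symmetric] by (simp add: cinner_scaleC_left)

lemma rip_add_right: "rip z (x + y) = rip z x + rip z y"
  by (metis rip_commute rip_add_left)

lemma rip_scaleR_right: "rip y (r *\<^sub>R x) = r * rip y x"
  by (metis rip_commute rip_scaleR_left)

lemma rip_Cauchy_Schwarz: "\<bar>rip x y\<bar> \<le> norm x * norm y"
proof (cases "y = 0")
  case True
  then show ?thesis using rip_scaleR_right[of x 0 0] by simp
next
  case False
  define z where "z = (norm y)\<^sup>2 *\<^sub>R x + (- rip x y) *\<^sub>R y"
  have "(norm z)\<^sup>2 = (norm y)\<^sup>2 * ((norm x)\<^sup>2 * (norm y)\<^sup>2 - (rip x y)\<^sup>2)"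
  proof -
    have "rip z z = (norm y)\<^sup>2 * ((norm y)\<^sup>2 * rip x x - 2 * (rip x y)\<^sup>2) + (rip x y)\<^sup>2 * rip y y"
      unfolding z_def rip_add_left rip_add_right rip_scaleR_left rip_scaleR_right rip_commute[of y x]
      by (simp add: algebra_simps power2_eq_square)
    then show ?thesis by (simp add: rip_self algebra_simps)
  qed
  then have "(norm y)\<^sup>2 * ((norm x)\<^sup>2 * (norm y)\<^sup>2 - (rip x y)\<^sup>2) \<ge> 0"
    by (metis zero_le_power2)
  then have "(rip x y)\<^sup>2 \<le> (norm x * norm y)\<^sup>2"
    using False by (simp add: zero_le_mult_iff power_mult_distrib)
  then show ?thesis by (simp add: power2_le_iff_abs_le)
qed

interpretation rip: bounded_bilinear "rip :: 'a::chilbert \<Rightarrow> 'a \<Rightarrow> real"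
proof
  show "\<exists>K. \<forall>a b :: 'a. norm (rip a b) \<le> norm a * norm b * K"
    by (intro exI[of _ 1]) (simp add: rip_Cauchy_Schwarz)
qed (simp_all add: rip_add_left rip_add_right rip_scaleR_left rip_scaleR_right)

lemma rip_continuous_Pair: "continuous_on UNIV (\<lambda>z. rip (fst z) (snd z))"
  by (intro rip.continuous_on continuous_intros)

lemma norm_add_rip: "(norm (x + y))\<^sup>2 = (norm x)\<^sup>2 + 2 * rip x y + (norm y)\<^sup>2"
  unfolding rip_self[symmetric] by (simp add: rip.add_left rip.add_right rip_commute[of y x])

lemma norm_diff_rip: "(norm (x - y))\<^sup>2 = (norm x)\<^sup>2 - 2 * rip x y + (norm y)\<^sup>2"
  unfolding rip_self[symmetric] by (simp add: rip.diff_left rip.diff_right rip_commute[of y x])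

lemma closure_subspace_orthogonal_projection:
  fixes V :: "'a::chilbert set"
  assumes V: "subspace V"
  obtains p where "p \<in> closure V" "\<And>v. v \<in> V \<Longrightarrow> rip (x - p) v = 0"
proof -
  define d where "d = Inf ((\<lambda>v. norm (x - v)) ` V)"
  have ne: "(\<lambda>v. norm (x - v)) ` V \<noteq> {}" using subspace_0[OF V] by blast
  have bdd: "bdd_below ((\<lambda>v. norm (x - v)) ` V)" by (rule bdd_belowI[of _ 0]) auto
  have dle: "d \<le> norm (x - v)" if "v \<in> V" for v
    unfolding d_def using cInf_lower[OF _ bdd] that by blast
  have d0: "d \<ge> 0" unfolding d_def by (rule cInf_greatest[OF ne]) auto
  have "\<exists>v\<in>V. norm (x - v) < d + 1 / real (Suc n)" for n
  proof -
    have "d < d + 1 / real (Suc n)" by simp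
    then show ?thesis unfolding d_def using cInf_lessD[OF ne] by blast
  qed
  then obtain v where v: "\<And>n. v n \<in> V" "\<And>n. norm (x - v n) < d + 1 / real (Suc n)" by metis
  have close: "(norm (v n - v m))\<^sup>2 \<le> 4 * (2 * d + 1) / real (Suc N)" if "n \<ge> N" "m \<ge> N" for n m N
  proof -
    define e where "e = 1 / real (Suc N)"
    have e: "0 < e" "e \<le> 1" by (auto simp: e_def)
    have sq: "(norm (x - v k))\<^sup>2 \<le> d\<^sup>2 + (2 * d + 1) * e" if "k \<ge> N" for k
    proof -
      have "1 / real (Suc k) \<le> e" unfolding e_def using that by (simp add: frac_le)
      then have "norm (x - v k) \<le> d + e" using v(2)[of k] by linarith
      then have "(norm (x - v k))\<^sup>2 \<le> (d + e)\<^sup>2" by (intro power_mono) auto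
      also have "\<dots> = d\<^sup>2 + (2 * d + e) * e" by (simp add: power2_eq_square algebra_simps)
      also have "\<dots> \<le> d\<^sup>2 + (2 * d + 1) * e" using e by (intro add_left_mono mult_right_mono) auto
      finally show ?thesis .
    qed
    define w where "w = (1/2) *\<^sub>R (v n + v m)"
    have "w \<in> V" unfolding w_def using V v(1) by (simp add: subspace_add subspace_scale)
    then have "d\<^sup>2 \<le> (norm (x - w))\<^sup>2" using dle d0 by (intro power_mono) auto
    moreover have "(norm (v n - v m))\<^sup>2 + 4 * (norm (x - w))\<^sup>2 = 2 * (norm (x - v n))\<^sup>2 + 2 * (norm (x - v m))\<^sup>2"
    proof -
      have "2 *\<^sub>R (x - w) = (x - v n) + (x - v m)"
        by (simp add: w_def algebra_simps scaleR_2)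
      moreover have "(norm (2 *\<^sub>R (x - w)))\<^sup>2 = 4 * (norm (x - w))\<^sup>2" by (simp add: power_mult_distrib)
      ultimately have "4 * (norm (x - w))\<^sup>2 = (norm ((x - v n) + (x - v m)))\<^sup>2" by simp
      moreover have "(norm (v n - v m))\<^sup>2 = (norm ((x - v m) - (x - v n)))\<^sup>2" by simp
      ultimately show ?thesis unfolding norm_add_rip norm_diff_rip[of "x - v m"] by (simp add: rip_commute)
    qed
    ultimately have "(norm (v n - v m))\<^sup>2 \<le> 4 * ((2 * d + 1) * e)"
      using sq[OF that(1)] sq[OF that(2)] by linarith
    then show ?thesis by (simp add: e_def)
  qed
  have "Cauchy v"
  proof (rule CauchyI)
    fix e :: real assume "e > 0"
    have "4 * (2 * d + 1) / e\<^sup>2 > 0" using d0 \<open>e > 0\<close> by (intro divide_pos_pos) auto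
    obtain N where "4 * (2 * d + 1) / e\<^sup>2 < real N" using reals_Archimedean2 by blast
    then have N: "4 * (2 * d + 1) / e\<^sup>2 < real (Suc N)" by simp
    then have lt: "4 * (2 * d + 1) / real (Suc N) < e\<^sup>2"
      using \<open>e > 0\<close> by (simp add: field_simps)
    have "norm (v m - v n) < e" if "m \<ge> N" "n \<ge> N" for m n
    proof -
      have "(norm (v m - v n))\<^sup>2 < e\<^sup>2" using close[OF that] lt by linarith
      then show ?thesis using \<open>e > 0\<close> by (simp add: power2_less_imp_less)
    qed
    then show "\<exists>M. \<forall>m\<ge>M. \<forall>n\<ge>M. norm (v m - v n) < e" by blast
  qed
  then obtain p where p: "v \<longlonglongrightarrow> p" using Cauchy_convergent convergent_def by blast
  have "p \<in> closure V" using p v(1) closure_sequential by blast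
  moreover have "rip (x - p) u = 0" if u: "u \<in> V" for u
  proof -
    have "norm (x - p) \<le> d"
    proof (rule LIMSEQ_le)
      show "(\<lambda>n. norm (x - v n)) \<longlonglongrightarrow> norm (x - p)" by (intro tendsto_intros p)
      show "(\<lambda>n. d + 1 / real (Suc n)) \<longlonglongrightarrow> d"
        using tendsto_add[OF tendsto_const LIMSEQ_inverse_real_of_nat, of d]
        by (simp add: inverse_eq_divide)
      show "\<exists>N. \<forall>n\<ge>N. norm (x - v n) \<le> d + 1 / real (Suc n)" using v(2) less_imp_le by blast
    qed
    moreover have "d \<le> norm (x - p - t *\<^sub>R u)" for t
    proof (rule LIMSEQ_le_const)
      show "(\<lambda>n. norm (x - v n - t *\<^sub>R u)) \<longlonglongrightarrow> norm (x - p - t *\<^sub>R u)" by (intro tendsto_intros p)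
      have "d \<le> norm (x - v n - t *\<^sub>R u)" for n
        using dle[of "v n + t *\<^sub>R u"] V v(1) u by (simp add: subspace_add subspace_scale diff_diff_eq)
      then show "\<exists>N. \<forall>n\<ge>N. d \<le> norm (x - v n - t *\<^sub>R u)" by blast
    qed
    ultimately have "norm (x - p) \<le> norm (x - p - t *\<^sub>R u)" for t using order_trans by blast
    then have le: "(norm (x - p))\<^sup>2 \<le> (norm (x - p - t *\<^sub>R u))\<^sup>2" for t by (intro power_mono) auto
    have *: "0 \<le> - 2 * t * rip (x - p) u + t\<^sup>2 * (norm u)\<^sup>2" for t
      using le[of t] unfolding norm_diff_rip[of "x - p" "t *\<^sub>R u"]
      by (simp add: rip.scaleR_right power_mult_distrib mult.assoc)
    show ?thesis
    proof (cases "u = 0")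
      case True
      then show ?thesis by (simp add: rip.zero_right)
    next
      case False
      define r b where "r = rip (x - p) u" and "b = (norm u)\<^sup>2"
      have b: "b > 0" using False by (simp add: b_def)
      have "0 \<le> - 2 * (r / b) * r + (r / b)\<^sup>2 * b" using *[of "r / b"] by (simp add: r_def b_def)
      also have "\<dots> = - r\<^sup>2 / b" using b by (simp add: field_simps power2_eq_square)
      finally have "r\<^sup>2 \<le> 0" using b by (simp add: divide_le_0_iff)
      then have "(rip (x - p) u)\<^sup>2 \<le> 0" by (simp add: r_def)
      then show ?thesis by simp
    qed
  qed
  ultimately show thesis by (rule that)
qed

lemma selfadjoint_nonneg_of_range:
  fixes M :: "'a::chilbert \<Rightarrow> 'a"
  assumes M: "bounded_linear M" and sa: "\<And>x y. rip (M x) y = rip x (M y)"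
    and pos: "\<And>x. x \<in> range M \<Longrightarrow> rip (M x) x \<ge> 0"
  shows "rip (M x) x \<ge> 0"
proof -
  interpret M: bounded_linear M by fact
  have "subspace (range M)"
    using linear_subspace_image[OF M.linear_axioms subspace_UNIV] .
  then obtain p where p: "p \<in> closure (range M)" "\<And>v. v \<in> range M \<Longrightarrow> rip (x - p) v = 0"
    using closure_subspace_orthogonal_projection by blast
  have "rip (M (x - p)) (M (x - p)) = 0" using p(2) by (simp add: sa)
  then have eq: "M x = M p" by (simp add: rip_self M.diff)
  obtain s where s: "\<And>n. s n \<in> range M" "s \<longlonglongrightarrow> p" using p(1) closure_sequential by blast
  have "(\<lambda>n. rip (M (s n)) (s n)) \<longlonglongrightarrow> rip (M p) p"
    by (intro rip.tendsto M.tendsto s)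
  then have "rip (M p) p \<ge> 0" using pos[OF s(1)] LIMSEQ_le_const by blast
  moreover have "rip (M x) x = rip (M p) p" using eq sa by metis
  ultimately show ?thesis by simp
qed

lemma nonneg_form_Young:
  fixes M :: "'a::chilbert \<Rightarrow> 'a"
  assumes M: "linear M" and sa: "\<And>x y. rip (M x) y = rip x (M y)"
    and pos: "\<And>x. rip (M x) x \<ge> 0" and s: "s > 0"
  shows "2 * rip (M a) b \<le> s * rip (M a) a + rip (M b) b / s"
proof -
  have "0 \<le> rip (M (s *\<^sub>R a - b)) (s *\<^sub>R a - b)" by (rule pos)
  also have "\<dots> = s * (s * rip (M a) a + rip (M b) b / s - 2 * rip (M a) b)"
    using s sa[of b a] rip_commute[of b "M a"]
    by (simp add: linear_diff[OF M] linear_scale[OF M] rip.diff_left rip.diff_right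
        rip.scaleR_left rip.scaleR_right algebra_simps)
  finally show ?thesis using s by (simp add: zero_le_mult_iff)
qed

locale linear_maximal_monotone =
  fixes DA :: "'a::chilbert set" and A :: "'a \<Rightarrow> 'a"
  assumes subspace_DA: "subspace DA"
    and A_add: "x \<in> DA \<Longrightarrow> y \<in> DA \<Longrightarrow> A (x + y) = A x + A y"
    and A_scaleR: "x \<in> DA \<Longrightarrow> A (r *\<^sub>R x) = r *\<^sub>R A x"
    and A_mono: "x \<in> DA \<Longrightarrow> rip (A x) x \<ge> 0"
    and A_max: "(\<And>x. x \<in> DA \<Longrightarrow> rip (A x - w) (x - y) \<ge> 0) \<Longrightarrow> y \<in> DA \<and> A y = w"

lemma linear_maximal_monotoneI:
  assumes lin: "linear_op DA A" and mm: "maximal_monotone DA A"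
  shows "linear_maximal_monotone DA A"
proof
  have sc: "r *\<^sub>R x \<in> DA \<and> A (r *\<^sub>R x) = r *\<^sub>R A x" if "x \<in> DA" for r x
    using lin that unfolding linear_op_def scaleC_of_real[symmetric] by blast
  show sub: "subspace DA" using lin sc unfolding linear_op_def subspace_def by blast
  show "A (x + y) = A x + A y" if "x \<in> DA" "y \<in> DA" for x y using lin that unfolding linear_op_def by blast
  show "A (r *\<^sub>R x) = r *\<^sub>R A x" if "x \<in> DA" for r x using sc that by blast
  have A0: "A 0 = 0" using sc[of 0 0] lin by (auto simp: linear_op_def)
  have mono: "rip (A x - A y) (x - y) \<ge> 0" if "x \<in> DA" "y \<in> DA" for x y
    using mm that unfolding maximal_monotone_def monotone_rel_def rip_def by blast
  show "rip (A x) x \<ge> 0" if "x \<in> DA" for x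
    using mono[OF that subspace_0[OF sub]] A0 by simp
  show "y \<in> DA \<and> A y = w" if *: "\<And>x. x \<in> DA \<Longrightarrow> rip (A x - w) (x - y) \<ge> 0" for y w
  proof -
    define G where "G = insert (y, w) {(x, A x) |x. x \<in> DA}"
    have "rip (w - A x) (y - x) \<ge> 0" if "x \<in> DA" for x
    proof -
      have "rip (w - A x) (y - x) = rip (- (A x - w)) (- (x - y))" by simp
      also have "\<dots> = rip (A x - w) (x - y)" by (simp only: rip.minus_left rip.minus_right minus_minus)
      finally show ?thesis using *[OF that] by simp
    qed
    then have "monotone_rel G"
      using mono * unfolding monotone_rel_def G_def rip_def[symmetric]
      by (auto simp: rip.zero_left)
    moreover have "{(x, A x) |x. x \<in> DA} \<subseteq> G" by (simp add: G_def subset_insertI)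
    ultimately have "G = {(x, A x) |x. x \<in> DA}"
      using mm[unfolded maximal_monotone_def, THEN conjunct2, rule_format, of G] by simp
    moreover have "(y, w) \<in> G" by (simp add: G_def)
    ultimately show ?thesis by auto
  qed
qed

context linear_maximal_monotone
begin

lemma A_zero: "A 0 = 0"
  using A_scaleR[OF subspace_0[OF subspace_DA], of 0] by simp

lemma A_diff: "x \<in> DA \<Longrightarrow> y \<in> DA \<Longrightarrow> A (x - y) = A x - A y"
  using A_add[of "x - y" y] subspace_diff[OF subspace_DA, of x y] by (simp add: eq_diff_eq)

lemma A_closed_graph:
  assumes "\<And>n. s n \<in> DA" "s \<longlonglongrightarrow> x" "(\<lambda>n. A (s n)) \<longlonglongrightarrow> w"
  shows "x \<in> DA" "A x = w"
proof -
  have "rip (A z - w) (z - x) \<ge> 0" if z: "z \<in> DA" for z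
  proof (rule LIMSEQ_le_const)
    show "(\<lambda>n. rip (A z - A (s n)) (z - s n)) \<longlonglongrightarrow> rip (A z - w) (z - x)"
      by (intro rip.tendsto tendsto_intros assms)
    show "\<exists>N. \<forall>n\<ge>N. 0 \<le> rip (A z - A (s n)) (z - s n)"
      using A_mono[OF subspace_diff[OF subspace_DA z assms(1)]] A_diff[OF z assms(1)] by auto
  qed
  then show "x \<in> DA" "A x = w" using A_max by blast+
qed

lemma dense_domain: "closure DA = UNIV"
proof -
  have "x \<in> closure DA" for x
  proof -
    obtain p where p: "p \<in> closure DA" "\<And>v. v \<in> DA \<Longrightarrow> rip (x - p) v = 0"
      using closure_subspace_orthogonal_projection[OF subspace_DA] by blast
    have "rip (A z - (x - p)) (z - 0) \<ge> 0" if "z \<in> DA" for z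
      using A_mono[OF that] p(2)[OF that] by (simp add: rip.diff_left)
    then have "A 0 = x - p" using A_max by blast
    then show ?thesis using p(1) A_zero by simp
  qed
  then show ?thesis by blast
qed

lemma surj_scale_plus:
  assumes l: "l > 0"
  shows "\<exists>x\<in>DA. l *\<^sub>R x + A x = y"
proof -
  define R where "R = (\<lambda>x. l *\<^sub>R x + A x) ` DA"
  have est: "l * norm x \<le> norm (l *\<^sub>R x + A x)" if "x \<in> DA" for x
  proof (cases "x = 0")
    case False
    have "l * (norm x)\<^sup>2 \<le> rip (l *\<^sub>R x + A x) x"
      using A_mono[OF that] by (simp add: rip.add_left rip.scaleR_left rip_self)
    also have "\<dots> \<le> norm (l *\<^sub>R x + A x) * norm x" using rip_Cauchy_Schwarz abs_le_D1 by blast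
    finally show ?thesis using False by (simp add: power2_eq_square)
  qed simp
  have sub: "subspace R"
    unfolding subspace_def R_def
  proof (intro conjI ballI allI)
    show "0 \<in> (\<lambda>x. l *\<^sub>R x + A x) ` DA" using subspace_0[OF subspace_DA] A_zero by force
  next
    fix a b assume "a \<in> (\<lambda>x. l *\<^sub>R x + A x) ` DA" "b \<in> (\<lambda>x. l *\<^sub>R x + A x) ` DA"
    then obtain x z where xz: "x \<in> DA" "z \<in> DA" "a = l *\<^sub>R x + A x" "b = l *\<^sub>R z + A z" by blast
    then have "a + b = l *\<^sub>R (x + z) + A (x + z)" by (simp add: A_add scaleR_add_right)
    then show "a + b \<in> (\<lambda>x. l *\<^sub>R x + A x) ` DA" using subspace_add[OF subspace_DA xz(1,2)] by blast
  next
    fix r a assume "a \<in> (\<lambda>x. l *\<^sub>R x + A x) ` DA"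
    then obtain x where x: "x \<in> DA" "a = l *\<^sub>R x + A x" by blast
    then have "r *\<^sub>R a = l *\<^sub>R (r *\<^sub>R x) + A (r *\<^sub>R x)" by (simp add: A_scaleR algebra_simps)
    then show "r *\<^sub>R a \<in> (\<lambda>x. l *\<^sub>R x + A x) ` DA" using subspace_scale[OF subspace_DA x(1)] by blast
  qed
  have clos: "p \<in> R" if p: "p \<in> closure R" for p
  proof -
    obtain s where s: "\<And>n. s n \<in> R" "s \<longlonglongrightarrow> p" using p closure_sequential by blast
    then obtain x where x: "\<And>n. x n \<in> DA" "\<And>n. s n = l *\<^sub>R x n + A (x n)"
      unfolding R_def image_iff by metis
    have bound: "norm (x m - x n) \<le> norm (s m - s n) / l" for m n
    proof -
      have "l *\<^sub>R (x m - x n) + A (x m - x n) = s m - s n"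
        unfolding x(2) by (simp add: A_diff x(1) algebra_simps)
      then have "l * norm (x m - x n) \<le> norm (s m - s n)"
        using est[OF subspace_diff[OF subspace_DA x(1) x(1)], of m n] by simp
      then show ?thesis using l by (simp add: field_simps)
    qed
    have "Cauchy x"
    proof (rule CauchyI)
      fix e :: real assume "e > 0"
      then obtain M where M: "\<And>m n. m \<ge> M \<Longrightarrow> n \<ge> M \<Longrightarrow> norm (s m - s n) < e * l"
        using CauchyD[OF LIMSEQ_imp_Cauchy[OF s(2)], of "e * l"] l by auto
      have "norm (x m - x n) < e" if "m \<ge> M" "n \<ge> M" for m n
      proof -
        have "norm (x m - x n) * l \<le> norm (s m - s n)" using bound[of m n] l by (simp add: pos_le_divide_eq)
        then have "norm (x m - x n) * l < e * l" using M[OF that] by linarith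
        then show ?thesis using l by simp
      qed
      then show "\<exists>M. \<forall>m\<ge>M. \<forall>n\<ge>M. norm (x m - x n) < e" by blast
    qed
    then obtain z where z: "x \<longlonglongrightarrow> z" using Cauchy_convergent convergent_def by blast
    have "(\<lambda>n. s n - l *\<^sub>R x n) \<longlonglongrightarrow> p - l *\<^sub>R z" by (intro tendsto_intros s z)
    then have "(\<lambda>n. A (x n)) \<longlonglongrightarrow> p - l *\<^sub>R z" by (simp add: x(2))
    from A_closed_graph[OF x(1) z this] show ?thesis unfolding R_def by force
  qed
  obtain p where p: "p \<in> closure R" "\<And>v. v \<in> R \<Longrightarrow> rip (y - p) v = 0"
    using closure_subspace_orthogonal_projection[OF sub] by blast
  define z where "z = y - p"
  have orth: "rip (A x) z = - l * rip x z" if "x \<in> DA" for x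
    using p(2)[of "l *\<^sub>R x + A x"] that
    unfolding R_def z_def[symmetric] by (simp add: rip.add_right rip.scaleR_right rip_commute[of z])
  have "rip (A x - l *\<^sub>R z) (x - z) \<ge> 0" if "x \<in> DA" for x
    using A_mono[OF that] orth[OF that] l
    by (simp add: rip.diff_left rip.diff_right rip.scaleR_left rip_self rip_commute[of z x] algebra_simps)
  then have z: "z \<in> DA" "A z = l *\<^sub>R z" using A_max by blast+
  then have "l * (norm z)\<^sup>2 = - l * (norm z)\<^sup>2" using orth[OF z(1)] by (simp add: rip.scaleR_left rip_self)
  then have "z = 0" using l by simp
  then show ?thesis using clos[OF p(1)] unfolding R_def z_def by auto
qed

lemma coercive_plus_estimate:
  assumes co: "\<And>x. rip (B x) x \<ge> c * (norm x)\<^sup>2" and x: "x \<in> DA"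
  shows "c * norm x \<le> norm (B x + A x)"
proof (cases "x = 0")
  case False
  have "c * (norm x)\<^sup>2 \<le> rip (B x + A x) x"
    using A_mono[OF x] co[of x] by (simp add: rip.add_left)
  also have "\<dots> \<le> norm (B x + A x) * norm x" using rip_Cauchy_Schwarz abs_le_D1 by blast
  finally show ?thesis using False by (simp add: power2_eq_square)
qed simp

text \<open>For \<open>l = K\<^sup>2 / c\<close> the map \<open>x \<mapsto> (l + A)\<^sup>-\<^sup>1 (y + l x - B x)\<close> is a strict contraction.\<close>

lemma surj_coercive_plus:
  assumes B: "bounded_linear B" and c: "c > 0" and co: "\<And>x. rip (B x) x \<ge> c * (norm x)\<^sup>2"
  shows "\<exists>x\<in>DA. B x + A x = y"
proof -
  interpret B: bounded_linear B by fact
  obtain K0 where K0: "K0 > 0" "\<And>x. norm (B x) \<le> norm x * K0" using B.pos_bounded by blast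
  define K where "K = max K0 c"
  have K: "K > 0" "K \<ge> c" "\<And>x. norm (B x) \<le> norm x * K"
    using K0 by (auto simp: K_def) (meson max.cobounded1 mult_left_mono norm_ge_zero order_trans)
  define l where "l = K\<^sup>2 / c"
  have "K * c \<le> K * K" using K c by (intro mult_left_mono) auto
  then have l: "l > 0" "l \<ge> K" using K c by (auto simp: l_def power2_eq_square field_simps)
  obtain J where J: "\<And>y. J y \<in> DA" "\<And>y. l *\<^sub>R J y + A (J y) = y"
    using surj_scale_plus[OF l(1)] by metis
  have Jlip: "l * norm (J a - J b) \<le> norm (a - b)" for a b
  proof -
    have "l *\<^sub>R (J a - J b) + A (J a - J b) = a - b"
    proof -
      have "l *\<^sub>R (J a - J b) + A (J a - J b) = (l *\<^sub>R J a + A (J a)) - (l *\<^sub>R J b + A (J b))"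
        by (simp add: A_diff J(1) algebra_simps)
      then show ?thesis by (simp only: J(2))
    qed
    then show ?thesis
      using coercive_plus_estimate[of l "\<lambda>x. l *\<^sub>R x" "J a - J b"] subspace_diff[OF subspace_DA J(1) J(1)]
      by (simp add: rip.scaleR_left rip_self)
  qed
  define q where "q = sqrt (l\<^sup>2 - K\<^sup>2) / l"
  have "l\<^sup>2 - K\<^sup>2 \<ge> 0" using l K by (simp add: power_mono)
  have q: "0 \<le> q" "q < 1"
  proof -
    have "sqrt (l\<^sup>2 - K\<^sup>2) < sqrt (l\<^sup>2)" using K by (intro real_sqrt_less_mono) simp
    then show "q < 1" using l by (simp add: q_def)
    show "0 \<le> q" using l \<open>l\<^sup>2 - K\<^sup>2 \<ge> 0\<close> by (simp add: q_def)
  qed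
  have contr: "norm (l *\<^sub>R x - B x) \<le> l * q * norm x" for x
  proof (rule power2_le_imp_le)
    have "(norm (l *\<^sub>R x - B x))\<^sup>2 = l\<^sup>2 * (norm x)\<^sup>2 - 2 * l * rip (B x) x + (norm (B x))\<^sup>2"
      unfolding norm_diff_rip by (simp add: rip.scaleR_left rip_commute[of x] power_mult_distrib)
    also have "\<dots> \<le> l\<^sup>2 * (norm x)\<^sup>2 - 2 * l * (c * (norm x)\<^sup>2) + (norm x * K)\<^sup>2"
      using co[of x] K(3)[of x] l by (intro add_mono diff_mono mult_left_mono power_mono) auto
    also have "\<dots> = (l\<^sup>2 - K\<^sup>2) * (norm x)\<^sup>2"
      using c by (simp add: l_def power_mult_distrib algebra_simps)
    also have "\<dots> = (l * q * norm x)\<^sup>2"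
      using l \<open>l\<^sup>2 - K\<^sup>2 \<ge> 0\<close> by (simp add: q_def power_mult_distrib power_divide)
    finally show "(norm (l *\<^sub>R x - B x))\<^sup>2 \<le> (l * q * norm x)\<^sup>2" .
    show "0 \<le> l * q * norm x" using l q by simp
  qed
  define \<Phi> where "\<Phi> x = J (y + (l *\<^sub>R x - B x))" for x
  have "dist (\<Phi> a) (\<Phi> b) \<le> q * dist a b" for a b
  proof -
    have "l * norm (\<Phi> a - \<Phi> b) \<le> norm (l *\<^sub>R (a - b) - B (a - b))"
      using Jlip[of "y + (l *\<^sub>R a - B a)" "y + (l *\<^sub>R b - B b)"]
      by (simp add: \<Phi>_def B.diff algebra_simps)
    also have "\<dots> \<le> l * q * norm (a - b)" by (rule contr)
    finally show ?thesis using l by (simp add: dist_norm mult.assoc)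
  qed
  then obtain x where x: "\<Phi> x = x" using banach_fix_type[OF q, of \<Phi>] by blast
  then have "x \<in> DA" "l *\<^sub>R x + A x = y + (l *\<^sub>R x - B x)"
    using J(1)[of "y + (l *\<^sub>R x - B x)"] J(2)[of "y + (l *\<^sub>R x - B x)"] unfolding \<Phi>_def by auto
  then show ?thesis by (intro bexI[of _ x]) (auto simp: algebra_simps)
qed

lemma coercive_resolvent:
  assumes B: "bounded_linear B" and c: "c > 0" and co: "\<And>x. rip (B x) x \<ge> c * (norm x)\<^sup>2"
  obtains R where "bounded_linear R" "\<And>y. R y \<in> DA" "\<And>y. B (R y) + A (R y) = y"
proof -
  interpret B: bounded_linear B by fact
  obtain R where R: "\<And>y. R y \<in> DA" "\<And>y. B (R y) + A (R y) = y"
    using surj_coercive_plus[OF B c co] by metis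
  have inj: "x = z" if "x \<in> DA" "z \<in> DA" "B x + A x = B z + A z" for x z
  proof -
    have "B (x - z) + A (x - z) = 0" using that by (simp add: B.diff A_diff algebra_simps)
    then have "c * norm (x - z) \<le> 0"
      using coercive_plus_estimate[OF co subspace_diff[OF subspace_DA that(1,2)]] by simp
    then show ?thesis using c by (simp add: mult_le_0_iff)
  qed
  have "bounded_linear R"
  proof (rule bounded_linear_intro[where K = "1 / c"])
    fix x y
    have "B (R x + R y) + A (R x + R y) = (B (R x) + A (R x)) + (B (R y) + A (R y))"
      by (simp add: B.add A_add R(1) algebra_simps)
    then have "B (R x + R y) + A (R x + R y) = B (R (x + y)) + A (R (x + y))" by (simp only: R(2))
    then show "R (x + y) = R x + R y"
      using inj[OF R(1) subspace_add[OF subspace_DA R(1) R(1)]] by metis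
  next
    fix r x
    have "B (r *\<^sub>R R x) + A (r *\<^sub>R R x) = r *\<^sub>R (B (R x) + A (R x))"
      by (simp add: B.scaleR A_scaleR R(1) scaleR_add_right)
    then have "B (r *\<^sub>R R x) + A (r *\<^sub>R R x) = B (R (r *\<^sub>R x)) + A (R (r *\<^sub>R x))" by (simp only: R(2))
    then show "R (r *\<^sub>R x) = r *\<^sub>R R x"
      using inj[OF R(1) subspace_scale[OF subspace_DA R(1)]] by metis
  next
    fix x
    have "c * norm (R x) \<le> norm (B (R x) + A (R x))" by (rule coercive_plus_estimate[OF co R(1)])
    then have "c * norm (R x) \<le> norm x" by (simp only: R(2))
    then show "norm (R x) \<le> norm x * (1 / c)" using c by (simp add: field_simps)
  qed
  then show thesis using R that by blast
qed

end

section \<open>Weighted square-integrable functions\<close>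

lemma borel_measurable_real_add:
  fixes f g :: "real \<Rightarrow> 'a::chilbert"
  shows "f \<in> borel_measurable borel \<Longrightarrow> g \<in> borel_measurable borel \<Longrightarrow> (\<lambda>t. f t + g t) \<in> borel_measurable borel"
  by (rule borel_measurable_continuous_Pair_real[where \<Phi> = "(+)"]) (auto intro!: continuous_intros)

lemma borel_measurable_real_diff:
  fixes f g :: "real \<Rightarrow> 'a::chilbert"
  shows "f \<in> borel_measurable borel \<Longrightarrow> g \<in> borel_measurable borel \<Longrightarrow> (\<lambda>t. f t - g t) \<in> borel_measurable borel"
  by (rule borel_measurable_continuous_Pair_real[where \<Phi> = "(-)"]) (auto intro!: continuous_intros)

lemma borel_measurable_real_scaleR:
  fixes f :: "real \<Rightarrow> 'a::chilbert" and r :: "real \<Rightarrow> real"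
  shows "r \<in> borel_measurable borel \<Longrightarrow> f \<in> borel_measurable borel \<Longrightarrow> (\<lambda>t. r t *\<^sub>R f t) \<in> borel_measurable borel"
  by (rule borel_measurable_continuous_Pair_real[where \<Phi> = "(*\<^sub>R)"]) (auto intro!: continuous_intros)

lemma borel_measurable_real_rip:
  fixes f g :: "real \<Rightarrow> 'a::chilbert"
  shows "f \<in> borel_measurable borel \<Longrightarrow> g \<in> borel_measurable borel \<Longrightarrow> (\<lambda>t. rip (f t) (g t)) \<in> borel_measurable borel"
  by (rule borel_measurable_continuous_Pair_real[where \<Phi> = rip]) (auto intro!: rip_continuous_Pair)

lemma borel_measurable_real_dist:
  fixes f g :: "real \<Rightarrow> 'a::chilbert"
  shows "f \<in> borel_measurable borel \<Longrightarrow> g \<in> borel_measurable borel \<Longrightarrow> (\<lambda>t. dist (f t) (g t)) \<in> borel_measurable borel"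
  by (rule borel_measurable_continuous_Pair_real[where \<Phi> = dist]) (auto intro!: continuous_intros)

lemma borel_measurable_real_bounded_linear:
  fixes f :: "real \<Rightarrow> 'a::chilbert"
  assumes "bounded_linear M" "f \<in> borel_measurable borel"
  shows "(\<lambda>t. M (f t)) \<in> borel_measurable borel"
  using measurable_compose[OF assms(2) borel_measurable_continuous_onI[OF linear_continuous_on[OF assms(1)]]] .

definition L2k :: "(real \<Rightarrow> real) \<Rightarrow> (real \<Rightarrow> 'a::chilbert) set" where
  "L2k k = {f. f \<in> borel_measurable borel \<and> integrable lborel (\<lambda>t. (norm (f t))\<^sup>2 * k t)}"

definition nk :: "(real \<Rightarrow> real) \<Rightarrow> (real \<Rightarrow> 'a::chilbert) \<Rightarrow> real" where
  "nk k f = sqrt (\<integral>t. (norm (f t))\<^sup>2 * k t \<partial>lborel)"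

definition ipk :: "(real \<Rightarrow> real) \<Rightarrow> (real \<Rightarrow> 'a::chilbert) \<Rightarrow> (real \<Rightarrow> 'a) \<Rightarrow> real" where
  "ipk k f g = (\<integral>t. rip (f t) (g t) * k t \<partial>lborel)"

lemma L2w_eq: "L2w \<rho> = L2k (\<lambda>t. exp (- 2 * \<rho> * t))"
  unfolding L2w_def L2k_def smeas_iff by simp

lemma normw_eq: "normw \<rho> = nk (\<lambda>t. exp (- 2 * \<rho> * t))"
  unfolding normw_def nk_def by (rule refl)

lemma norm_add_sq_le: "(norm (x + y :: 'a::real_normed_vector))\<^sup>2 \<le> 2 * (norm x)\<^sup>2 + 2 * (norm y)\<^sup>2"
proof -
  have "(norm (x + y))\<^sup>2 \<le> (norm x + norm y)\<^sup>2" by (intro power_mono norm_triangle_ineq) simp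
  also have "\<dots> \<le> 2 * (norm x)\<^sup>2 + 2 * (norm y)\<^sup>2"
    using sum_squares_bound[of "norm x" "norm y"] by (simp add: power2_sum)
  finally show ?thesis .
qed

locale weight =
  fixes k :: "real \<Rightarrow> real"
  assumes k_cont: "continuous_on UNIV k" and k_pos: "\<And>t. k t > 0"
begin

lemma k_nonneg: "k t \<ge> 0" using k_pos[of t] by simp

lemma k_meas[measurable]: "k \<in> borel_measurable borel"
  by (rule borel_measurable_continuous_onI[OF k_cont])

lemma L2k_meas: "f \<in> L2k k \<Longrightarrow> f \<in> borel_measurable borel"
  by (simp add: L2k_def)

lemma sq_meas:
  fixes f :: "real \<Rightarrow> 'a::chilbert"
  assumes f: "f \<in> borel_measurable borel"
  shows "(\<lambda>t. (norm (f t))\<^sup>2 * k t) \<in> borel_measurable borel"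
proof -
  have "(\<lambda>t. norm (f t)) \<in> borel_measurable borel"
    using measurable_compose[OF f borel_measurable_continuous_onI[OF continuous_on_norm_id]] .
  then show ?thesis by measurable
qed

lemma L2k_bound:
  fixes f :: "real \<Rightarrow> 'a::chilbert"
  assumes f: "f \<in> borel_measurable borel" and h: "integrable lborel h"
    and le: "AE t in lborel. (norm (f t))\<^sup>2 * k t \<le> h t"
  shows "f \<in> L2k k"
proof -
  have "integrable lborel (\<lambda>t. (norm (f t))\<^sup>2 * k t)"
    by (rule Bochner_Integration.integrable_bound[OF h])
      (use sq_meas[OF f] le k_nonneg in \<open>auto elim!: eventually_mono intro: order_trans\<close>)
  then show ?thesis using f by (simp add: L2k_def)
qed

lemma L2k_int: "f \<in> L2k k \<Longrightarrow> integrable lborel (\<lambda>t. (norm (f t))\<^sup>2 * k t)"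
  by (simp add: L2k_def)

lemma L2k_cong_AE:
  assumes "f \<in> L2k k" "g \<in> borel_measurable borel" "AE t in lborel. f t = g t"
  shows "g \<in> L2k k"
  by (rule L2k_bound[OF assms(2) L2k_int[OF assms(1)]]) (use assms(3) in \<open>auto elim!: eventually_mono\<close>)

lemma L2k_add:
  fixes f g :: "real \<Rightarrow> 'a::chilbert"
  assumes "f \<in> L2k k" "g \<in> L2k k"
  shows "(\<lambda>t. f t + g t) \<in> L2k k"
proof (rule L2k_bound)
  show "(\<lambda>t. f t + g t) \<in> borel_measurable borel"
    using assms by (intro borel_measurable_real_add L2k_meas)
  show "integrable lborel (\<lambda>t. 2 * ((norm (f t))\<^sup>2 * k t) + 2 * ((norm (g t))\<^sup>2 * k t))"
    using assms by (intro Bochner_Integration.integrable_add integrable_mult_right L2k_int)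
  have "(norm (f t + g t))\<^sup>2 * k t \<le> (2 * (norm (f t))\<^sup>2 + 2 * (norm (g t))\<^sup>2) * k t" for t
    by (rule mult_right_mono[OF norm_add_sq_le k_nonneg])
  then show "AE t in lborel. (norm (f t + g t))\<^sup>2 * k t \<le> 2 * ((norm (f t))\<^sup>2 * k t) + 2 * ((norm (g t))\<^sup>2 * k t)"
    by (simp add: algebra_simps)
qed

lemma L2k_bounded_linear:
  fixes f :: "real \<Rightarrow> 'a::chilbert" and M :: "'a \<Rightarrow> 'a"
  assumes f: "f \<in> L2k k" and M: "bounded_linear M"
  shows "(\<lambda>t. M (f t)) \<in> L2k k"
proof -
  obtain K where K: "\<And>x. norm (M x) \<le> norm x * K" using bounded_linear.bounded[OF M] by blast
  show ?thesis
  proof (rule L2k_bound)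
    show "(\<lambda>t. M (f t)) \<in> borel_measurable borel"
      by (rule borel_measurable_real_bounded_linear[OF M L2k_meas[OF f]])
    show "integrable lborel (\<lambda>t. K\<^sup>2 * ((norm (f t))\<^sup>2 * k t))"
      by (intro integrable_mult_right L2k_int f)
    have "(norm (M (f t)))\<^sup>2 * k t \<le> (norm (f t) * K)\<^sup>2 * k t" for t
      by (intro mult_right_mono power_mono K k_nonneg) auto
    then show "AE t in lborel. (norm (M (f t)))\<^sup>2 * k t \<le> K\<^sup>2 * ((norm (f t))\<^sup>2 * k t)"
      by (simp add: power_mult_distrib algebra_simps)
  qed
qed

lemma L2k_scaleR:
  fixes f :: "real \<Rightarrow> 'a::chilbert"
  shows "f \<in> L2k k \<Longrightarrow> (\<lambda>t. r *\<^sub>R f t) \<in> L2k k"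
  by (rule L2k_bounded_linear[OF _ bounded_linear_scaleR_right])

lemma L2k_diff:
  fixes f g :: "real \<Rightarrow> 'a::chilbert"
  assumes "f \<in> L2k k" "g \<in> L2k k"
  shows "(\<lambda>t. f t - g t) \<in> L2k k"
  using L2k_add[OF assms(1) L2k_scaleR[OF assms(2), of "-1"]] by simp

lemma nk_nonneg: "nk k f \<ge> 0"
  unfolding nk_def using k_nonneg by (intro real_sqrt_ge_zero integral_nonneg_AE) auto

lemma nk_sq: "(nk k f)\<^sup>2 = (\<integral>t. (norm (f t))\<^sup>2 * k t \<partial>lborel)"
  unfolding nk_def using k_nonneg by (intro real_sqrt_pow2 integral_nonneg_AE) auto

lemma nk_zero: "nk k (\<lambda>_. 0) = 0"
  by (simp add: nk_def)

lemma nk_cong_AE: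
  fixes f g :: "real \<Rightarrow> 'a::chilbert"
  assumes "f \<in> borel_measurable borel" "g \<in> borel_measurable borel" "AE t in lborel. f t = g t"
  shows "nk k f = nk k g"
  unfolding nk_def by (rule arg_cong[of _ _ sqrt], rule integral_cong_AE)
    (use sq_meas assms in \<open>auto elim!: eventually_mono\<close>)

lemma nk_scaleR: "nk k (\<lambda>t. r *\<^sub>R f t) = \<bar>r\<bar> * nk k f"
  unfolding nk_def by (simp add: power_mult_distrib mult.assoc real_sqrt_mult)

lemma nk_diff_commute: "nk k (\<lambda>t. f t - g t) = nk k (\<lambda>t. g t - f t)"
  unfolding nk_def by (simp add: norm_minus_commute)

lemma nk_mono:
  fixes f g :: "real \<Rightarrow> 'a::chilbert"
  assumes "f \<in> L2k k" "g \<in> L2k k" "C \<ge> 0" "\<And>t. norm (f t) \<le> C * norm (g t)"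
  shows "nk k f \<le> C * nk k g"
proof (rule power2_le_imp_le)
  have "(nk k f)\<^sup>2 \<le> (\<integral>t. C\<^sup>2 * ((norm (g t))\<^sup>2 * k t) \<partial>lborel)"
    unfolding nk_sq
  proof (rule integral_mono)
    fix t
    have "(norm (f t))\<^sup>2 * k t \<le> (C * norm (g t))\<^sup>2 * k t"
      by (intro mult_right_mono power_mono assms k_nonneg) auto
    then show "(norm (f t))\<^sup>2 * k t \<le> C\<^sup>2 * ((norm (g t))\<^sup>2 * k t)" by (simp add: power_mult_distrib)
  qed (intro integrable_mult_right L2k_int assms)+
  also have "\<dots> = (C * nk k g)\<^sup>2" by (simp add: nk_sq power_mult_distrib)
  finally show "(nk k f)\<^sup>2 \<le> (C * nk k g)\<^sup>2" .
  show "0 \<le> C * nk k g" by (intro mult_nonneg_nonneg assms nk_nonneg)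
qed

lemma nk_eq_0_AE:
  fixes f :: "real \<Rightarrow> 'a::chilbert"
  assumes f: "f \<in> L2k k" and "nk k f = 0"
  shows "AE t in lborel. f t = 0"
proof -
  have "(\<integral>t. (norm (f t))\<^sup>2 * k t \<partial>lborel) = 0" using nk_sq[of f] assms(2) by simp
  then have "AE t in lborel. (norm (f t))\<^sup>2 * k t = 0"
    using integral_nonneg_eq_0_iff_AE[OF L2k_int[OF f]] k_nonneg by simp
  then show ?thesis using k_pos by (auto elim!: eventually_mono simp: less_imp_neq[THEN not_sym])
qed

lemma ip_integrable:
  fixes f g :: "real \<Rightarrow> 'a::chilbert"
  assumes "f \<in> L2k k" "g \<in> L2k k"
  shows "integrable lborel (\<lambda>t. rip (f t) (g t) * k t)"
proof (rule Bochner_Integration.integrable_bound)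
  show "integrable lborel (\<lambda>t. (norm (f t))\<^sup>2 * k t + (norm (g t))\<^sup>2 * k t)"
    using assms by (intro Bochner_Integration.integrable_add L2k_int)
  have "(\<lambda>t. rip (f t) (g t)) \<in> borel_measurable borel"
    using assms by (intro borel_measurable_real_rip L2k_meas)
  then show "(\<lambda>t. rip (f t) (g t) * k t) \<in> borel_measurable lborel" by measurable
  have "\<bar>rip (f t) (g t)\<bar> * k t \<le> ((norm (f t))\<^sup>2 + (norm (g t))\<^sup>2) * k t" for t
  proof (intro mult_right_mono k_nonneg)
    show "\<bar>rip (f t) (g t)\<bar> \<le> (norm (f t))\<^sup>2 + (norm (g t))\<^sup>2"
      using rip_Cauchy_Schwarz[of "f t" "g t"] sum_squares_bound[of "norm (f t)" "norm (g t)"]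
        mult_nonneg_nonneg[OF norm_ge_zero norm_ge_zero, of "f t" "g t"] by linarith
  qed
  then show "AE t in lborel. norm (rip (f t) (g t) * k t) \<le> norm ((norm (f t))\<^sup>2 * k t + (norm (g t))\<^sup>2 * k t)"
    using k_nonneg by (simp add: abs_mult distrib_right)
qed

lemma ipk_add_left:
  fixes f g h :: "real \<Rightarrow> 'a::chilbert"
  assumes "f \<in> L2k k" "g \<in> L2k k" "h \<in> L2k k"
  shows "ipk k (\<lambda>t. f t + g t) h = ipk k f h + ipk k g h"
  unfolding ipk_def using assms
  by (simp add: rip.add_left distrib_right ip_integrable)

lemma ipk_diff_left:
  fixes f g h :: "real \<Rightarrow> 'a::chilbert"
  assumes "f \<in> L2k k" "g \<in> L2k k" "h \<in> L2k k"
  shows "ipk k (\<lambda>t. f t - g t) h = ipk k f h - ipk k g h"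
  unfolding ipk_def using assms
  by (simp add: rip.diff_left left_diff_distrib ip_integrable)

lemma ipk_scaleR_left: "ipk k (\<lambda>t. r *\<^sub>R f t) h = r * ipk k f h"
  unfolding ipk_def by (simp add: rip.scaleR_left mult.assoc)

lemma ipk_commute: "ipk k f g = ipk k g f"
  unfolding ipk_def by (simp add: rip_commute)

lemma ipk_self: "ipk k f f = (nk k f)\<^sup>2"
  unfolding ipk_def nk_sq by (simp add: rip_self)

lemma ipk_CS:
  fixes f g :: "real \<Rightarrow> 'a::chilbert"
  assumes f: "f \<in> L2k k" and g: "g \<in> L2k k"
  shows "ipk k f g \<le> nk k f * nk k g"
proof -
  have Young: "2 * ipk k f g \<le> s * (nk k f)\<^sup>2 + (nk k g)\<^sup>2 / s" if s: "s > 0" for s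
  proof -
    have "2 * rip (f t) (g t) \<le> s * (norm (f t))\<^sup>2 + (norm (g t))\<^sup>2 / s" for t
      using nonneg_form_Young[of "\<lambda>x. x" s "f t" "g t"] s by (simp add: rip_self linear_id[unfolded id_def])
    then have "2 * rip (f t) (g t) * k t \<le> (s * (norm (f t))\<^sup>2 + (norm (g t))\<^sup>2 / s) * k t" for t
      by (intro mult_right_mono k_nonneg)
    then have "2 * (rip (f t) (g t) * k t) \<le> s * ((norm (f t))\<^sup>2 * k t) + (norm (g t))\<^sup>2 * k t / s" for t
      by (simp add: algebra_simps)
    then have "(\<integral>t. 2 * (rip (f t) (g t) * k t) \<partial>lborel) \<le> (\<integral>t. s * ((norm (f t))\<^sup>2 * k t) + (norm (g t))\<^sup>2 * k t / s \<partial>lborel)"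
      using f g by (intro integral_mono Bochner_Integration.integrable_add integrable_mult_right integrable_divide ip_integrable L2k_int) auto
    also have "\<dots> = s * (nk k f)\<^sup>2 + (nk k g)\<^sup>2 / s"
      unfolding nk_sq using f g by (subst Bochner_Integration.integral_add) (auto intro!: integrable_divide L2k_int)
    finally show ?thesis by (simp add: ipk_def)
  qed
  have eq: "s * (nk k f)\<^sup>2 + (nk k g)\<^sup>2 / s = 2 * (nk k f * nk k g)" if "nk k f > 0" "nk k g > 0" "s = nk k g / nk k f" for s
    unfolding that(3) using that(1,2) by (simp add: power2_eq_square)
  consider "nk k f = 0" | "nk k g = 0" | "nk k f > 0" "nk k g > 0" using nk_nonneg[of f] nk_nonneg[of g] by linarith
  then show ?thesis
  proof cases
    case 1
    have "ipk k f g = 0"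
      unfolding ipk_def by (rule integral_eq_zero_AE) (use nk_eq_0_AE[OF f 1] in \<open>auto elim!: eventually_mono simp: rip.zero_left\<close>)
    then show ?thesis using 1 by simp
  next
    case 2
    have "ipk k f g = 0"
      unfolding ipk_def by (rule integral_eq_zero_AE) (use nk_eq_0_AE[OF g 2] in \<open>auto elim!: eventually_mono simp: rip.zero_right\<close>)
    then show ?thesis using 2 by simp
  next
    case 3
    then show ?thesis using Young[of "nk k g / nk k f"] eq[OF 3 refl] by simp
  qed
qed

lemma nk_triangle:
  fixes f g :: "real \<Rightarrow> 'a::chilbert"
  assumes f: "f \<in> L2k k" and g: "g \<in> L2k k"
  shows "nk k (\<lambda>t. f t + g t) \<le> nk k f + nk k g"
proof (rule power2_le_imp_le)
  have "(nk k (\<lambda>t. f t + g t))\<^sup>2 = (nk k f)\<^sup>2 + 2 * ipk k f g + (nk k g)\<^sup>2"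
  proof -
    have "ipk k (\<lambda>t. f t + g t) (\<lambda>t. f t + g t) = ipk k f (\<lambda>t. f t + g t) + ipk k g (\<lambda>t. f t + g t)"
      by (rule ipk_add_left[OF f g L2k_add[OF f g]])
    moreover have "ipk k f (\<lambda>t. f t + g t) = ipk k f f + ipk k g f"
      unfolding ipk_commute[of f "\<lambda>t. f t + g t"] by (rule ipk_add_left[OF f g f])
    moreover have "ipk k g (\<lambda>t. f t + g t) = ipk k f g + ipk k g g"
      unfolding ipk_commute[of g "\<lambda>t. f t + g t"] by (rule ipk_add_left[OF f g g])
    ultimately show ?thesis using ipk_commute[of g f] unfolding ipk_self by linarith
  qed
  also have "\<dots> \<le> (nk k f + nk k g)\<^sup>2" using ipk_CS[OF f g] by (simp add: power2_sum)
  finally show "(nk k (\<lambda>t. f t + g t))\<^sup>2 \<le> (nk k f + nk k g)\<^sup>2" .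
qed (simp add: nk_nonneg)

lemma nk_triangle_diff:
  fixes f g h :: "real \<Rightarrow> 'a::chilbert"
  assumes f: "f \<in> L2k k" and g: "g \<in> L2k k" and h: "h \<in> L2k k"
  shows "nk k (\<lambda>t. f t - h t) \<le> nk k (\<lambda>t. f t - g t) + nk k (\<lambda>t. g t - h t)"
  using nk_triangle[OF L2k_diff[OF f g] L2k_diff[OF g h]] by simp

lemma nk_triangle_sub:
  fixes f g :: "real \<Rightarrow> 'a::chilbert"
  assumes f: "f \<in> L2k k" and g: "g \<in> L2k k"
  shows "nk k (\<lambda>t. f t - g t) \<le> nk k f + nk k g"
  using nk_triangle[OF f L2k_scaleR[OF g, of "-1"]] nk_scaleR[of "-1" g] by simp

lemma nk_triangle_rev:
  fixes f g :: "real \<Rightarrow> 'a::chilbert"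
  assumes f: "f \<in> L2k k" and g: "g \<in> L2k k"
  shows "\<bar>nk k f - nk k g\<bar> \<le> nk k (\<lambda>t. f t - g t)"
  using nk_triangle[OF L2k_diff[OF f g] g] nk_triangle[OF L2k_diff[OF g f] f] nk_diff_commute[of f g] by simp

lemma nk_dominated:
  fixes f :: "nat \<Rightarrow> real \<Rightarrow> 'a::chilbert"
  assumes f: "\<And>n. f n \<in> borel_measurable borel" and h: "integrable lborel h"
    and le: "\<And>n t. (norm (f n t))\<^sup>2 * k t \<le> h t"
    and lim: "\<And>t. (\<lambda>n. f n t) \<longlonglongrightarrow> 0"
  shows "(\<lambda>n. nk k (f n)) \<longlonglongrightarrow> 0"
proof -
  have "(\<lambda>n. \<integral>t. (norm (f n t))\<^sup>2 * k t \<partial>lborel) \<longlonglongrightarrow> (\<integral>t. 0 \<partial>(lborel :: real measure))"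
  proof (rule integral_dominated_convergence[where w = h])
    show "AE t in lborel. (\<lambda>n. (norm (f n t))\<^sup>2 * k t) \<longlonglongrightarrow> 0"
    proof (rule AE_I2)
      fix t
      have "(\<lambda>n. (norm (f n t))\<^sup>2 * k t) \<longlonglongrightarrow> (norm (0::'a))\<^sup>2 * k t" by (intro tendsto_intros lim)
      then show "(\<lambda>n. (norm (f n t))\<^sup>2 * k t) \<longlonglongrightarrow> 0" by simp
    qed
  qed (use sq_meas f h le k_nonneg in auto)
  then have "(\<lambda>n. sqrt (\<integral>t. (norm (f n t))\<^sup>2 * k t \<partial>lborel)) \<longlonglongrightarrow> sqrt 0"
    by (intro tendsto_real_sqrt) simp
  then show ?thesis by (simp add: nk_def)
qed

lemma nn_integral_nk:
  fixes f :: "real \<Rightarrow> 'a::chilbert"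
  assumes "f \<in> L2k k"
  shows "(\<integral>\<^sup>+t. ennreal ((norm (f t))\<^sup>2 * k t) \<partial>lborel) = ennreal ((nk k f)\<^sup>2)"
  unfolding nk_sq by (rule nn_integral_eq_integral[OF L2k_int[OF assms]]) (use k_nonneg in auto)

lemma L2k_Fatou:
  fixes f :: "nat \<Rightarrow> real \<Rightarrow> 'a::chilbert"
  assumes f: "\<And>n. f n \<in> L2k k" and g: "g \<in> borel_measurable borel"
    and lim: "AE t in lborel. (\<lambda>n. f n t) \<longlonglongrightarrow> g t"
    and B: "\<And>n. n \<ge> N \<Longrightarrow> nk k (f n) \<le> B" and B0: "B \<ge> 0"
  shows "g \<in> L2k k" "nk k g \<le> B"
proof -
  have "(\<integral>\<^sup>+t. ennreal ((norm (g t))\<^sup>2 * k t) \<partial>lborel)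
      = (\<integral>\<^sup>+t. liminf (\<lambda>n. ennreal ((norm (f n t))\<^sup>2 * k t)) \<partial>lborel)"
  proof (rule nn_integral_cong_AE, use lim in \<open>rule eventually_mono\<close>)
    fix t assume "(\<lambda>n. f n t) \<longlonglongrightarrow> g t"
    then have "(\<lambda>n. ennreal ((norm (f n t))\<^sup>2 * k t)) \<longlonglongrightarrow> ennreal ((norm (g t))\<^sup>2 * k t)"
      by (intro tendsto_ennrealI tendsto_intros)
    then show "ennreal ((norm (g t))\<^sup>2 * k t) = liminf (\<lambda>n. ennreal ((norm (f n t))\<^sup>2 * k t))"
      by (simp add: lim_imp_Liminf)
  qed
  also have "\<dots> \<le> liminf (\<lambda>n. \<integral>\<^sup>+t. ennreal ((norm (f n t))\<^sup>2 * k t) \<partial>lborel)"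
    by (rule nn_integral_liminf) (use sq_meas[OF L2k_meas[OF f]] in auto)
  also have "\<dots> = liminf (\<lambda>n. ennreal ((nk k (f n))\<^sup>2))"
    by (simp add: nn_integral_nk[OF f])
  also have "\<dots> \<le> liminf (\<lambda>n. ennreal (B\<^sup>2))"
    by (rule Liminf_mono) (use B nk_nonneg in \<open>auto intro!: exI[of _ N] ennreal_leI power_mono simp: eventually_sequentially\<close>)
  also have "\<dots> = ennreal (B\<^sup>2)" by (simp add: Liminf_const)
  finally have le: "(\<integral>\<^sup>+t. ennreal ((norm (g t))\<^sup>2 * k t) \<partial>lborel) \<le> ennreal (B\<^sup>2)" .
  have "integrable lborel (\<lambda>t. (norm (g t))\<^sup>2 * k t)"
    by (rule integrableI_nonneg) (use sq_meas[OF g] k_nonneg le in \<open>auto simp: le_less_trans[OF _ ennreal_less_top]\<close>)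
  then show g2: "g \<in> L2k k" using g by (simp add: L2k_def)
  have "(nk k g)\<^sup>2 \<le> B\<^sup>2" using le unfolding nn_integral_nk[OF g2] by simp
  then show "nk k g \<le> B" using B0 by (rule power2_le_imp_le)
qed

lemma L2k_fast_Cauchy_AE:
  fixes f :: "nat \<Rightarrow> real \<Rightarrow> 'a::chilbert"
  assumes f: "\<And>n. f n \<in> L2k k" and fast: "\<And>n. nk k (\<lambda>t. f (Suc n) t - f n t) \<le> (1/2)^n"
  shows "AE t in lborel. convergent (\<lambda>n. f n t)"
proof -
  define G where "G n t = 2^n * ((norm (f (Suc n) t - f n t))\<^sup>2 * k t)" for n t
  have Gd: "(\<lambda>t. f (Suc n) t - f n t) \<in> L2k k" for n by (intro L2k_diff f)
  have Gm: "G n \<in> borel_measurable borel" for n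
    unfolding G_def using sq_meas[OF L2k_meas[OF Gd[of n]]] by measurable
  have G0: "G n t \<ge> 0" for n t unfolding G_def using k_nonneg by simp
  have Gint: "(\<integral>\<^sup>+t. ennreal (G n t) \<partial>lborel) \<le> ennreal ((1/2)^n)" for n
  proof -
    have "(\<integral>\<^sup>+t. ennreal (G n t) \<partial>lborel) = (\<integral>\<^sup>+t. ennreal (2^n) * ennreal ((norm (f (Suc n) t - f n t))\<^sup>2 * k t) \<partial>lborel)"
      unfolding G_def by (intro nn_integral_cong) (simp add: ennreal_mult k_nonneg)
    also have "\<dots> = ennreal (2^n) * ennreal ((nk k (\<lambda>t. f (Suc n) t - f n t))\<^sup>2)"
      by (subst nn_integral_cmult) (use sq_meas[OF L2k_meas[OF Gd[of n]]] nn_integral_nk[OF Gd[of n]] in auto)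
    also have "\<dots> \<le> ennreal (2^n) * ennreal (((1/2)^n)\<^sup>2)"
      by (intro mult_left_mono ennreal_leI power_mono fast nk_nonneg) auto
    also have "\<dots> = ennreal (2^n * ((1/2)^n)\<^sup>2)" by (simp add: ennreal_mult)
    also have "2^n * ((1/2)^n)\<^sup>2 = (1/2 :: real)^n"
      by (simp add: power2_eq_square power_one_over field_simps)
    finally show ?thesis .
  qed
  have "(\<integral>\<^sup>+t. (\<Sum>n. ennreal (G n t)) \<partial>lborel) = (\<Sum>n. \<integral>\<^sup>+t. ennreal (G n t) \<partial>lborel)"
    by (rule nn_integral_suminf) (use Gm in auto)
  also have "\<dots> \<le> (\<Sum>n. ennreal ((1/2)^n))" by (intro suminf_le Gint) auto
  also have "\<dots> = ennreal (\<Sum>n. (1/2)^n)" by (rule suminf_ennreal2) (auto intro: summable_geometric)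
  also have "\<dots> < \<infinity>" by simp
  finally have fin: "(\<integral>\<^sup>+t. (\<Sum>n. ennreal (G n t)) \<partial>lborel) \<noteq> \<infinity>" by simp
  have "AE t in lborel. (\<Sum>n. ennreal (G n t)) \<noteq> \<infinity>"
    by (rule nn_integral_PInf_AE[OF _ fin]) (use Gm in measurable)
  then show ?thesis
  proof (rule eventually_mono)
    fix t assume t: "(\<Sum>n. ennreal (G n t)) \<noteq> \<infinity>"
    then obtain C where C: "C \<ge> 0" "(\<Sum>n. ennreal (G n t)) = ennreal C"
      by (metis ennreal_cases infinity_ennreal_def)
    have GC: "G n t \<le> C" for n
    proof -
      have "ennreal (G n t) \<le> (\<Sum>n. ennreal (G n t))"
        using sum_le_suminf[of "\<lambda>n. ennreal (G n t)" "{n}"] by simp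
      then show ?thesis using C by simp
    qed
    define D where "D = sqrt (C / k t)"
    define q where "q = sqrt (1/2)"
    have q: "0 \<le> q" "q < 1" by (auto simp: q_def)
    have nle: "norm (f (Suc n) t - f n t) \<le> D * q^n" for n
    proof (rule power2_le_imp_le)
      have "2^n * (norm (f (Suc n) t - f n t))\<^sup>2 * k t \<le> C" using GC[of n] by (simp add: G_def mult.assoc)
      then have "(norm (f (Suc n) t - f n t))\<^sup>2 \<le> (C / k t) * (1/2)^n"
        using k_pos[of t] by (simp add: field_simps power_one_over)
      also have "\<dots> = (D * q^n)\<^sup>2"
      proof -
        have "D\<^sup>2 = C / k t" using C(1) k_nonneg by (simp add: D_def)
        moreover have "(q^n)\<^sup>2 = (1/2)^n"
          by (simp add: q_def power_mult[symmetric] mult.commute[of n] power_mult)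
        ultimately show ?thesis by (simp add: power_mult_distrib)
      qed
      finally show "(norm (f (Suc n) t - f n t))\<^sup>2 \<le> (D * q^n)\<^sup>2" .
      show "0 \<le> D * q^n" using q C(1) k_nonneg by (simp add: D_def)
    qed
    have "summable (\<lambda>n. f (Suc n) t - f n t)"
      by (rule summable_comparison_test'[of "\<lambda>n. D * q^n" 0]) (use nle q in \<open>auto intro!: summable_mult summable_geometric\<close>)
    then have "(\<lambda>n. \<Sum>i<n. f (Suc i) t - f i t) \<longlonglongrightarrow> (\<Sum>n. f (Suc n) t - f n t)" by (rule summable_LIMSEQ)
    then have "(\<lambda>n. f n t - f 0 t) \<longlonglongrightarrow> (\<Sum>n. f (Suc n) t - f n t)"
      using sum_lessThan_telescope[of "\<lambda>n. f n t"] by simp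
    from tendsto_add[OF this tendsto_const[of "f 0 t"]]
    have "(\<lambda>n. f n t) \<longlonglongrightarrow> (\<Sum>n. f (Suc n) t - f n t) + f 0 t" by simp
    then show "convergent (\<lambda>n. f n t)" by (rule convergentI)
  qed
qed

theorem L2k_complete:
  fixes f :: "nat \<Rightarrow> real \<Rightarrow> 'a::chilbert"
  assumes f: "\<And>n. f n \<in> L2k k"
    and Cau: "\<And>e. e > 0 \<Longrightarrow> \<exists>N. \<forall>m\<ge>N. \<forall>n\<ge>N. nk k (\<lambda>t. f m t - f n t) < e"
  obtains g where "g \<in> L2k k" "(\<lambda>n. nk k (\<lambda>t. f n t - g t)) \<longlonglongrightarrow> 0"
proof -
  have "\<forall>i. \<exists>N. \<forall>m\<ge>N. \<forall>n\<ge>N. nk k (\<lambda>t. f m t - f n t) < (1/2)^i" using Cau by simp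
  then obtain M where M: "\<And>i m n. m \<ge> M i \<Longrightarrow> n \<ge> M i \<Longrightarrow> nk k (\<lambda>t. f m t - f n t) < (1/2)^i" by metis
  define r where "r i = (\<Sum>j\<le>i. M j) + i" for i
  have rM: "r i \<ge> M i" for i unfolding r_def by (simp add: member_le_sum trans_le_add1)
  have ri: "r i \<ge> i" for i unfolding r_def by simp
  have rS: "r (Suc i) \<ge> M i" for i
    using rM[of i] unfolding r_def by simp
  have "AE t in lborel. convergent (\<lambda>i. f (r i) t)"
    by (rule L2k_fast_Cauchy_AE) (use f M[OF rS rM] less_imp_le in auto)
  then obtain N where N: "{t. \<not> convergent (\<lambda>i. f (r i) t)} \<subseteq> N" "N \<in> null_sets lborel"
    by (auto elim!: AE_E simp: null_sets_def)
  define g where "g t = (if t \<in> N then 0 else lim (\<lambda>i. f (r i) t))" for t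
  have Nb: "N \<in> sets borel" using N(2) by (simp add: null_sets_def)
  have lim: "(\<lambda>i. if t \<in> N then 0 else f (r i) t) \<longlonglongrightarrow> g t" for t
    using N(1) unfolding g_def by (auto simp: convergent_LIMSEQ_iff)
  have gm: "g \<in> borel_measurable borel"
    by (rule borel_measurable_LIMSEQ_metric[OF _ lim])
      (use Nb L2k_meas[OF f] in \<open>auto intro!: measurable_If_set\<close>)
  have AElim: "AE t in lborel. (\<lambda>i. f (r i) t) \<longlonglongrightarrow> g t"
    using AE_not_in[OF N(2)]
  proof (rule eventually_mono)
    fix t assume "t \<notin> N"
    then show "(\<lambda>i. f (r i) t) \<longlonglongrightarrow> g t" using lim[of t] by simp
  qed
  have bound: "(\<lambda>t. f n t - g t) \<in> L2k k \<and> nk k (\<lambda>t. f n t - g t) \<le> (1/2)^i" if "n \<ge> M i" for n i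
  proof -
    have "AE t in lborel. (\<lambda>j. f n t - f (r j) t) \<longlonglongrightarrow> f n t - g t"
      using AElim by (rule eventually_mono) (intro tendsto_intros)
    moreover have "nk k (\<lambda>t. f n t - f (r j) t) \<le> (1/2)^i" if "j \<ge> M i" for j
      using M[of i n "r j"] \<open>n \<ge> M i\<close> ri[of j] that by (simp add: less_imp_le order_trans)
    ultimately show ?thesis
      using L2k_Fatou[of "\<lambda>j t. f n t - f (r j) t" "\<lambda>t. f n t - g t" "M i" "(1/2)^i"]
        L2k_diff[OF f f] borel_measurable_real_diff[OF L2k_meas[OF f] gm] by simp
  qed
  have "g \<in> L2k k"
    using L2k_diff[OF f[of "M 0"] conjunct1[OF bound[OF order_refl]], of 0] by simp
  moreover have "(\<lambda>n. nk k (\<lambda>t. f n t - g t)) \<longlonglongrightarrow> 0"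
  proof (rule LIMSEQ_I)
    fix e :: real assume e: "e > 0"
    obtain i where i: "(1/2)^i < e" using real_arch_pow_inv[OF e, of "1/2"] by auto
    have "norm (nk k (\<lambda>t. f n t - g t) - 0) < e" if "n \<ge> M i" for n
      using bound[OF that] i nk_nonneg[of "\<lambda>t. f n t - g t"] by simp
    then show "\<exists>no. \<forall>n\<ge>no. norm (nk k (\<lambda>t. f n t - g t) - 0) < e" by blast
  qed
  ultimately show thesis by (rule that)
qed

lemma L2k_cont_compact:
  fixes f :: "real \<Rightarrow> 'a::chilbert"
  assumes f: "continuous_on UNIV f" and supp: "\<And>t. t \<notin> {a..b} \<Longrightarrow> f t = 0"
  shows "f \<in> L2k k"
proof -
  have "integrable lborel (\<lambda>t. indicator {a..b} t *\<^sub>R ((norm (f t))\<^sup>2 * k t))"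
    by (rule borel_integrable_compact)
      (auto intro!: continuous_intros continuous_on_subset[OF f] continuous_on_subset[OF k_cont])
  moreover have "(\<lambda>t. indicator {a..b} t *\<^sub>R ((norm (f t))\<^sup>2 * k t)) = (\<lambda>t. (norm (f t))\<^sup>2 * k t)"
  proof
    fix t
    show "indicator {a..b} t *\<^sub>R ((norm (f t))\<^sup>2 * k t) = (norm (f t))\<^sup>2 * k t"
      using supp[of t] by (cases "t \<in> {a..b}") auto
  qed
  ultimately show ?thesis by (simp add: L2k_def borel_measurable_continuous_onI[OF f])
qed

end

section \<open>Smooth functions and density\<close>

definition smooth_fun :: "(real \<Rightarrow> 'b::real_normed_vector) \<Rightarrow> bool" where
  "smooth_fun f \<longleftrightarrow> (\<exists>D :: nat \<Rightarrow> real \<Rightarrow> 'b. D 0 = f \<and>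
     (\<forall>n t. (D n has_vector_derivative D (Suc n) t) (at t)))"

lemma smooth_fun_coinduct:
  assumes step: "\<And>f. P f \<Longrightarrow> \<exists>f'. P f' \<and> (\<forall>t. (f has_vector_derivative f' t) (at t))" and "P f"
  shows "smooth_fun f"
proof -
  obtain d where d: "\<And>f. P f \<Longrightarrow> P (d f) \<and> (\<forall>t. (f has_vector_derivative d f t) (at t))"
    using step by metis
  have "P ((d ^^ n) f)" for n by (induction n) (use d assms(2) in auto)
  then show ?thesis unfolding smooth_fun_def by (intro exI[of _ "\<lambda>n. (d ^^ n) f"]) (use d in auto)
qed

lemma smooth_fun_derivative:
  assumes "smooth_fun f"
  obtains f' where "smooth_fun f'" "\<And>t. (f has_vector_derivative f' t) (at t)"
proof -
  obtain D where D: "D 0 = f" "\<And>n t. (D n has_vector_derivative D (Suc n) t) (at t)"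
    using assms unfolding smooth_fun_def by blast
  have "smooth_fun (D 1)"
    unfolding smooth_fun_def by (rule exI[of _ "\<lambda>n. D (Suc n)"]) (use D(2) in auto)
  then show thesis using D(1) D(2)[of 0] that by simp
qed

lemma smooth_fun_continuous: "smooth_fun f \<Longrightarrow> continuous_on UNIV f"
  by (metis smooth_fun_derivative continuous_at_imp_continuous_on has_vector_derivative_continuous)

lemma smooth_fun_add:
  assumes "smooth_fun f" "smooth_fun g"
  shows "smooth_fun (\<lambda>t. f t + g t)"
proof (rule smooth_fun_coinduct[where P = "\<lambda>h. \<exists>f g. smooth_fun f \<and> smooth_fun g \<and> h = (\<lambda>t. f t + g t)"])
  fix h assume "\<exists>f g. smooth_fun f \<and> smooth_fun g \<and> h = (\<lambda>t. f t + g t)"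
  then obtain f g where fg: "smooth_fun f" "smooth_fun g" and h: "h = (\<lambda>t. f t + g t)" by blast
  obtain f' g' where "smooth_fun f'" "\<And>t. (f has_vector_derivative f' t) (at t)"
    "smooth_fun g'" "\<And>t. (g has_vector_derivative g' t) (at t)"
    using smooth_fun_derivative[OF fg(1)] smooth_fun_derivative[OF fg(2)] by metis
  then show "\<exists>h'. (\<exists>f g. smooth_fun f \<and> smooth_fun g \<and> h' = (\<lambda>t. f t + g t)) \<and> (\<forall>t. (h has_vector_derivative h' t) (at t))"
    unfolding h by (intro exI[of _ "\<lambda>t. f' t + g' t"]) (auto intro: has_vector_derivative_add)
qed (use assms in blast)

lemma smooth_fun_bounded_linear:
  assumes M: "bounded_linear M" and "smooth_fun f"
  shows "smooth_fun (\<lambda>t. M (f t))"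
proof (rule smooth_fun_coinduct[where P = "\<lambda>h. \<exists>f. smooth_fun f \<and> h = (\<lambda>t. M (f t))"])
  fix h assume "\<exists>f. smooth_fun f \<and> h = (\<lambda>t. M (f t))"
  then obtain f where f: "smooth_fun f" and h: "h = (\<lambda>t. M (f t))" by blast
  obtain f' where "smooth_fun f'" "\<And>t. (f has_vector_derivative f' t) (at t)"
    using smooth_fun_derivative[OF f] by metis
  then show "\<exists>h'. (\<exists>f. smooth_fun f \<and> h' = (\<lambda>t. M (f t))) \<and> (\<forall>t. (h has_vector_derivative h' t) (at t))"
    unfolding h by (intro exI[of _ "\<lambda>t. M (f' t)"]) (auto intro: bounded_linear.has_vector_derivative[OF M])
qed (use assms in blast)

lemma smooth_fun_affine:
  fixes f :: "real \<Rightarrow> 'b::real_normed_vector"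
  assumes "smooth_fun f"
  shows "smooth_fun (\<lambda>t. f (c * t + d))"
proof (rule smooth_fun_coinduct[where P = "\<lambda>h. \<exists>(r::real) f. smooth_fun f \<and> h = (\<lambda>t. r *\<^sub>R f (c * t + d))"])
  fix h :: "real \<Rightarrow> 'b" assume "\<exists>(r::real) f. smooth_fun f \<and> h = (\<lambda>t. r *\<^sub>R f (c * t + d))"
  then obtain r :: real and f where f: "smooth_fun f" and h: "h = (\<lambda>t. r *\<^sub>R f (c * t + d))" by blast
  obtain f' where f': "smooth_fun f'" "\<And>t. (f has_vector_derivative f' t) (at t)"
    using smooth_fun_derivative[OF f] by metis
  have "(h has_vector_derivative (r * c) *\<^sub>R f' (c * t + d)) (at t)" for t
  proof -
    have "((\<lambda>t. c * t + d) has_vector_derivative c) (at t)"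
      by (auto intro!: derivative_eq_intros simp: has_real_derivative_iff_has_vector_derivative[symmetric])
    then have "((f \<circ> (\<lambda>t. c * t + d)) has_vector_derivative c *\<^sub>R f' (c * t + d)) (at t)"
      by (rule vector_diff_chain_at) (rule f'(2))
    then have "((\<lambda>t. r *\<^sub>R f (c * t + d)) has_vector_derivative r *\<^sub>R (c *\<^sub>R f' (c * t + d))) (at t)"
      by (intro bounded_linear.has_vector_derivative[OF bounded_linear_scaleR_right]) (simp add: o_def)
    then show ?thesis unfolding h by simp
  qed
  then show "\<exists>h'. (\<exists>(r::real) f. smooth_fun f \<and> h' = (\<lambda>t. r *\<^sub>R f (c * t + d))) \<and> (\<forall>t. (h has_vector_derivative h' t) (at t))"
    using f'(1) by (intro exI[of _ "\<lambda>t. (r * c) *\<^sub>R f' (c * t + d)"]) blast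
next
  show "\<exists>(r::real) f'. smooth_fun f' \<and> (\<lambda>t. f (c * t + d)) = (\<lambda>t. r *\<^sub>R f' (c * t + d))"
    using assms by (intro exI[of _ 1] exI[of _ f]) simp
qed

inductive smooth_products :: "(real \<Rightarrow> real) \<Rightarrow> bool" where
  prod: "smooth_fun f \<Longrightarrow> smooth_fun g \<Longrightarrow> smooth_products (\<lambda>t. f t * g t)"
| add: "smooth_products u \<Longrightarrow> smooth_products v \<Longrightarrow> smooth_products (\<lambda>t. u t + v t)"

lemma smooth_fun_mult:
  assumes "smooth_fun f" "smooth_fun g"
  shows "smooth_fun (\<lambda>t. f t * g t :: real)"
proof (rule smooth_fun_coinduct[where P = smooth_products])
  fix h assume "smooth_products h"
  then show "\<exists>h'. smooth_products h' \<and> (\<forall>t. (h has_vector_derivative h' t) (at t))"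
  proof induction
    case (prod f g)
    obtain f' g' where "smooth_fun f'" "\<And>t. (f has_vector_derivative f' t) (at t)"
      "smooth_fun g'" "\<And>t. (g has_vector_derivative g' t) (at t)"
      using smooth_fun_derivative[OF prod(1)] smooth_fun_derivative[OF prod(2)] by metis
    then show ?case
      using prod by (intro exI[of _ "\<lambda>t. f t * g' t + f' t * g t"])
        (auto intro: has_vector_derivative_mult smooth_products.intros)
  next
    case (add u v)
    then obtain u' v' where "smooth_products u'" "\<And>t. (u has_vector_derivative u' t) (at t)"
      "smooth_products v'" "\<And>t. (v has_vector_derivative v' t) (at t)" by blast
    then show ?case
      by (intro exI[of _ "\<lambda>t. u' t + v' t"]) (auto intro: has_vector_derivative_add smooth_products.intros)
  qed
qed (use assms in \<open>rule smooth_products.prod\<close>)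

definition flat_exp :: "nat \<Rightarrow> real \<Rightarrow> real" where
  "flat_exp m t = (if t > 0 then (1 / t) ^ m * exp (- (1 / t)) else 0)"

lemma flat_exp_tendsto_0: "(flat_exp m \<longlongrightarrow> 0) (at 0)"
proof -
  have "((\<lambda>s::real. s ^ m / exp s) \<longlongrightarrow> 0) at_top" by (rule tendsto_power_div_exp_0)
  then have "((\<lambda>t::real. inverse t ^ m / exp (inverse t)) \<longlongrightarrow> 0) (at_right 0)"
    by (rule filterlim_compose[OF _ filterlim_inverse_at_top_right])
  moreover have "inverse t ^ m / exp (inverse t) = flat_exp m t" if "t > 0" for t
    using that by (simp add: flat_exp_def exp_minus inverse_eq_divide)
  then have "\<forall>\<^sub>F t in at_right 0. inverse t ^ m / exp (inverse t) = flat_exp m t"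
    by (auto simp: eventually_at_filter)
  ultimately have "(flat_exp m \<longlongrightarrow> 0) (at_right 0)" by (rule Lim_transform_eventually)
  moreover have "(flat_exp m \<longlongrightarrow> 0) (at_left 0)"
    by (rule Lim_transform_eventually[OF tendsto_const]) (auto simp: eventually_at_filter flat_exp_def)
  ultimately show ?thesis by (simp add: filterlim_split_at)
qed

lemma flat_exp_derivative:
  "(flat_exp m has_real_derivative flat_exp (m + 2) t - real m * flat_exp (m + 1) t) (at t)"
proof -
  consider "t > 0" | "t < 0" | "t = 0" by linarith
  then show ?thesis
  proof cases
    case 1
    have "((\<lambda>t. (1 / t) ^ m * exp (- (1 / t))) has_real_derivative
      flat_exp (m + 2) t - real m * flat_exp (m + 1) t) (at t)"
      using 1 by (auto intro!: derivative_eq_intros simp: flat_exp_def)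
        (cases m; simp add: field_simps power2_eq_square)
    then show ?thesis
      by (rule has_field_derivative_transform_within_open[of _ _ _ "{0<..}"]) (use 1 in \<open>auto simp: flat_exp_def\<close>)
  next
    case 2
    have "((\<lambda>t. 0) has_real_derivative flat_exp (m + 2) t - real m * flat_exp (m + 1) t) (at t)"
      using 2 by (auto simp: flat_exp_def)
    then show ?thesis
      by (rule has_field_derivative_transform_within_open[of _ _ _ "{..<0}"]) (use 2 in \<open>auto simp: flat_exp_def\<close>)
  next
    case 3
    have "((\<lambda>h. (flat_exp m (0 + h) - flat_exp m 0) / h) \<longlongrightarrow> 0) (at 0)"
      by (rule Lim_transform_eventually[OF flat_exp_tendsto_0[of "m + 1"]])
        (auto simp: eventually_at_filter flat_exp_def)
    then show ?thesis using 3 by (simp add: DERIV_def flat_exp_def)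
  qed
qed

inductive flat_span :: "(real \<Rightarrow> real) \<Rightarrow> bool" where
  base: "flat_span (flat_exp m)"
| add: "flat_span u \<Longrightarrow> flat_span v \<Longrightarrow> flat_span (\<lambda>t. u t + r * v t)"

lemma smooth_fun_flat_exp: "smooth_fun (flat_exp m)"
proof (rule smooth_fun_coinduct[where P = flat_span])
  fix h assume "flat_span h"
  then show "\<exists>h'. flat_span h' \<and> (\<forall>t. (h has_vector_derivative h' t) (at t))"
  proof induction
    case (base m)
    have "flat_span (\<lambda>t. flat_exp (m + 2) t + (- real m) * flat_exp (m + 1) t)"
      by (intro flat_span.intros)
    then show ?case
      using flat_exp_derivative[of m]
      by (intro exI[of _ "\<lambda>t. flat_exp (m + 2) t + (- real m) * flat_exp (m + 1) t"])
        (simp add: has_real_derivative_iff_has_vector_derivative)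
  next
    case (add u v r)
    then obtain u' v' where uv: "flat_span u'" "\<And>t. (u has_vector_derivative u' t) (at t)"
      "flat_span v'" "\<And>t. (v has_vector_derivative v' t) (at t)" by blast
    have "((\<lambda>t. u t + r * v t) has_vector_derivative u' t + r * v' t) (at t)" for t
      by (intro has_vector_derivative_add uv bounded_linear.has_vector_derivative[OF bounded_linear_mult_right])
    then show ?case using flat_span.add[OF uv(1,3)] by blast
  qed
qed (rule flat_span.base)

definition bump :: "real \<Rightarrow> real \<Rightarrow> nat \<Rightarrow> real \<Rightarrow> real" where
  "bump a b n t = flat_exp 0 (real (Suc n) * (t - a)) * flat_exp 0 (real (Suc n) * (b - t))"

lemma smooth_fun_bump: "smooth_fun (bump a b n)"
proof -
  have "smooth_fun (\<lambda>t. flat_exp 0 (real (Suc n) * t + (- real (Suc n) * a)) *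
      flat_exp 0 ((- real (Suc n)) * t + real (Suc n) * b))"
    by (intro smooth_fun_mult smooth_fun_affine smooth_fun_flat_exp)
  then show ?thesis unfolding bump_def[abs_def] by (simp add: algebra_simps del: of_nat_Suc)
qed

lemma flat_exp_0_range: "0 \<le> flat_exp 0 t" "flat_exp 0 t \<le> 1"
  by (auto simp: flat_exp_def)

lemma bump_range: "0 \<le> bump a b n t" "bump a b n t \<le> 1"
  unfolding bump_def by (intro mult_nonneg_nonneg mult_le_one flat_exp_0_range)+

lemma bump_outside: "t \<notin> {a<..<b} \<Longrightarrow> bump a b n t = 0"
  by (auto simp: bump_def flat_exp_def zero_less_mult_iff)

lemma bump_tendsto: "(\<lambda>n. bump a b n t) \<longlonglongrightarrow> indicator {a<..<b} t"
proof (cases "t \<in> {a<..<b}")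
  case True
  have *: "(\<lambda>n. flat_exp 0 (real (Suc n) * x)) \<longlonglongrightarrow> 1" if x: "x > 0" for x
  proof -
    have "(\<lambda>n. exp (- (inverse (real (Suc n)) * (1 / x)))) \<longlonglongrightarrow> exp (- (0 * (1 / x)))"
      by (intro tendsto_intros LIMSEQ_inverse_real_of_nat)
    moreover have "flat_exp 0 (real (Suc n) * x) = exp (- (inverse (real (Suc n)) * (1 / x)))" for n
    proof -
      have "real (Suc n) * x > 0" using x by (intro mult_pos_pos) auto
      then show ?thesis by (simp add: flat_exp_def field_simps del: of_nat_Suc)
    qed
    ultimately show ?thesis by simp
  qed
  have "(\<lambda>n. bump a b n t) \<longlonglongrightarrow> 1 * 1"
    unfolding bump_def by (intro tendsto_mult *) (use True in auto)
  then show ?thesis using True by simp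
qed (simp add: bump_outside)

lemma test_fun_iff: "test_fun \<phi> \<longleftrightarrow> smooth_fun \<phi> \<and> bounded {t. \<phi> t \<noteq> 0}"
  unfolding test_fun_def smooth_fun_def by blast

lemma test_fun_support:
  assumes "test_fun \<phi>"
  obtains a b where "\<And>t. t \<notin> {a..b} \<Longrightarrow> \<phi> t = 0"
proof -
  obtain R where "\<And>t. \<phi> t \<noteq> 0 \<Longrightarrow> norm t \<le> R"
    using assms unfolding test_fun_iff bounded_iff by blast
  then show thesis by (intro that[of "-R" R]) (force simp: abs_le_iff)
qed

lemma test_funI:
  assumes "smooth_fun \<phi>" "\<And>t. t \<notin> {a..b} \<Longrightarrow> \<phi> t = 0"
  shows "test_fun \<phi>"
  unfolding test_fun_iff
  by (intro conjI assms(1) bounded_subset[OF bounded_closed_interval[of a b]]) (use assms(2) in blast)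

lemma test_fun_continuous: "test_fun \<phi> \<Longrightarrow> continuous_on UNIV \<phi>"
  by (simp add: test_fun_iff smooth_fun_continuous)

lemma test_fun_derivative:
  fixes \<phi> :: "real \<Rightarrow> 'a::chilbert"
  assumes "test_fun \<phi>"
  obtains \<phi>' where "test_fun \<phi>'" "\<And>t. (\<phi> has_vector_derivative \<phi>' t) (at t)"
proof -
  obtain \<phi>' where d: "smooth_fun \<phi>'" "\<And>t. (\<phi> has_vector_derivative \<phi>' t) (at t)"
    using assms smooth_fun_derivative unfolding test_fun_iff by blast
  obtain a b where supp: "\<And>t. t \<notin> {a..b} \<Longrightarrow> \<phi> t = 0" using test_fun_support[OF assms] by blast
  have z: "\<phi>' t = 0" if t: "t \<notin> {a..b}" for t
  proof -
    have "((\<lambda>_. 0) has_vector_derivative 0) (at t)" by simp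
    then have "(\<phi> has_vector_derivative 0) (at t)"
      by (rule has_vector_derivative_transform_within_open[of _ _ _ "- {a..b}"])
        (use supp t in \<open>auto intro: open_Compl\<close>)
    then show ?thesis using d(2) vector_derivative_unique_at by blast
  qed
  have "test_fun \<phi>'" using z by (rule test_funI[OF d(1)])
  then show thesis using that d(2) by blast
qed

lemma test_fun_add:
  fixes f g :: "real \<Rightarrow> 'a::chilbert"
  assumes "test_fun f" "test_fun g"
  shows "test_fun (\<lambda>t. f t + g t)"
  unfolding test_fun_iff
proof
  show "smooth_fun (\<lambda>t. f t + g t)" using assms by (simp add: test_fun_iff smooth_fun_add)
  have "{t. f t + g t \<noteq> 0} \<subseteq> {t. f t \<noteq> 0} \<union> {t. g t \<noteq> 0}" by auto
  moreover have "bounded ({t. f t \<noteq> 0} \<union> {t. g t \<noteq> 0})" using assms by (simp add: test_fun_iff)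
  ultimately show "bounded {t. f t + g t \<noteq> 0}" using bounded_subset by blast
qed

lemma test_fun_bounded_linear:
  fixes f :: "real \<Rightarrow> 'a::chilbert" and M :: "'a \<Rightarrow> 'a"
  assumes M: "bounded_linear M" and "test_fun f"
  shows "test_fun (\<lambda>t. M (f t))"
  unfolding test_fun_iff
proof
  show "smooth_fun (\<lambda>t. M (f t))" using assms by (simp add: test_fun_iff smooth_fun_bounded_linear)
  have "{t. M (f t) \<noteq> 0} \<subseteq> {t. f t \<noteq> 0}" by (auto simp: linear_simps[OF M])
  moreover have "bounded {t. f t \<noteq> 0}" using assms by (simp add: test_fun_iff)
  ultimately show "bounded {t. M (f t) \<noteq> 0}" using bounded_subset by blast
qed

lemma test_fun_scaleR:
  fixes f :: "real \<Rightarrow> 'a::chilbert"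
  shows "test_fun f \<Longrightarrow> test_fun (\<lambda>t. r *\<^sub>R f t)"
  by (rule test_fun_bounded_linear[OF bounded_linear_scaleR_right])

lemma test_fun_zero: "test_fun (\<lambda>_. 0 :: 'a::chilbert)"
  unfolding test_fun_def by (auto intro!: exI[of _ "\<lambda>_ _. 0"])

lemma test_fun_shift:
  fixes f :: "real \<Rightarrow> 'a::chilbert"
  assumes "test_fun f"
  shows "test_fun (\<lambda>t. f (t - s))"
proof -
  obtain a b where ab: "\<And>t. t \<notin> {a..b} \<Longrightarrow> f t = 0" using test_fun_support[OF assms] by blast
  have "smooth_fun (\<lambda>t. f (1 * t + (- s)))" using assms by (intro smooth_fun_affine) (simp add: test_fun_iff)
  then show ?thesis by (intro test_funI[of _ "a + s" "b + s"]) (use ab in auto)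
qed

lemma test_fun_sum:
  fixes f :: "'i \<Rightarrow> real \<Rightarrow> 'a::chilbert"
  assumes "\<And>i. i \<in> I \<Longrightarrow> test_fun (f i)"
  shows "test_fun (\<lambda>t. \<Sum>i\<in>I. f i t)"
  using assms by (induction I rule: infinite_finite_induct) (auto intro: test_fun_add test_fun_zero)

lemma test_fun_bump_scaleR: "test_fun (\<lambda>t. bump a b n t *\<^sub>R (x :: 'a::chilbert))"
  by (rule test_funI[of _ a b])
    (auto intro!: smooth_fun_bounded_linear[OF bounded_linear_scaleR_left] smooth_fun_bump simp: bump_outside)

context weight
begin

lemma L2k_indicator_scaleR:
  assumes "E \<in> sets borel"
  shows "(\<lambda>t. indicator (E \<inter> {-N<..<N}) t *\<^sub>R (x::'a::chilbert)) \<in> L2k k"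
proof (rule L2k_bound)
  show "integrable lborel (\<lambda>t. indicator {-N..N} t *\<^sub>R ((norm x)\<^sup>2 * k t))"
    by (rule borel_integrable_compact) (auto intro!: continuous_intros continuous_on_subset[OF k_cont])
  show "AE t in lborel. (norm (indicator (E \<inter> {-N<..<N}) t *\<^sub>R x))\<^sup>2 * k t \<le> indicator {-N..N} t *\<^sub>R ((norm x)\<^sup>2 * k t)"
    using k_nonneg by (auto simp: indicator_def)
  show "(\<lambda>t. indicator (E \<inter> {-N<..<N}) t *\<^sub>R x) \<in> borel_measurable borel"
    using assms by (intro borel_measurable_real_scaleR) auto
qed

lemma L2k_dense:
  fixes \<C> :: "(real \<Rightarrow> 'a::chilbert) set" and f :: "real \<Rightarrow> 'a"
  assumes C_L2: "\<C> \<subseteq> L2k k"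
    and C_add: "\<And>f g. f \<in> \<C> \<Longrightarrow> g \<in> \<C> \<Longrightarrow> (\<lambda>t. f t + g t) \<in> \<C>"
    and C_scaleR: "\<And>f r. f \<in> \<C> \<Longrightarrow> (\<lambda>t. r *\<^sub>R f t) \<in> \<C>"
    and C_bump: "\<And>a b n x. x \<in> X \<Longrightarrow> (\<lambda>t. bump a b n t *\<^sub>R x) \<in> \<C>"
    and X: "closure X = UNIV"
    and f: "f \<in> L2k k" and e: "e > 0"
  shows "\<exists>g\<in>\<C>. nk k (\<lambda>t. f t - g t) < e"
proof -
  define \<D> where "\<D> = {f \<in> L2k k. \<forall>e>0. \<exists>g\<in>\<C>. nk k (\<lambda>t. f t - g t) < e}"
  have DI: "f \<in> \<D>" if fL: "f \<in> L2k k" and g: "\<And>n. g n \<in> \<D>"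
    and lim: "(\<lambda>n. nk k (\<lambda>t. g n t - f t)) \<longlonglongrightarrow> 0" for f and g :: "nat \<Rightarrow> real \<Rightarrow> 'a"
    unfolding \<D>_def
  proof (intro CollectI conjI fL allI impI)
    fix e :: real assume e: "e > 0"
    obtain n where n: "nk k (\<lambda>t. g n t - f t) < e/2"
    proof -
      obtain no where "\<forall>n\<ge>no. norm (nk k (\<lambda>t. g n t - f t) - 0) < e/2" using LIMSEQ_D[OF lim, of "e/2"] e by auto
      from this[rule_format, of no] have "nk k (\<lambda>t. g no t - f t) < e/2" by simp
      then show thesis by (rule that)
    qed
    obtain h where h: "h \<in> \<C>" "nk k (\<lambda>t. g n t - h t) < e/2"
      using g[of n] half_gt_zero[OF e] unfolding \<D>_def by blast
    have "nk k (\<lambda>t. f t - h t) \<le> nk k (\<lambda>t. f t - g n t) + nk k (\<lambda>t. g n t - h t)"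
      using fL g[of n] h(1) C_L2 unfolding \<D>_def by (intro nk_triangle_diff) auto
    then have "nk k (\<lambda>t. f t - h t) < e" using n h(2) nk_diff_commute[of f "g n"] by linarith
    then show "\<exists>g\<in>\<C>. nk k (\<lambda>t. f t - g t) < e" using h(1) by blast
  qed
  have CD: "g \<in> \<D>" if "g \<in> \<C>" for g
    using that C_L2 unfolding \<D>_def by (auto intro!: bexI[of _ g] simp: nk_zero)
  have D_add: "(\<lambda>t. f t + g t) \<in> \<D>" if fg: "f \<in> \<D>" "g \<in> \<D>" for f g
    unfolding \<D>_def
  proof (intro CollectI conjI allI impI)
    have L: "f \<in> L2k k" "g \<in> L2k k" using fg by (auto simp: \<D>_def)
    then show "(\<lambda>t. f t + g t) \<in> L2k k" by (rule L2k_add)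
    fix e :: real assume e: "e > 0"
    obtain f' g' where f': "f' \<in> \<C>" "nk k (\<lambda>t. f t - f' t) < e/2" and g': "g' \<in> \<C>" "nk k (\<lambda>t. g t - g' t) < e/2"
      using fg half_gt_zero[OF e] unfolding \<D>_def by blast
    have "nk k (\<lambda>t. (f t - f' t) + (g t - g' t)) \<le> nk k (\<lambda>t. f t - f' t) + nk k (\<lambda>t. g t - g' t)"
      using L f'(1) g'(1) C_L2 by (intro nk_triangle L2k_diff) auto
    then have "nk k (\<lambda>t. (f t + g t) - (f' t + g' t)) < e" using f'(2) g'(2) by (simp add: algebra_simps)
    then show "\<exists>h\<in>\<C>. nk k (\<lambda>t. (f t + g t) - h t) < e" by (intro bexI[OF _ C_add[OF f'(1) g'(1)]])
  qed
  have D_minus: "(\<lambda>t. - f t) \<in> \<D>" if f: "f \<in> \<D>" for f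
    unfolding \<D>_def
  proof (intro CollectI conjI allI impI)
    have L: "f \<in> L2k k" using f by (auto simp: \<D>_def)
    then show "(\<lambda>t. - f t) \<in> L2k k" using L2k_scaleR[of f "-1"] by simp
    fix e :: real assume e: "e > 0"
    then obtain f' where f': "f' \<in> \<C>" "nk k (\<lambda>t. f t - f' t) < e" using f unfolding \<D>_def by blast
    then have "nk k (\<lambda>t. - f t - (-1) *\<^sub>R f' t) < e" using nk_diff_commute[of f f'] by simp
    then show "\<exists>h\<in>\<C>. nk k (\<lambda>t. - f t - h t) < e" by (intro bexI[OF _ C_scaleR[OF f'(1), of "-1"]])
  qed
  have XD: "(\<lambda>t. indicator E t *\<^sub>R x) \<in> \<D>" if x: "x \<in> X" and E: "E = {a<..<b}" for x a b and E :: "real set"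
  proof (rule DI[of _ "\<lambda>n t. bump a b n t *\<^sub>R x"])
    define N where "N = max \<bar>a\<bar> \<bar>b\<bar>"
    have EN: "E = E \<inter> {-N<..<N}" unfolding E N_def by auto
    have Eb: "E \<in> sets borel" unfolding E by simp
    show "(\<lambda>t. indicator E t *\<^sub>R x) \<in> L2k k" using L2k_indicator_scaleR[OF Eb, of N x] EN by simp
    show "(\<lambda>n. nk k (\<lambda>t. bump a b n t *\<^sub>R x - indicator E t *\<^sub>R x)) \<longlonglongrightarrow> 0"
    proof (rule nk_dominated)
      show "integrable lborel (\<lambda>t. (norm (indicator E t *\<^sub>R x))\<^sup>2 * k t)"
        using L2k_int[OF L2k_indicator_scaleR[OF Eb, of N x]] EN by simp
      show "(\<lambda>t. bump a b n t *\<^sub>R x - indicator E t *\<^sub>R x) \<in> borel_measurable borel" for n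
        using Eb by (intro borel_measurable_real_diff borel_measurable_real_scaleR
            borel_measurable_continuous_onI[OF smooth_fun_continuous[OF smooth_fun_bump]]) auto
      show "(norm (bump a b n t *\<^sub>R x - indicator E t *\<^sub>R x))\<^sup>2 * k t \<le> (norm (indicator E t *\<^sub>R x))\<^sup>2 * k t" for n t
      proof (intro mult_right_mono power_mono k_nonneg)
        have "\<bar>bump a b n t - indicator E t\<bar> \<le> \<bar>indicator E t\<bar>"
          using bump_range[of a b n t] bump_outside[of t a b n] unfolding E by (auto simp: indicator_def)
        then show "norm (bump a b n t *\<^sub>R x - indicator E t *\<^sub>R x) \<le> norm (indicator E t *\<^sub>R x)"
          unfolding scaleR_left_diff_distrib[symmetric] norm_scaleR by (intro mult_right_mono) auto
      qed auto
      have "(\<lambda>n. bump a b n t *\<^sub>R x - indicator E t *\<^sub>R x) \<longlonglongrightarrow> indicator E t *\<^sub>R x - indicator E t *\<^sub>R x" for t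
        unfolding E by (intro tendsto_intros bump_tendsto)
      then show "(\<lambda>n. bump a b n t *\<^sub>R x - indicator E t *\<^sub>R x) \<longlonglongrightarrow> 0" for t by simp
    qed
  qed (use C_bump[OF x] CD in auto)
  have XB: "(\<lambda>t. indicator (E \<inter> {-N<..<N}) t *\<^sub>R x) \<in> \<D>" if x: "x \<in> X" and E: "E \<in> sets borel" for x E and N :: real
  proof -
    let ?G = "range (\<lambda>(a, b). {a<..<b :: real})"
    have "Int_stable ?G"
    proof (rule Int_stableI)
      fix A B :: "real set" assume "A \<in> ?G" "B \<in> ?G"
      then obtain a b c d where "A = {a<..<b}" "B = {c<..<d}" by auto
      then have "A \<inter> B = (\<lambda>(a, b). {a<..<b}) (max a c, min b d)" by auto
      then show "A \<inter> B \<in> ?G" by blast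
    qed
    moreover have "?G \<subseteq> Pow UNIV" by simp
    moreover have Gb: "sets borel = sigma_sets UNIV ?G"
      unfolding borel_eq_box by (simp add: box_real[abs_def])
    then have "E \<in> sigma_sets UNIV ?G" using E by simp
    ultimately show ?thesis
    proof (induction rule: sigma_sets_induct_disjoint)
      case (basic A)
      then obtain a b where "A = {a<..<b}" by auto
      then have "A \<inter> {-N<..<N} = {max a (-N)<..<min b N}" by auto
      then show ?case using XD[OF x] by blast
    next
      case empty
      then show ?case using XD[OF x, of "{}" 0 0] by simp
    next
      case (compl A)
      have "(\<lambda>t. indicator {-N<..<N} t *\<^sub>R x + - (indicator (A \<inter> {-N<..<N}) t *\<^sub>R x)) \<in> \<D>"
        by (intro D_add D_minus compl XD[OF x refl])
      moreover have "(\<lambda>t. indicator {-N<..<N} t *\<^sub>R x + - (indicator (A \<inter> {-N<..<N}) t *\<^sub>R x)) =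
          (\<lambda>t. indicator ((UNIV - A) \<inter> {-N<..<N}) t *\<^sub>R x)"
        by (auto simp: indicator_def fun_eq_iff)
      ultimately show ?case by simp
    next
      case (union A)
      define U where "U n = (\<Union>i<n. A i)" for n
      have Ab: "A i \<in> sets borel" for i using union(2) Gb by auto
      have Ub: "U n \<in> sets borel" "(\<Union>i. A i) \<in> sets borel" for n unfolding U_def using Ab by auto
      have UD: "(\<lambda>t. indicator (U n \<inter> {-N<..<N}) t *\<^sub>R x) \<in> \<D>" for n
      proof (induction n)
        case 0
        then show ?case using XD[OF x, of "{}" 0 0] by (simp add: U_def)
      next
        case (Suc n)
        have disj: "U n \<inter> A n = {}" 
        proof -
          have "A i \<inter> A n = {}" if "i < n" for i
            using union(1) that unfolding disjoint_family_on_def by (metis UNIV_I less_irrefl)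
          then show ?thesis unfolding U_def by blast
        qed
        have "(\<lambda>t. indicator (U (Suc n) \<inter> {-N<..<N}) t *\<^sub>R x) =
          (\<lambda>t. indicator (U n \<inter> {-N<..<N}) t *\<^sub>R x + indicator (A n \<inter> {-N<..<N}) t *\<^sub>R x)"
        proof
          fix t
          have "U (Suc n) = U n \<union> A n" by (auto simp: U_def lessThan_Suc)
          then show "indicator (U (Suc n) \<inter> {-N<..<N}) t *\<^sub>R x =
            indicator (U n \<inter> {-N<..<N}) t *\<^sub>R x + indicator (A n \<inter> {-N<..<N}) t *\<^sub>R x"
            using disj by (cases "t \<in> U n"; cases "t \<in> A n") (auto simp: indicator_def)
        qed
        then show ?case using D_add[OF Suc union(3)[of n]] by simp
      qed
      show ?case
      proof (rule DI[of _ "\<lambda>n t. indicator (U n \<inter> {-N<..<N}) t *\<^sub>R x"])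
        show "(\<lambda>t. indicator (\<Union> (range A) \<inter> {-N<..<N}) t *\<^sub>R x) \<in> L2k k" by (rule L2k_indicator_scaleR[OF Ub(2)])
        show "(\<lambda>n. nk k (\<lambda>t. indicator (U n \<inter> {-N<..<N}) t *\<^sub>R x - indicator (\<Union> (range A) \<inter> {-N<..<N}) t *\<^sub>R x)) \<longlonglongrightarrow> 0"
        proof (rule nk_dominated)
          show "integrable lborel (\<lambda>t. (norm (indicator (\<Union> (range A) \<inter> {-N<..<N}) t *\<^sub>R x))\<^sup>2 * k t)"
            by (rule L2k_int[OF L2k_indicator_scaleR[OF Ub(2)]])
          show "(\<lambda>t. indicator (U n \<inter> {-N<..<N}) t *\<^sub>R x - indicator (\<Union> (range A) \<inter> {-N<..<N}) t *\<^sub>R x) \<in> borel_measurable borel" for n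
            by (intro L2k_meas L2k_diff L2k_indicator_scaleR Ub)
          show "(norm (indicator (U n \<inter> {-N<..<N}) t *\<^sub>R x - indicator (\<Union> (range A) \<inter> {-N<..<N}) t *\<^sub>R x))\<^sup>2 * k t
            \<le> (norm (indicator (\<Union> (range A) \<inter> {-N<..<N}) t *\<^sub>R x))\<^sup>2 * k t" for n t
            using k_nonneg by (intro mult_right_mono power_mono) (auto simp: indicator_def U_def)
          show "(\<lambda>n. indicator (U n \<inter> {-N<..<N}) t *\<^sub>R x - indicator (\<Union> (range A) \<inter> {-N<..<N}) t *\<^sub>R x) \<longlonglongrightarrow> 0" for t
          proof (cases "t \<in> \<Union> (range A)")
            case True
            then obtain i where "t \<in> A i" by blast
            then have "\<forall>n>i. t \<in> U n" unfolding U_def by blast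
            then have "\<forall>\<^sub>F n in sequentially. indicator (U n \<inter> {-N<..<N}) t *\<^sub>R x - indicator (\<Union> (range A) \<inter> {-N<..<N}) t *\<^sub>R x = 0"
              using True unfolding eventually_sequentially by (intro exI[of _ "Suc i"]) (auto simp: indicator_def)
            then show ?thesis by (rule tendsto_eventually)
          next
            case False
            then show ?thesis by (auto simp: U_def indicator_def)
          qed
        qed
      qed (use UD in auto)
    qed
  qed
  have YB: "(\<lambda>t. indicator (E \<inter> {-N<..<N}) t *\<^sub>R x) \<in> \<D>" if E: "E \<in> sets borel" for x E and N :: real
  proof -
    obtain s where s: "\<And>n. s n \<in> X" "s \<longlonglongrightarrow> x" using X closure_sequential[of x X] by auto
    show ?thesis
    proof (rule DI[of _ "\<lambda>n t. indicator (E \<inter> {-N<..<N}) t *\<^sub>R s n"])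
      show "(\<lambda>t. indicator (E \<inter> {-N<..<N}) t *\<^sub>R x) \<in> L2k k" by (rule L2k_indicator_scaleR[OF E])
      have "nk k (\<lambda>t. indicator (E \<inter> {-N<..<N}) t *\<^sub>R s n - indicator (E \<inter> {-N<..<N}) t *\<^sub>R x) =
        norm (s n - x) * sqrt (\<integral>t. indicator (E \<inter> {-N<..<N}) t * k t \<partial>lborel)" for n
      proof -
        have *: "(norm (indicator (E \<inter> {-N<..<N}) t *\<^sub>R s n - indicator (E \<inter> {-N<..<N}) t *\<^sub>R x))\<^sup>2 * k t =
          (norm (s n - x))\<^sup>2 * (indicator (E \<inter> {-N<..<N}) t * k t)" for t
          by (auto simp: indicator_def)
        show ?thesis unfolding nk_def * by (simp add: real_sqrt_mult)
      qed
      moreover have "(\<lambda>n. norm (s n - x) * sqrt (\<integral>t. indicator (E \<inter> {-N<..<N}) t * k t \<partial>lborel)) \<longlonglongrightarrow>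
        norm (x - x) * sqrt (\<integral>t. indicator (E \<inter> {-N<..<N}) t * k t \<partial>lborel)"
        by (intro tendsto_intros s)
      ultimately show "(\<lambda>n. nk k (\<lambda>t. indicator (E \<inter> {-N<..<N}) t *\<^sub>R s n - indicator (E \<inter> {-N<..<N}) t *\<^sub>R x)) \<longlonglongrightarrow> 0"
        by simp
    qed (use XB s E in auto)
  qed
  have fm: "f \<in> borel_measurable borel" by (rule L2k_meas[OF f])
  obtain D where D: "countable D" "range f \<subseteq> closure D"
    using borel_measurable_real_separable_range[OF fm] by blast
  have "D \<noteq> {}" using D(2) by auto
  define d where "d = from_nat_into D"
  have d: "range d = D" unfolding d_def using range_from_nat_into[OF \<open>D \<noteq> {}\<close> D(1)] .
  define s where "s = rec_nat (\<lambda>_. 0 :: 'a) (\<lambda>m u t. if dist (f t) (d m) < dist (f t) (u t) then d m else u t)"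
  have s: "s 0 = (\<lambda>_. 0)" "s (Suc m) = (\<lambda>t. if dist (f t) (d m) < dist (f t) (s m t) then d m else s m t)" for m
    by (auto simp: s_def)
  have sm: "s m \<in> borel_measurable borel" for m
  proof (induction m)
    case (Suc m)
    have "{t \<in> space borel. dist (f t) (d m) < dist (f t) (s m t)} \<in> sets borel"
      using borel_measurable_real_dist[OF fm Suc] borel_measurable_real_dist[OF fm, of "\<lambda>_. d m"] by measurable
    then show ?case unfolding s by (intro measurable_If) (use Suc in auto)
  qed (simp add: s)
  have sD: "E \<in> sets borel \<Longrightarrow> (\<lambda>t. indicator (E \<inter> {-N<..<N}) t *\<^sub>R s m t) \<in> \<D>" for m E and N :: real
  proof (induction m arbitrary: E)
    case 0
    then show ?case using YB[of "{}" N 0] by (simp add: s)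
  next
    case (Suc m)
    define F where "F = {t. dist (f t) (d m) < dist (f t) (s m t)}"
    have "{t \<in> space borel. dist (f t) (d m) < dist (f t) (s m t)} \<in> sets borel"
      using borel_measurable_real_dist[OF fm sm[of m]] borel_measurable_real_dist[OF fm, of "\<lambda>_. d m"] by measurable
    then have "F \<in> sets borel" by (simp add: F_def)
    then have "(\<lambda>t. indicator ((E \<inter> F) \<inter> {-N<..<N}) t *\<^sub>R d m + indicator ((E - F) \<inter> {-N<..<N}) t *\<^sub>R s m t) \<in> \<D>"
      using Suc by (intro D_add YB Suc.IH) auto
    moreover have "(\<lambda>t. indicator ((E \<inter> F) \<inter> {-N<..<N}) t *\<^sub>R d m + indicator ((E - F) \<inter> {-N<..<N}) t *\<^sub>R s m t)
      = (\<lambda>t. indicator (E \<inter> {-N<..<N}) t *\<^sub>R s (Suc m) t)"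
      unfolding s F_def by (auto simp: indicator_def fun_eq_iff)
    ultimately show ?case by simp
  qed
  have s_norm: "dist (f t) (s m t) \<le> norm (f t)" for m t
    by (induction m) (auto simp: s)
  have s_d: "dist (f t) (s m t) \<le> dist (f t) (d i)" if "i < m" for i m t
    using that by (induction m) (auto simp: s less_Suc_eq)
  have s_lim: "(\<lambda>m. s m t) \<longlonglongrightarrow> f t" for t
  proof (rule metric_LIMSEQ_I)
    fix e :: real assume e: "e > 0"
    have "f t \<in> closure D" using D(2) by auto
    then obtain i where "dist (d i) (f t) < e" using e d unfolding closure_approachable by blast
    then have "dist (s m t) (f t) < e" if "m \<ge> Suc i" for m
      using s_d[of i m t] that by (simp add: dist_commute)
    then show "\<exists>no. \<forall>n\<ge>no. dist (s n t) (f t) < e" by blast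
  qed
  have "f \<in> \<D>"
  proof (rule DI[of _ "\<lambda>m t. indicator (UNIV \<inter> {- real m<..<real m}) t *\<^sub>R s m t"])
    show "(\<lambda>n. nk k (\<lambda>t. indicator (UNIV \<inter> {- real n<..<real n}) t *\<^sub>R s n t - f t)) \<longlonglongrightarrow> 0"
    proof (rule nk_dominated)
      show "integrable lborel (\<lambda>t. (norm (f t))\<^sup>2 * k t)" by (rule L2k_int[OF f])
      show "(\<lambda>t. indicator (UNIV \<inter> {- real n<..<real n}) t *\<^sub>R s n t - f t) \<in> borel_measurable borel" for n
        by (intro borel_measurable_real_diff borel_measurable_real_scaleR sm fm) auto
      show "(norm (indicator (UNIV \<inter> {- real n<..<real n}) t *\<^sub>R s n t - f t))\<^sup>2 * k t \<le> (norm (f t))\<^sup>2 * k t" for n t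
        using s_norm[of t n] by (intro mult_right_mono power_mono k_nonneg) (auto simp: indicator_def dist_norm norm_minus_commute)
      show "(\<lambda>n. indicator (UNIV \<inter> {- real n<..<real n}) t *\<^sub>R s n t - f t) \<longlonglongrightarrow> 0" for t
      proof -
        obtain n0 where n0: "\<bar>t\<bar> < real n0" using reals_Archimedean2 by blast
        have "\<forall>\<^sub>F n in sequentially. s n t - f t = indicator (UNIV \<inter> {- real n<..<real n}) t *\<^sub>R s n t - f t"
          unfolding eventually_sequentially using n0 by (intro exI[of _ n0]) (auto simp: indicator_def)
        moreover have "(\<lambda>n. s n t - f t) \<longlonglongrightarrow> 0" using s_lim[of t] by (simp add: LIM_zero)
        ultimately show ?thesis by (rule Lim_transform_eventually[rotated])
      qed
    qed
  qed (rule f, rule sD, simp)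
  then show ?thesis using e unfolding \<D>_def by blast
qed

end

section \<open>Difference quotients in exponentially weighted spaces\<close>

definition ew :: "real \<Rightarrow> real \<Rightarrow> real" where
  "ew \<mu> t = exp (- 2 * \<mu> * t)"

lemma L2w_ew: "L2w \<mu> = L2k (ew \<mu>)"
  unfolding L2w_eq ew_def[abs_def] by (rule refl)

lemma normw_ew: "normw \<mu> = nk (ew \<mu>)"
  unfolding normw_eq ew_def[abs_def] by (rule refl)

interpretation ew: weight "ew \<mu>" for \<mu>
  by unfold_locales (auto simp: ew_def intro!: continuous_intros)

lemma ew_shift: "ew \<mu> t = exp (- 2 * \<mu> * h) * ew \<mu> (t - h)"
  by (simp add: ew_def exp_add[symmetric] algebra_simps)

lemma integral_shift:
  fixes F :: "real \<Rightarrow> real"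
  shows "(\<integral>t. F (t - h) \<partial>lborel) = (\<integral>t. F t \<partial>lborel)"
    and "integrable lborel F \<Longrightarrow> integrable lborel (\<lambda>t. F (t - h))"
  using lborel_integral_real_affine[of 1 F "-h"] lborel_integrable_real_affine[of F 1 "-h"]
  by (simp_all add: add.commute)

lemma integral_ew_shift:
  fixes g :: "real \<Rightarrow> real"
  shows "(\<integral>t. g (t - h) * ew \<mu> t \<partial>lborel) = exp (- 2 * \<mu> * h) * (\<integral>t. g t * ew \<mu> t \<partial>lborel)"
    and "integrable lborel (\<lambda>t. g t * ew \<mu> t) \<Longrightarrow> integrable lborel (\<lambda>t. g (t - h) * ew \<mu> t)"
proof -
  have eq: "(\<lambda>t. g (t - h) * ew \<mu> t) = (\<lambda>t. exp (- 2 * \<mu> * h) * (g (t - h) * ew \<mu> (t - h)))"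
    by (subst ew_shift[of \<mu> _ h]) (simp add: algebra_simps)
  show "(\<integral>t. g (t - h) * ew \<mu> t \<partial>lborel) = exp (- 2 * \<mu> * h) * (\<integral>t. g t * ew \<mu> t \<partial>lborel)"
    unfolding eq using integral_shift(1)[of "\<lambda>t. g t * ew \<mu> t" h] by simp
  show "integrable lborel (\<lambda>t. g (t - h) * ew \<mu> t)" if "integrable lborel (\<lambda>t. g t * ew \<mu> t)"
    unfolding eq by (intro integrable_mult_right integral_shift(2)[of "\<lambda>t. g t * ew \<mu> t" h] that)
qed

lemma L2k_shift:
  fixes f :: "real \<Rightarrow> 'a::chilbert"
  assumes "f \<in> L2k (ew \<mu>)"
  shows "(\<lambda>t. f (t - h)) \<in> L2k (ew \<mu>)"
proof -
  have "(\<lambda>t. f (t - h)) \<in> borel_measurable borel"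
    by (rule measurable_compose[OF _ ew.L2k_meas[OF assms]]) simp
  then show ?thesis
    using integral_ew_shift(2)[of "\<lambda>t. (norm (f t))\<^sup>2" \<mu> h] ew.L2k_int[OF assms] by (simp add: L2k_def)
qed

lemma nk_shift: "nk (ew \<mu>) (\<lambda>t. f (t - h)) = exp (- \<mu> * h) * nk (ew \<mu>) f"
proof -
  have "sqrt (exp (- 2 * \<mu> * h)) = exp (- \<mu> * h)"
    by (rule real_sqrt_unique) (auto simp: power2_eq_square exp_add[symmetric])
  then show ?thesis
    unfolding nk_def integral_ew_shift(1)[of "\<lambda>t. (norm (f t))\<^sup>2" h \<mu>] real_sqrt_mult by simp
qed

definition dq :: "real \<Rightarrow> (real \<Rightarrow> 'a::chilbert) \<Rightarrow> real \<Rightarrow> 'a" where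
  "dq h f t = (1 / h) *\<^sub>R (f t - f (t - h))"

lemma L2k_dq: "f \<in> L2k (ew \<mu>) \<Longrightarrow> dq h f \<in> L2k (ew \<mu>)"
  unfolding dq_def[abs_def] by (intro ew.L2k_scaleR ew.L2k_diff L2k_shift)

lemma dq_diff: "dq h (\<lambda>t. f t - g t) t = dq h f t - dq h g t"
  by (simp add: dq_def algebra_simps)

lemma dq_bounded_linear:
  assumes "bounded_linear M"
  shows "dq h (\<lambda>t. M (f t)) t = M (dq h f t)"
  by (simp add: dq_def linear_simps[OF assms])

lemma dq_halve:
  "h \<noteq> 0 \<Longrightarrow> dq h f t = (1/2) *\<^sub>R (dq (h/2) f t + dq (h/2) f (t - h/2))"
  by (simp add: dq_def algebra_simps)

lemma dq_halve_diff:
  assumes "h \<noteq> 0"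
  shows "dq h f t - dq (h/2) f t = (- (h/4)) *\<^sub>R dq (h/2) (dq (h/2) f) t"
proof -
  define x y where "x = dq (h/2) f t" and "y = dq (h/2) f (t - h/2)"
  have "dq (h/2) (dq (h/2) f) t = (2 / h) *\<^sub>R (x - y)"
    unfolding dq_def[of "h/2" "dq (h/2) f"] x_def y_def by simp
  then have "(- (h/4)) *\<^sub>R dq (h/2) (dq (h/2) f) t = (1/2) *\<^sub>R (y - x)"
    using assms by (simp add: scaleR_diff_right)
  also have "\<dots> = (1/2) *\<^sub>R (x + y) - (1/2) *\<^sub>R (x + x)"
    unfolding scaleR_diff_right[symmetric] by (rule arg_cong) simp
  also have "\<dots> = dq h f t - x" unfolding dq_halve[OF assms, of f t] x_def[symmetric] y_def[symmetric] by simp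
  finally show ?thesis by (simp add: x_def)
qed

lemma nk_dq_le:
  assumes "f \<in> L2k (ew \<mu>)" "h > 0"
  shows "nk (ew \<mu>) (dq h f) \<le> (1 + exp (- \<mu> * h)) / h * nk (ew \<mu>) f"
proof -
  define n e where "n = nk (ew \<mu>) f" and "e = exp (- \<mu> * h)"
  have "nk (ew \<mu>) (\<lambda>t. f t - f (t - h)) \<le> n + e * n"
    using ew.nk_triangle_sub[OF assms(1) L2k_shift[OF assms(1)], of h] unfolding nk_shift n_def e_def .
  then have "\<bar>1 / h\<bar> * nk (ew \<mu>) (\<lambda>t. f t - f (t - h)) \<le> \<bar>1 / h\<bar> * (n + e * n)"
    by (rule mult_left_mono) simp
  also have "\<dots> = (1 + e) / h * n" using assms(2) by (simp add: field_simps)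
  finally show ?thesis unfolding dq_def[abs_def] ew.nk_scaleR n_def e_def .
qed

definition ccont :: "(real \<Rightarrow> 'a::chilbert) \<Rightarrow> bool" where
  "ccont f \<longleftrightarrow> continuous_on UNIV f \<and> (\<exists>a b. \<forall>t. t \<notin> {a..b} \<longrightarrow> f t = 0)"

lemma test_fun_ccont: "test_fun f \<Longrightarrow> ccont f"
proof -
  assume f: "test_fun f"
  obtain a b where "\<And>t. t \<notin> {a..b} \<Longrightarrow> f t = 0" using test_fun_support[OF f] by blast
  then show "ccont f" unfolding ccont_def using test_fun_continuous[OF f] by blast
qed

lemma (in weight) ccont_L2k:
  assumes "ccont f"
  shows "f \<in> L2k k"
proof -
  obtain a b where "\<And>t. t \<notin> {a..b} \<Longrightarrow> f t = 0" using assms unfolding ccont_def by blast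
  moreover have "continuous_on UNIV f" using assms by (simp add: ccont_def)
  ultimately show ?thesis by (rule L2k_cont_compact[rotated])
qed

lemma ccont_add:
  assumes "ccont f" "ccont g"
  shows "ccont (\<lambda>t. f t + g t)"
proof -
  obtain a b where ab: "\<And>t. t \<notin> {a..b} \<Longrightarrow> f t = 0" using assms(1) unfolding ccont_def by blast
  obtain c d where cd: "\<And>t. t \<notin> {c..d} \<Longrightarrow> g t = 0" using assms(2) unfolding ccont_def by blast
  have "f t + g t = 0" if "t \<notin> {min a c..max b d}" for t
  proof -
    have "t \<notin> {a..b}" "t \<notin> {c..d}" using that by auto
    then show ?thesis by (simp add: ab cd)
  qed
  moreover have "continuous_on UNIV (\<lambda>t. f t + g t)"
    using assms by (intro continuous_intros) (auto simp: ccont_def)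
  ultimately show ?thesis unfolding ccont_def by blast
qed

lemma ccont_bounded_linear:
  assumes M: "bounded_linear M" and "ccont f"
  shows "ccont (\<lambda>t. M (f t))"
proof -
  obtain a b where ab: "\<And>t. t \<notin> {a..b} \<Longrightarrow> f t = 0" and c: "continuous_on UNIV f" using assms(2) unfolding ccont_def by blast
  have "M (f t) = 0" if "t \<notin> {a..b}" for t using ab[OF that] by (simp add: linear_simps[OF M])
  then show ?thesis unfolding ccont_def using bounded_linear.continuous_on[OF M c] by blast
qed

lemma ccont_diff: "ccont f \<Longrightarrow> ccont g \<Longrightarrow> ccont (\<lambda>t. f t - g t)"
  using ccont_add[OF _ ccont_bounded_linear[OF bounded_linear_minus[OF bounded_linear_ident]], of f g] by simp

lemma ccont_shift:
  assumes "ccont f"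
  shows "ccont (\<lambda>t. f (t - h))"
proof -
  obtain a b where ab: "\<And>t. t \<notin> {a..b} \<Longrightarrow> f t = 0" and c: "continuous_on UNIV f" using assms unfolding ccont_def by blast
  have "f (t - h) = 0" if "t \<notin> {a + h..b + h}" for t using that by (intro ab) auto
  moreover have "continuous_on UNIV (\<lambda>t. f (t - h))"
    by (rule continuous_on_compose2[OF c]) (auto intro!: continuous_intros)
  ultimately show ?thesis unfolding ccont_def by blast
qed

lemma ccont_zero: "ccont (\<lambda>_. 0)" by (auto simp: ccont_def)

lemma ccont_sum: "(\<And>i. i \<in> I \<Longrightarrow> ccont (f i)) \<Longrightarrow> ccont (\<lambda>t. \<Sum>i\<in>I. f i t)"
  by (induction I rule: infinite_finite_induct) (auto intro: ccont_add ccont_zero)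

lemma ccont_dq: "ccont f \<Longrightarrow> ccont (dq h f)"
  using ccont_bounded_linear[OF bounded_linear_scaleR_right[of "1/h"] ccont_add[of f "\<lambda>t. - f (t - h)"]]
    ccont_bounded_linear[OF bounded_linear_minus[OF bounded_linear_ident] ccont_shift[of f h]]
  by (simp add: dq_def[abs_def])

lemma dq_bound:
  fixes f :: "real \<Rightarrow> 'a::chilbert"
  assumes f': "\<And>t. (f has_vector_derivative f' t) (at t)" and L: "\<And>t. norm (f' t) \<le> L" and h: "h > 0"
  shows "norm (dq h f t) \<le> L"
proof -
  have "norm (f t - f (t - h)) \<le> L * norm (t - (t - h))"
  proof (rule differentiable_bound[where S = UNIV and f' = "\<lambda>t s. s *\<^sub>R f' t"])
    show "(f has_derivative (\<lambda>s. s *\<^sub>R f' x)) (at x within UNIV)" for x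
      using f'[of x] by (simp add: has_vector_derivative_def)
    show "onorm (\<lambda>s. s *\<^sub>R f' x) \<le> L" for x
    proof (rule onorm_bound)
      show "norm (s *\<^sub>R f' x) \<le> L * norm s" for s
        using mult_right_mono[OF L[of x], of "norm s"] by (simp add: mult.commute)
      show "0 \<le> L" using L[of x] norm_ge_zero order_trans by blast
    qed
  qed auto
  then show ?thesis using h by (simp add: dq_def pos_divide_le_eq)
qed

lemma ccont_bounded:
  assumes "ccont f"
  obtains L where "L \<ge> 0" "\<And>t. norm (f t) \<le> L"
proof -
  obtain a b where ab: "\<And>t. t \<notin> {a..b} \<Longrightarrow> f t = 0" and c: "continuous_on UNIV f" using assms unfolding ccont_def by blast
  have "compact (f ` {a..b})" by (intro compact_continuous_image continuous_on_subset[OF c]) auto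
  then obtain B where B: "\<And>t. t \<in> {a..b} \<Longrightarrow> norm (f t) \<le> B" using compact_imp_bounded bounded_iff by (metis image_eqI)
  have "norm (f t) \<le> max 0 B" for t using B[of t] ab[of t] by (cases "t \<in> {a..b}") auto
  then show thesis by (intro that[of "max 0 B"]) auto
qed

lemma dq_tendsto:
  assumes f': "(f has_vector_derivative f' t) (at t)" and s: "s \<longlonglongrightarrow> 0" "\<And>n::nat. s n \<noteq> 0"
  shows "(\<lambda>n. dq (s n) f t) \<longlonglongrightarrow> f' t"
proof -
  have "((\<lambda>y. (1 / (y - t)) *\<^sub>R (f y - f t)) \<longlongrightarrow> f' t) (at t)"
  proof -
    have "((\<lambda>y. ((f y - f t) - (y - t) *\<^sub>R f' t) /\<^sub>R norm (y - t)) \<longlongrightarrow> 0) (at t)"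
      using f' by (simp add: has_vector_derivative_def has_derivative_at_within)
    then have "((\<lambda>y. norm (((f y - f t) - (y - t) *\<^sub>R f' t) /\<^sub>R norm (y - t))) \<longlongrightarrow> 0) (at t)"
      by (rule tendsto_norm_zero)
    moreover have "norm (((f y - f t) - (y - t) *\<^sub>R f' t) /\<^sub>R norm (y - t)) =
        norm ((1 / (y - t)) *\<^sub>R (f y - f t) - f' t)" if "y \<noteq> t" for y
    proof -
      have "(1 / (y - t)) *\<^sub>R (f y - f t) - f' t = (1 / (y - t)) *\<^sub>R ((f y - f t) - (y - t) *\<^sub>R f' t)"
        using that by (simp add: scaleR_diff_right)
      then show ?thesis by (simp add: inverse_eq_divide)
    qed
    then have "\<forall>\<^sub>F y in at t. norm (((f y - f t) - (y - t) *\<^sub>R f' t) /\<^sub>R norm (y - t)) =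
        norm ((1 / (y - t)) *\<^sub>R (f y - f t) - f' t)"
      by (auto simp: eventually_at_filter)
    ultimately have "((\<lambda>y. norm ((1 / (y - t)) *\<^sub>R (f y - f t) - f' t)) \<longlongrightarrow> 0) (at t)"
      by (rule Lim_transform_eventually)
    then show ?thesis by (simp add: tendsto_norm_zero_iff LIM_zero_iff)
  qed
  moreover have "filterlim (\<lambda>n. t - s n) (at t) sequentially"
    using tendsto_diff[OF tendsto_const s(1), of t] s(2) by (auto simp: filterlim_at)
  ultimately have "(\<lambda>n. (1 / (t - s n - t)) *\<^sub>R (f (t - s n) - f t)) \<longlonglongrightarrow> f' t"
    by (rule filterlim_compose)
  moreover have "(1 / (t - s n - t)) *\<^sub>R (f (t - s n) - f t) = dq (s n) f t" for n
    by (simp add: dq_def algebra_simps)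
  ultimately show ?thesis by simp
qed

lemma (in weight) nk_bounded_support:
  fixes f :: "nat \<Rightarrow> real \<Rightarrow> 'a::chilbert"
  assumes f: "\<And>n. f n \<in> borel_measurable borel" and supp: "\<And>n t. t \<notin> {a..b} \<Longrightarrow> f n t = 0"
    and L: "\<And>n t. norm (f n t) \<le> L" and lim: "\<And>t. (\<lambda>n. f n t) \<longlonglongrightarrow> 0"
  shows "(\<lambda>n. nk k (f n)) \<longlonglongrightarrow> 0"
proof (rule nk_dominated[OF f _ _ lim])
  show "integrable lborel (\<lambda>t. indicator {a..b} t *\<^sub>R (L\<^sup>2 * k t))"
    by (rule borel_integrable_compact) (auto intro!: continuous_intros continuous_on_subset[OF k_cont])
  show "(norm (f n t))\<^sup>2 * k t \<le> indicator {a..b} t *\<^sub>R (L\<^sup>2 * k t)" for n t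
    using supp[of t n] L[of n t] k_nonneg by (cases "t \<in> {a..b}") (auto intro!: mult_right_mono power_mono)
qed

lemma (in weight) nk_le_bounded_support:
  shows "\<exists>C\<ge>0. \<forall>f :: real \<Rightarrow> 'a::chilbert. f \<in> L2k k \<longrightarrow> (\<forall>t. t \<notin> {a..b} \<longrightarrow> f t = 0) \<longrightarrow> (\<forall>t. norm (f t) \<le> L) \<longrightarrow> nk k f \<le> C"
proof (intro exI conjI allI impI)
  show "sqrt (\<integral>t. indicator {a..b} t *\<^sub>R (L\<^sup>2 * k t) \<partial>lborel) \<ge> 0"
    using k_nonneg by (intro real_sqrt_ge_zero integral_nonneg_AE) auto
  fix f :: "real \<Rightarrow> 'a" assume f: "f \<in> L2k k" and supp: "\<forall>t. t \<notin> {a..b} \<longrightarrow> f t = 0" and L: "\<forall>t. norm (f t) \<le> L"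
  show "nk k f \<le> sqrt (\<integral>t. indicator {a..b} t *\<^sub>R (L\<^sup>2 * k t) \<partial>lborel)"
    unfolding nk_def
  proof (intro real_sqrt_le_mono integral_mono L2k_int f)
    show "integrable lborel (\<lambda>t. indicator {a..b} t *\<^sub>R (L\<^sup>2 * k t))"
      by (rule borel_integrable_compact) (auto intro!: continuous_intros continuous_on_subset[OF k_cont])
    show "(norm (f t))\<^sup>2 * k t \<le> indicator {a..b} t *\<^sub>R (L\<^sup>2 * k t)" for t
      using supp L k_nonneg by (cases "t \<in> {a..b}") (auto intro!: mult_right_mono power_mono)
  qed
qed

lemma nk_dq_test_fun_tendsto:
  fixes f :: "real \<Rightarrow> 'a::chilbert"
  assumes f: "test_fun f" and f': "\<And>t. (f has_vector_derivative f' t) (at t)" "test_fun f'"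
    and s: "s \<longlonglongrightarrow> 0" "\<And>n. 0 < s n" "\<And>n. s n \<le> 1"
  shows "(\<lambda>n. nk (ew \<mu>) (\<lambda>t. dq (s n) f t - f' t)) \<longlonglongrightarrow> 0"
proof -
  obtain a b where ab: "\<And>t. t \<notin> {a..b} \<Longrightarrow> f t = 0" using test_fun_support[OF f] by blast
  obtain c d where cd: "\<And>t. t \<notin> {c..d} \<Longrightarrow> f' t = 0" using test_fun_support[OF f'(2)] by blast
  obtain L where L: "L \<ge> 0" "\<And>t. norm (f' t) \<le> L" using ccont_bounded[OF test_fun_ccont[OF f'(2)]] by blast
  show ?thesis
  proof (rule ew.nk_bounded_support[where a = "min a c" and b = "max (b + 1) d" and L = "L + L"])
    show "(\<lambda>t. dq (s n) f t - f' t) \<in> borel_measurable borel" for n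
      using f f'(2) by (intro borel_measurable_real_diff ew.L2k_meas[of _ 0] L2k_dq ew.ccont_L2k test_fun_ccont)
    show "dq (s n) f t - f' t = 0" if "t \<notin> {min a c..max (b + 1) d}" for n t
    proof -
      have "t \<notin> {a..b}" "t - s n \<notin> {a..b}" "t \<notin> {c..d}" using that s(2)[of n] s(3)[of n] by auto
      then show ?thesis by (simp add: dq_def ab cd)
    qed
    show "norm (dq (s n) f t - f' t) \<le> L + L" for n t
      by (intro order_trans[OF norm_triangle_ineq4] add_mono L dq_bound[OF f'(1) _ s(2)])
    have "(\<lambda>n. dq (s n) f t - f' t) \<longlonglongrightarrow> f' t - f' t" for t
      by (intro tendsto_intros dq_tendsto f'(1) s) (use s(2) in \<open>auto simp: less_imp_neq[THEN not_sym]\<close>)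
    then show "(\<lambda>n. dq (s n) f t - f' t) \<longlonglongrightarrow> 0" for t by simp
  qed
qed

lemma dyadic_tendsto_0: "(\<lambda>n. h / 2 ^ n :: real) \<longlonglongrightarrow> 0"
  by (rule LIMSEQ_divide_realpow_zero) simp

text \<open>Averaging two difference quotients of half the step shows that the norm only grows as the
  step is halved; this needs \<open>\<mu> \<ge> 0\<close>.\<close>

lemma nk_dq_le_derivative:
  fixes f :: "real \<Rightarrow> 'a::chilbert"
  assumes f: "test_fun f" and f': "\<And>t. (f has_vector_derivative f' t) (at t)" "test_fun f'"
    and mu: "\<mu> \<ge> 0" and h: "0 < h" "h \<le> 1"
  shows "nk (ew \<mu>) (dq h f) \<le> nk (ew \<mu>) f'"
proof -
  have fL: "f \<in> L2k (ew \<mu>)" "f' \<in> L2k (ew \<mu>)" using f f'(2) by (auto intro: ew.ccont_L2k test_fun_ccont)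
  have half: "nk (ew \<mu>) (dq h f) \<le> nk (ew \<mu>) (dq (h/2) f)" if h: "h > 0" for h
  proof -
    let ?g = "dq (h/2) f"
    have "nk (ew \<mu>) (dq h f) = nk (ew \<mu>) (\<lambda>t. (1/2) *\<^sub>R (?g t + ?g (t - h/2)))"
      by (rule arg_cong[of _ _ "nk (ew \<mu>)"], rule ext, rule dq_halve) (use h in simp)
    also have "\<dots> = (1/2) * nk (ew \<mu>) (\<lambda>t. ?g t + ?g (t - h/2))" unfolding ew.nk_scaleR by simp
    also have "\<dots> \<le> (1/2) * (nk (ew \<mu>) ?g + exp (- \<mu> * (h/2)) * nk (ew \<mu>) ?g)"
      using ew.nk_triangle[OF L2k_dq[OF fL(1)] L2k_shift[OF L2k_dq[OF fL(1)]], of "h/2" "h/2" "h/2"]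
      unfolding nk_shift by (intro mult_left_mono) auto
    also have "\<dots> \<le> (1/2) * (nk (ew \<mu>) ?g + 1 * nk (ew \<mu>) ?g)"
      using mu h by (intro mult_left_mono add_left_mono mult_right_mono ew.nk_nonneg) auto
    finally show ?thesis by simp
  qed
  have le: "nk (ew \<mu>) (dq h f) \<le> nk (ew \<mu>) (dq (h / 2 ^ n) f)" for n
  proof (induction n)
    case (Suc n)
    then show ?case using half[of "h / 2 ^ n"] h by (simp add: field_simps)
  qed simp
  have "h / 2 ^ n \<le> 1" for n
  proof -
    have "h / 2 ^ n \<le> h" using h by (simp add: field_simps)
    then show ?thesis using h by linarith
  qed
  then have "(\<lambda>n. nk (ew \<mu>) (\<lambda>t. dq (h / 2 ^ n) f t - f' t)) \<longlonglongrightarrow> 0"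
    by (intro nk_dq_test_fun_tendsto[OF f f' dyadic_tendsto_0]) (use h in auto)
  then have "(\<lambda>n. nk (ew \<mu>) f' + nk (ew \<mu>) (\<lambda>t. dq (h / 2 ^ n) f t - f' t)) \<longlonglongrightarrow> nk (ew \<mu>) f' + 0"
    by (intro tendsto_intros)
  moreover have "nk (ew \<mu>) (dq h f) \<le> nk (ew \<mu>) f' + nk (ew \<mu>) (\<lambda>t. dq (h / 2 ^ n) f t - f' t)" for n
    using le[of n] ew.nk_triangle_rev[OF L2k_dq[OF fL(1)] fL(2), of "h / 2 ^ n"] by linarith
  ultimately have "nk (ew \<mu>) (dq h f) \<le> nk (ew \<mu>) f' + 0"
    by (intro LIMSEQ_le_const) blast+
  then show ?thesis by simp
qed

text \<open>Telescoping over halved steps replaces Taylor's formula, so no vector-valued integral is needed.\<close>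

lemma nk_dq_diff_derivative:
  fixes f :: "real \<Rightarrow> 'a::chilbert"
  assumes f: "test_fun f" and f': "\<And>t. (f has_vector_derivative f' t) (at t)" "test_fun f'"
    and h: "h > 0" and C: "\<And>s. 0 < s \<Longrightarrow> s \<le> h \<Longrightarrow> nk (ew \<mu>) (dq s (dq s f)) \<le> C"
  shows "nk (ew \<mu>) (\<lambda>t. dq h f t - f' t) \<le> h / 2 * C"
proof -
  have fL: "f \<in> L2k (ew \<mu>)" "f' \<in> L2k (ew \<mu>)" using f f'(2) by (auto intro: ew.ccont_L2k test_fun_ccont)
  have C0: "C \<ge> 0" using order_trans[OF ew.nk_nonneg C[OF h order_refl]] .
  have step: "nk (ew \<mu>) (\<lambda>t. dq s f t - dq (s/2) f t) \<le> s / 4 * C" if s: "0 < s" "s \<le> h" for s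
  proof -
    have "nk (ew \<mu>) (\<lambda>t. dq s f t - dq (s/2) f t) = nk (ew \<mu>) (\<lambda>t. (- (s/4)) *\<^sub>R dq (s/2) (dq (s/2) f) t)"
      by (rule arg_cong[of _ _ "nk (ew \<mu>)"], rule ext, rule dq_halve_diff) (use s in simp)
    also have "\<dots> = s / 4 * nk (ew \<mu>) (dq (s/2) (dq (s/2) f))" unfolding ew.nk_scaleR using s by simp
    also have "\<dots> \<le> s / 4 * C" using s by (intro mult_left_mono C) auto
    finally show ?thesis .
  qed
  have tele: "nk (ew \<mu>) (\<lambda>t. dq h f t - dq (h / 2 ^ n) f t) \<le> h / 2 * (1 - 1 / 2 ^ n) * C" for n
  proof (induction n)
    case 0
    then show ?case by (simp add: ew.nk_zero)
  next
    case (Suc n)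
    have "h / 2 ^ n \<le> h" using h by (simp add: field_simps)
    then have "nk (ew \<mu>) (\<lambda>t. dq (h / 2 ^ n) f t - dq (h / 2 ^ Suc n) f t) \<le> h / 2 ^ n / 4 * C"
      using step[of "h / 2 ^ n"] h by (simp add: field_simps)
    moreover have "nk (ew \<mu>) (\<lambda>t. dq h f t - dq (h / 2 ^ Suc n) f t) \<le>
      nk (ew \<mu>) (\<lambda>t. dq h f t - dq (h / 2 ^ n) f t) + nk (ew \<mu>) (\<lambda>t. dq (h / 2 ^ n) f t - dq (h / 2 ^ Suc n) f t)"
      by (intro ew.nk_triangle_diff L2k_dq fL)
    ultimately have "nk (ew \<mu>) (\<lambda>t. dq h f t - dq (h / 2 ^ Suc n) f t) \<le> h / 2 * (1 - 1 / 2 ^ n) * C + h / 2 ^ n / 4 * C"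
      using Suc by linarith
    also have "\<dots> = h / 2 * (1 - 1 / 2 ^ Suc n) * C" by (simp add: field_simps)
    finally show ?case .
  qed
  show ?thesis
  proof (rule ew.L2k_Fatou(2)[where f = "\<lambda>n t. dq h f t - dq (h / 2 ^ n) f t" and N = 0])
    show "(\<lambda>t. dq h f t - dq (h / 2 ^ n) f t) \<in> L2k (ew \<mu>)" for n by (intro ew.L2k_diff L2k_dq fL)
    show "(\<lambda>t. dq h f t - f' t) \<in> borel_measurable borel"
      by (intro ew.L2k_meas[of _ \<mu>] ew.L2k_diff L2k_dq fL)
    have "(\<lambda>n. dq (h / 2 ^ n) f t) \<longlonglongrightarrow> f' t" for t
      by (rule dq_tendsto[OF f'(1) dyadic_tendsto_0]) (use h in auto)
    then show "AE t in lborel. (\<lambda>n. dq h f t - dq (h / 2 ^ n) f t) \<longlonglongrightarrow> dq h f t - f' t"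
      by (intro AE_I2 tendsto_intros)
    have "h / 2 * (1 - 1 / 2 ^ n) * C \<le> h / 2 * 1 * C" for n
      using h C0 by (intro mult_right_mono mult_left_mono) auto
    then show "nk (ew \<mu>) (\<lambda>t. dq h f t - dq (h / 2 ^ n) f t) \<le> h / 2 * C" for n
      using order_trans[OF tele[of n], of "h / 2 * C"] by simp
    show "0 \<le> h / 2 * C" using h C0 by simp
  qed
qed

lemma nk_second_dq_bounded:
  fixes f :: "real \<Rightarrow> 'a::chilbert"
  assumes f: "test_fun f"
  obtains C where "C \<ge> 0" "\<And>s. 0 < s \<Longrightarrow> s \<le> 1 \<Longrightarrow> nk (ew \<mu>) (dq s (dq s f)) \<le> C"
proof -
  obtain f' where f': "test_fun f'" "\<And>t. (f has_vector_derivative f' t) (at t)"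
    using test_fun_derivative[OF f] by blast
  obtain f'' where f'': "test_fun f''" "\<And>t. (f' has_vector_derivative f'' t) (at t)"
    using test_fun_derivative[OF f'(1)] by blast
  obtain L where L: "L \<ge> 0" "\<And>t. norm (f'' t) \<le> L" using ccont_bounded[OF test_fun_ccont[OF f''(1)]] by blast
  obtain a b where ab: "\<And>t. t \<notin> {a..b} \<Longrightarrow> f t = 0" using test_fun_support[OF f] by blast
  obtain C where C: "C \<ge> 0" and C': "\<And>g :: real \<Rightarrow> 'a. g \<in> L2k (ew \<mu>) \<Longrightarrow> (\<And>t. t \<notin> {a..b + 2} \<Longrightarrow> g t = 0) \<Longrightarrow> (\<And>t. norm (g t) \<le> L) \<Longrightarrow> nk (ew \<mu>) g \<le> C"
  proof -
    obtain C where "C \<ge> 0" "\<forall>f :: real \<Rightarrow> 'a. f \<in> L2k (ew \<mu>) \<longrightarrow> (\<forall>t. t \<notin> {a..b + 2} \<longrightarrow> f t = 0) \<longrightarrow> (\<forall>t. norm (f t) \<le> L) \<longrightarrow> nk (ew \<mu>) f \<le> C"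
      using ew.nk_le_bounded_support by blast
    then show thesis by (intro that[of C]) auto
  qed
  have "nk (ew \<mu>) (dq s (dq s f)) \<le> C" if s: "0 < s" "s \<le> 1" for s
  proof (rule C')
    show "dq s (dq s f) \<in> L2k (ew \<mu>)" using f by (intro L2k_dq ew.ccont_L2k test_fun_ccont)
    show "dq s (dq s f) t = 0" if "t \<notin> {a..b + 2}" for t
    proof -
      have "t \<notin> {a..b}" "t - s \<notin> {a..b}" "t - s - s \<notin> {a..b}" using that s by auto
      then show ?thesis by (simp add: dq_def ab)
    qed
    have "(dq s f has_vector_derivative dq s f' t) (at t)" for t
    proof -
      have "((\<lambda>t. f (t - s)) has_vector_derivative f' (t - s)) (at t)"
      proof -
        have "((\<lambda>t. t - s) has_vector_derivative 1) (at t)" by (auto intro!: derivative_eq_intros simp: has_real_derivative_iff_has_vector_derivative[symmetric])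
        then have "((f \<circ> (\<lambda>t. t - s)) has_vector_derivative 1 *\<^sub>R f' (t - s)) (at t)"
          by (rule vector_diff_chain_at) (rule f'(2))
        then show ?thesis by (simp add: o_def)
      qed
      then show ?thesis unfolding dq_def[abs_def]
        by (intro bounded_linear.has_vector_derivative[OF bounded_linear_scaleR_right] has_vector_derivative_diff f'(2))
    qed
    moreover have "norm (dq s f' t) \<le> L" for t by (rule dq_bound[OF f''(2) L(2) s(1)])
    ultimately show "norm (dq s (dq s f) t) \<le> L" for t by (rule dq_bound[OF _ _ s(1)])
  qed
  then show thesis using C that by blast
qed

section \<open>The implicit Euler scheme\<close>

lemma bounded_linear_funpow:
  fixes M :: "'b::real_normed_vector \<Rightarrow> 'b"
  assumes "bounded_linear M"
  shows "bounded_linear (M ^^ n)"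
proof (induction n)
  case 0
  then show ?case by (simp add: id_def bounded_linear_ident)
next
  case (Suc n)
  then show ?case using bounded_linear_compose[OF assms Suc] by (simp add: o_def)
qed

locale evo = linear_maximal_monotone DA A
  for DA :: "'a::chilbert set" and A :: "'a \<Rightarrow> 'a" +
  fixes M0 M1 :: "'a \<Rightarrow> 'a" and c K :: real
  assumes M0: "bounded_linear M0" and M1: "bounded_linear M1"
    and M0_sa: "rip (M0 x) y = rip x (M0 y)"
    and M0_nonneg: "rip (M0 x) x \<ge> 0"
    and M0_le: "rip (M0 x) x \<le> K * (norm x)\<^sup>2"
    and K: "K > 0" and c: "c > 0"
    and M1_coercive: "rip (M1 x) x \<ge> c * (norm x)\<^sup>2"
begin

lemma M0_Young: "s > 0 \<Longrightarrow> 2 * rip (M0 a) b \<le> s * rip (M0 a) a + rip (M0 b) b / s"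
  using nonneg_form_Young[OF bounded_linear.linear[OF M0] M0_sa M0_nonneg] .

lemma norm_M0_sq_le: "(norm (M0 x))\<^sup>2 \<le> K * rip (M0 x) x"
proof -
  have "2 * rip (M0 x) (M0 x) \<le> K * rip (M0 x) x + rip (M0 (M0 x)) (M0 x) / K"
    by (rule M0_Young[OF K])
  also have "\<dots> \<le> K * rip (M0 x) x + K * (norm (M0 x))\<^sup>2 / K"
    using K by (intro add_left_mono divide_right_mono M0_le) auto
  finally show ?thesis using K by (simp add: rip_self)
qed

text \<open>The largest loss of coercivity caused by the difference quotient in weight \<open>\<mu>\<close>; it tends to
  \<open>K max 0 (-\<mu>)\<close> as \<open>h \<rightarrow> 0\<close>.\<close>

definition defect :: "real \<Rightarrow> real \<Rightarrow> real" where
  "defect \<mu> h = K * max 0 ((exp (- \<mu> * h) - 1) / h)"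

lemma eventually_defect:
  assumes "\<mu> > - (c / K)"
  obtains \<delta> where "\<delta> > 0" "\<forall>\<^sub>F h in at_right 0. defect \<mu> h \<le> c - \<delta>"
proof -
  have "((\<lambda>h. exp (- \<mu> * h)) has_real_derivative - \<mu>) (at 0)"
    by (auto intro!: derivative_eq_intros)
  then have "((\<lambda>h. (exp (- \<mu> * h) - 1) / h) \<longlongrightarrow> - \<mu>) (at 0)"
    by (simp add: DERIV_def)
  then have "((\<lambda>h. (exp (- \<mu> * h) - 1) / h) \<longlongrightarrow> - \<mu>) (at_right 0)"
    by (rule filterlim_mono) (simp_all add: at_le)
  then have lim: "(defect \<mu> \<longlongrightarrow> K * max 0 (- \<mu>)) (at_right 0)"
    unfolding defect_def[abs_def] by (intro tendsto_intros)
  define \<delta> where "\<delta> = (c - K * max 0 (- \<mu>)) / 2"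
  have "K * max 0 (- \<mu>) < c"
  proof (cases "\<mu> \<ge> 0")
    case False
    have "- \<mu> < c / K" using assms by simp
    then show ?thesis using False K by (simp add: max_def field_simps)
  qed (use c in \<open>simp add: max_def\<close>)
  then have "\<delta> > 0" "K * max 0 (- \<mu>) < c - \<delta>" by (auto simp: \<delta>_def field_simps)
  then show thesis using that order_tendstoD(2)[OF lim] by (blast intro: eventually_mono less_imp_le)
qed

lemma ipk_M0_bounds:
  assumes v: "v \<in> L2k (ew \<mu>)"
  shows "0 \<le> ipk (ew \<mu>) (\<lambda>t. M0 (v t)) v" "ipk (ew \<mu>) (\<lambda>t. M0 (v t)) v \<le> K * (nk (ew \<mu>) v)\<^sup>2"
proof -
  show "0 \<le> ipk (ew \<mu>) (\<lambda>t. M0 (v t)) v"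
    unfolding ipk_def by (rule integral_nonneg_AE) (auto intro!: AE_I2 mult_nonneg_nonneg M0_nonneg ew.k_nonneg)
  have "ipk (ew \<mu>) (\<lambda>t. M0 (v t)) v \<le> (\<integral>t. K * ((norm (v t))\<^sup>2 * ew \<mu> t) \<partial>lborel)"
    unfolding ipk_def
  proof (rule integral_mono)
    show "rip (M0 (v t)) (v t) * ew \<mu> t \<le> K * ((norm (v t))\<^sup>2 * ew \<mu> t)" for t
      using mult_right_mono[OF M0_le ew.k_nonneg, of "v t" \<mu> t] by (simp add: mult.assoc)
  qed (rule ew.ip_integrable[OF ew.L2k_bounded_linear[OF v M0] v] integrable_mult_right[OF ew.L2k_int[OF v]])+
  then show "ipk (ew \<mu>) (\<lambda>t. M0 (v t)) v \<le> K * (nk (ew \<mu>) v)\<^sup>2" by (simp add: ew.nk_sq)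
qed

lemma ipk_M0_dq_ge:
  assumes v: "v \<in> L2k (ew \<mu>)" and h: "h > 0"
  shows "ipk (ew \<mu>) (\<lambda>t. M0 (dq h v t)) v \<ge> (1 - exp (- \<mu> * h)) / h * ipk (ew \<mu>) (\<lambda>t. M0 (v t)) v"
proof -
  define Q where "Q = ipk (ew \<mu>) (\<lambda>t. M0 (v t)) v"
  define s where "s = exp (\<mu> * h)"
  have s: "s > 0" "1 / s = exp (- \<mu> * h)" by (auto simp: s_def exp_minus inverse_eq_divide)
  have "s * exp (- 2 * \<mu> * h) = exp (\<mu> * h + - 2 * \<mu> * h)" unfolding s_def exp_add ..
  then have s3: "s * exp (- 2 * \<mu> * h) = exp (- \<mu> * h)" by simp
  have L: "(\<lambda>t. v (t - h)) \<in> L2k (ew \<mu>)" "(\<lambda>t. M0 (v t)) \<in> L2k (ew \<mu>)" "(\<lambda>t. M0 (v (t - h))) \<in> L2k (ew \<mu>)"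
    using v by (auto intro!: L2k_shift ew.L2k_bounded_linear[OF _ M0])
  have i1: "integrable lborel (\<lambda>t. rip (M0 (v t)) (v t) * ew \<mu> t)" by (rule ew.ip_integrable[OF L(2) v])
  have i2: "integrable lborel (\<lambda>t. rip (M0 (v (t - h))) (v (t - h)) * ew \<mu> t)" by (rule ew.ip_integrable[OF L(3) L(1)])
  have shift: "(\<integral>t. rip (M0 (v (t - h))) (v (t - h)) * ew \<mu> t \<partial>lborel) = exp (- 2 * \<mu> * h) * Q"
    unfolding Q_def ipk_def by (rule integral_ew_shift(1)[of "\<lambda>t. rip (M0 (v t)) (v t)"])
  have "2 * ipk (ew \<mu>) (\<lambda>t. M0 (v (t - h))) v = (\<integral>t. 2 * (rip (M0 (v (t - h))) (v t) * ew \<mu> t) \<partial>lborel)"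
    by (simp add: ipk_def)
  also have "\<dots> \<le> (\<integral>t. s * (rip (M0 (v (t - h))) (v (t - h)) * ew \<mu> t) + (1 / s) * (rip (M0 (v t)) (v t) * ew \<mu> t) \<partial>lborel)"
  proof (rule integral_mono)
    show "integrable lborel (\<lambda>t. 2 * (rip (M0 (v (t - h))) (v t) * ew \<mu> t))"
      by (intro integrable_mult_right ew.ip_integrable L v)
    show "integrable lborel (\<lambda>t. s * (rip (M0 (v (t - h))) (v (t - h)) * ew \<mu> t) + (1 / s) * (rip (M0 (v t)) (v t) * ew \<mu> t))"
      by (intro Bochner_Integration.integrable_add integrable_mult_right i1 i2)
    fix t
    have "2 * rip (M0 (v (t - h))) (v t) * ew \<mu> t \<le> (s * rip (M0 (v (t - h))) (v (t - h)) + rip (M0 (v t)) (v t) / s) * ew \<mu> t"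
      by (intro mult_right_mono M0_Young s ew.k_nonneg)
    then show "2 * (rip (M0 (v (t - h))) (v t) * ew \<mu> t) \<le> s * (rip (M0 (v (t - h))) (v (t - h)) * ew \<mu> t) + (1 / s) * (rip (M0 (v t)) (v t) * ew \<mu> t)"
      by (simp add: algebra_simps)
  qed
  also have "\<dots> = s * (exp (- 2 * \<mu> * h) * Q) + (1 / s) * Q"
  proof -
    have "(\<integral>t. s * (rip (M0 (v (t - h))) (v (t - h)) * ew \<mu> t) + (1 / s) * (rip (M0 (v t)) (v t) * ew \<mu> t) \<partial>lborel)
      = (\<integral>t. s * (rip (M0 (v (t - h))) (v (t - h)) * ew \<mu> t) \<partial>lborel) + (\<integral>t. (1 / s) * (rip (M0 (v t)) (v t) * ew \<mu> t) \<partial>lborel)"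
      by (rule Bochner_Integration.integral_add; intro integrable_mult_right i1 i2)
    then show ?thesis unfolding shift[symmetric] unfolding Q_def ipk_def by simp
  qed
  also have "\<dots> = 2 * (exp (- \<mu> * h) * Q)" unfolding s(2) mult.assoc[symmetric] s3 by simp
  finally have le: "ipk (ew \<mu>) (\<lambda>t. M0 (v (t - h))) v \<le> exp (- \<mu> * h) * Q" by simp
  have "ipk (ew \<mu>) (\<lambda>t. M0 (dq h v t)) v = (1 / h) * (Q - ipk (ew \<mu>) (\<lambda>t. M0 (v (t - h))) v)"
  proof -
    have "ipk (ew \<mu>) (\<lambda>t. M0 (dq h v t)) v = ipk (ew \<mu>) (\<lambda>t. (1 / h) *\<^sub>R (M0 (v t) - M0 (v (t - h)))) v"
      unfolding dq_def by (simp only: linear_simps[OF M0])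
    then show ?thesis unfolding ew.ipk_scaleR_left ew.ipk_diff_left[OF L(2) L(3) v] Q_def .
  qed
  moreover have "(1 / h) * (Q - exp (- \<mu> * h) * Q) \<le> (1 / h) * (Q - ipk (ew \<mu>) (\<lambda>t. M0 (v (t - h))) v)"
    using le h by (intro mult_left_mono) auto
  moreover have "(1 / h) * (Q - exp (- \<mu> * h) * Q) = (1 - exp (- \<mu> * h)) / h * Q"
    by (simp add: left_diff_distrib diff_divide_distrib)
  ultimately show ?thesis unfolding Q_def by linarith
qed

lemma ipk_M0_dq_ge_defect:
  assumes v: "v \<in> L2k (ew \<mu>)" and h: "h > 0"
  shows "ipk (ew \<mu>) (\<lambda>t. M0 (dq h v t)) v \<ge> - defect \<mu> h * (nk (ew \<mu>) v)\<^sup>2"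
proof -
  define x Q where "x = (exp (- \<mu> * h) - 1) / h" and "Q = ipk (ew \<mu>) (\<lambda>t. M0 (v t)) v"
  have "x * Q \<le> max 0 x * Q" using ipk_M0_bounds(1)[OF v] by (intro mult_right_mono) (auto simp: Q_def)
  also have "\<dots> \<le> max 0 x * (K * (nk (ew \<mu>) v)\<^sup>2)" using ipk_M0_bounds(2)[OF v] by (intro mult_left_mono) (auto simp: Q_def)
  also have "\<dots> = defect \<mu> h * (nk (ew \<mu>) v)\<^sup>2" by (simp add: defect_def x_def)
  finally have "x * Q \<le> defect \<mu> h * (nk (ew \<mu>) v)\<^sup>2" .
  moreover have "(1 - exp (- \<mu> * h)) / h * Q = - (x * Q)" by (simp add: x_def diff_divide_distrib left_diff_distrib)
  ultimately show ?thesis using ipk_M0_dq_ge[OF v h] unfolding Q_def by simp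
qed

lemma energy_inequality:
  assumes L: "v \<in> L2k (ew \<mu>)" "w \<in> L2k (ew \<mu>)" "a \<in> L2k (ew \<mu>)" "g \<in> L2k (ew \<mu>)"
    and eq: "AE t in lborel. g t = w t + M1 (v t) + a t"
    and a: "AE t in lborel. rip (a t) (v t) \<ge> 0"
    and w: "ipk (ew \<mu>) w v \<ge> - (c - \<delta>) * (nk (ew \<mu>) v)\<^sup>2"
  shows "\<delta> * (nk (ew \<mu>) v)\<^sup>2 \<le> ipk (ew \<mu>) g v"
proof -
  have M1L: "(\<lambda>t. M1 (v t)) \<in> L2k (ew \<mu>)" by (rule ew.L2k_bounded_linear[OF L(1) M1])
  have sumL: "(\<lambda>t. w t + M1 (v t) + a t) \<in> L2k (ew \<mu>)" by (intro ew.L2k_add L M1L)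
  have "ipk (ew \<mu>) g v = ipk (ew \<mu>) (\<lambda>t. w t + M1 (v t) + a t) v"
    unfolding ipk_def
    by (rule integral_cong_AE)
      (use eq ew.ip_integrable[OF L(4) L(1)] ew.ip_integrable[OF sumL L(1)] in \<open>auto elim!: eventually_mono dest: borel_measurable_integrable\<close>)
  also have "\<dots> = ipk (ew \<mu>) w v + ipk (ew \<mu>) (\<lambda>t. M1 (v t)) v + ipk (ew \<mu>) a v"
    by (simp add: ew.ipk_add_left L M1L ew.L2k_add)
  finally have eq: "ipk (ew \<mu>) g v = ipk (ew \<mu>) w v + ipk (ew \<mu>) (\<lambda>t. M1 (v t)) v + ipk (ew \<mu>) a v" .
  have "ipk (ew \<mu>) a v \<ge> 0"
    unfolding ipk_def by (rule integral_nonneg_AE) (use a in \<open>auto elim!: eventually_mono intro!: mult_nonneg_nonneg ew.k_nonneg\<close>)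
  moreover have "ipk (ew \<mu>) (\<lambda>t. M1 (v t)) v \<ge> (\<integral>t. c * ((norm (v t))\<^sup>2 * ew \<mu> t) \<partial>lborel)"
    unfolding ipk_def
  proof (rule integral_mono)
    show "c * ((norm (v t))\<^sup>2 * ew \<mu> t) \<le> rip (M1 (v t)) (v t) * ew \<mu> t" for t
      using mult_right_mono[OF M1_coercive ew.k_nonneg, of "v t" \<mu> t] by (simp add: mult.assoc)
  qed (intro ew.ip_integrable integrable_mult_right ew.L2k_int L M1L)+
  moreover have "(\<integral>t. c * ((norm (v t))\<^sup>2 * ew \<mu> t) \<partial>lborel) = c * (nk (ew \<mu>) v)\<^sup>2" by (simp add: ew.nk_sq)
  ultimately have "c * (nk (ew \<mu>) v)\<^sup>2 - (c - \<delta>) * (nk (ew \<mu>) v)\<^sup>2 \<le> ipk (ew \<mu>) g v"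
    using w eq by linarith
  then show ?thesis by (simp add: left_diff_distrib)
qed

lemma energy_estimate:
  assumes L: "v \<in> L2k (ew \<mu>)" "w \<in> L2k (ew \<mu>)" "a \<in> L2k (ew \<mu>)" "g \<in> L2k (ew \<mu>)"
    and eq: "AE t in lborel. g t = w t + M1 (v t) + a t"
    and a: "AE t in lborel. rip (a t) (v t) \<ge> 0"
    and w: "ipk (ew \<mu>) w v \<ge> - (c - \<delta>) * (nk (ew \<mu>) v)\<^sup>2"
  shows "\<delta> * nk (ew \<mu>) v \<le> nk (ew \<mu>) g"
proof (cases "nk (ew \<mu>) v = 0")
  case False
  then have pos: "nk (ew \<mu>) v > 0" using ew.nk_nonneg[of \<mu> v] by linarith
  have "\<delta> * nk (ew \<mu>) v * nk (ew \<mu>) v \<le> nk (ew \<mu>) g * nk (ew \<mu>) v"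
    using energy_inequality[OF assms] ew.ipk_CS[OF L(4) L(1)] by (simp add: power2_eq_square mult.assoc)
  then show ?thesis using pos by simp
qed (simp add: ew.nk_nonneg)

end

locale euler = evo DA A M0 M1 c K
  for DA :: "'a::chilbert set" and A M0 M1 c K +
  fixes h :: real and R :: "'a \<Rightarrow> 'a"
  assumes h: "h > 0" and R: "bounded_linear R" and R_DA: "R y \<in> DA"
    and R_eq: "(1 / h) *\<^sub>R M0 (R y) + M1 (R y) + A (R y) = y"

lemma (in evo) exists_euler:
  assumes h: "h > 0"
  obtains R where "euler DA A M0 M1 c K h R"
proof -
  have B: "bounded_linear (\<lambda>x. (1 / h) *\<^sub>R M0 x + M1 x)"
    by (intro bounded_linear_add M1 bounded_linear_compose[OF bounded_linear_scaleR_right M0])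
  have co: "rip ((1 / h) *\<^sub>R M0 x + M1 x) x \<ge> c * (norm x)\<^sup>2" for x
  proof -
    have "(1 / h) * rip (M0 x) x \<ge> 0" using h M0_nonneg[of x] by simp
    then show ?thesis using M1_coercive[of x] by (simp add: rip.add_left rip.scaleR_left)
  qed
  obtain R where R: "bounded_linear R" "\<And>y. R y \<in> DA" "\<And>y. ((1 / h) *\<^sub>R M0 (R y) + M1 (R y)) + A (R y) = y"
    using coercive_resolvent[OF B c co] by blast
  have "euler DA A M0 M1 c K h R" by (intro euler.intro euler_axioms.intro evo_axioms h R)
  then show thesis by (rule that)
qed

context euler
begin

definition Q :: "'a \<Rightarrow> 'a" where
  "Q y = R ((1 / h) *\<^sub>R M0 y)"

definition P :: "nat \<Rightarrow> 'a \<Rightarrow> 'a" where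
  "P n y = (Q ^^ n) (R y)"

definition sol :: "nat \<Rightarrow> (real \<Rightarrow> 'a) \<Rightarrow> real \<Rightarrow> 'a" where
  "sol N f t = (\<Sum>n\<le>N. P n (f (t - real n * h)))"

definition res :: "nat \<Rightarrow> (real \<Rightarrow> 'a) \<Rightarrow> real \<Rightarrow> 'a" where
  "res N f t = (1 / h) *\<^sub>R M0 (P N (f (t - real (Suc N) * h)))"

lemma bounded_linear_P: "bounded_linear (P n)"
proof -
  have "bounded_linear Q"
    unfolding Q_def[abs_def] by (intro bounded_linear_compose[OF R] bounded_linear_compose[OF bounded_linear_scaleR_right M0])
  then show ?thesis unfolding P_def[abs_def] by (intro bounded_linear_compose[OF bounded_linear_funpow R])
qed

lemma P_0: "P 0 y = R y" by (simp add: P_def)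

lemma P_Suc: "P (Suc n) y = R ((1 / h) *\<^sub>R M0 (P n y))" by (simp add: P_def Q_def)

lemma P_DA: "P n y \<in> DA"
  by (cases n) (simp_all add: P_0 P_Suc R_DA)

lemma sol_DA: "sol N f t \<in> DA"
  unfolding sol_def by (intro subspace_sum[OF subspace_DA] P_DA)

lemma sol_Suc: "sol (Suc N) f t = sol N f t + P (Suc N) (f (t - real (Suc N) * h))"
  by (simp add: sol_def)

lemma euler_equation_aux:
  "(1 / h) *\<^sub>R M0 (sol N f t) + M1 (sol N f t) + A (sol N f t)
    = f t + (1 / h) *\<^sub>R M0 (sol N f (t - h)) - res N f t"
proof (induction N)
  case 0
  have "t - real (Suc 0) * h = t - h" by simp
  then show ?case using R_eq[of "f t"] by (simp add: sol_def res_def P_0)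
next
  case (Suc N)
  define x where "x = P (Suc N) (f (t - real (Suc N) * h))"
  have x: "(1 / h) *\<^sub>R M0 x + M1 x + A x = res N f t"
    unfolding x_def P_Suc res_def by (rule R_eq)
  have y: "(1 / h) *\<^sub>R M0 (sol (Suc N) f (t - h)) = (1 / h) *\<^sub>R M0 (sol N f (t - h)) + res (Suc N) f t"
  proof -
    have "t - h - real (Suc N) * h = t - real (Suc (Suc N)) * h" by (simp add: algebra_simps)
    then show ?thesis unfolding sol_Suc res_def by (simp only: linear_simps[OF M0] scaleR_add_right)
  qed
  have "(1 / h) *\<^sub>R M0 (sol (Suc N) f t) + M1 (sol (Suc N) f t) + A (sol (Suc N) f t) =
    ((1 / h) *\<^sub>R M0 (sol N f t) + M1 (sol N f t) + A (sol N f t)) + ((1 / h) *\<^sub>R M0 x + M1 x + A x)"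
    unfolding sol_Suc x_def[symmetric] A_add[OF sol_DA P_DA[of "Suc N" "f (t - real (Suc N) * h)", folded x_def]]
    by (simp add: linear_simps[OF M0] linear_simps[OF M1] scaleR_add_right algebra_simps)
  then show ?case unfolding Suc.IH x y by simp
qed

lemma euler_equation: "M0 (dq h (sol N f) t) + M1 (sol N f t) + A (sol N f t) = f t - res N f t"
proof -
  have "M0 (dq h (sol N f) t) = (1 / h) *\<^sub>R M0 (sol N f t) - (1 / h) *\<^sub>R M0 (sol N f (t - h))"
    unfolding dq_def by (simp only: linear_simps[OF M0] scaleR_diff_right)
  then have "M0 (dq h (sol N f) t) + M1 (sol N f t) + A (sol N f t) =
    ((1 / h) *\<^sub>R M0 (sol N f t) + M1 (sol N f t) + A (sol N f t)) - (1 / h) *\<^sub>R M0 (sol N f (t - h))"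
    by simp
  then show ?thesis unfolding euler_equation_aux[of N f t] by simp
qed

lemma test_fun_sol: "test_fun f \<Longrightarrow> test_fun (sol N f)"
  unfolding sol_def[abs_def] by (intro test_fun_sum test_fun_bounded_linear[OF bounded_linear_P] test_fun_shift)

lemma ccont_sol: "ccont f \<Longrightarrow> ccont (sol N f)"
  unfolding sol_def[abs_def] by (intro ccont_sum ccont_bounded_linear[OF bounded_linear_P] ccont_shift)

lemma ccont_res: "ccont f \<Longrightarrow> ccont (res N f)"
  unfolding res_def[abs_def]
  by (intro ccont_bounded_linear[OF bounded_linear_compose[OF bounded_linear_scaleR_right bounded_linear_compose[OF M0 bounded_linear_P]]] ccont_shift)

lemma ccont_A_sol:
  assumes f: "ccont f"
  shows "ccont (\<lambda>t. A (sol N f t))"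
proof -
  have "(\<lambda>t. A (sol N f t)) = (\<lambda>t. (f t - res N f t) - (M0 (dq h (sol N f) t) + M1 (sol N f t)))"
  proof
    fix t
    show "A (sol N f t) = (f t - res N f t) - (M0 (dq h (sol N f) t) + M1 (sol N f t))"
      using euler_equation[of N f t] by (simp add: algebra_simps)
  qed
  moreover have "ccont (\<lambda>t. (f t - res N f t) - (M0 (dq h (sol N f) t) + M1 (sol N f t)))"
    by (intro ccont_diff ccont_add ccont_bounded_linear[OF M0] ccont_bounded_linear[OF M1] ccont_dq ccont_sol ccont_res f)
  ultimately show ?thesis by simp
qed

lemma sol_has_derivative:
  assumes "\<And>t. (f has_vector_derivative f' t) (at t)"
  shows "(sol N f has_vector_derivative sol N f' t) (at t)"
  unfolding sol_def[abs_def]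
proof (rule has_vector_derivative_sum)
  fix n
  have "((\<lambda>t. t - real n * h) has_vector_derivative 1) (at t)"
    by (auto intro!: derivative_eq_intros simp: has_real_derivative_iff_has_vector_derivative[symmetric])
  then have "((f \<circ> (\<lambda>t. t - real n * h)) has_vector_derivative 1 *\<^sub>R f' (t - real n * h)) (at t)"
    by (rule vector_diff_chain_at) (rule assms)
  then show "((\<lambda>t. P n (f (t - real n * h))) has_vector_derivative P n (f' (t - real n * h))) (at t)"
    by (intro bounded_linear.has_vector_derivative[OF bounded_linear_P]) (simp add: o_def)
qed

lemma dq_sol: "dq s (sol N f) = sol N (dq s f)"
proof
  fix t
  have *: "t - s - x = t - x - s" for x :: real by simp
  show "dq s (sol N f) t = sol N (dq s f) t"
    unfolding dq_def sol_def linear_simps[OF bounded_linear_P] scaleR_sum_right[symmetric] sum_subtractf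
      * by (rule refl)
qed

lemma form_Q_le:
  "rip (M0 (R ((1 / h) *\<^sub>R M0 y))) (R ((1 / h) *\<^sub>R M0 y)) \<le> rip (M0 y) y / (1 + h * c / K)\<^sup>2"
proof -
  define z where "z = R ((1 / h) *\<^sub>R M0 y)"
  define q where "q x = rip (M0 x) x" for x
  define \<theta> where "\<theta> = 1 + h * c / K"
  have \<theta>: "\<theta> > 0" using h c K by (auto simp: \<theta>_def intro!: add_pos_pos divide_pos_pos mult_pos_pos)
  have "(1 / h) *\<^sub>R M0 z + M1 z + A z = (1 / h) *\<^sub>R M0 y" unfolding z_def by (rule R_eq)
  then have "rip ((1 / h) *\<^sub>R M0 z + M1 z + A z) z = rip ((1 / h) *\<^sub>R M0 y) z" by simp
  then have "(1 / h) * q z + rip (M1 z) z + rip (A z) z = (1 / h) * rip (M0 y) z"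
    by (simp add: rip.add_left rip.scaleR_left q_def)
  moreover have "rip (A z) z \<ge> 0" unfolding z_def by (intro A_mono R_DA)
  moreover have "rip (M1 z) z \<ge> c / K * q z"
  proof -
    have "c / K * q z \<le> c / K * (K * (norm z)\<^sup>2)" unfolding q_def using c K by (intro mult_left_mono M0_le) auto
    then show ?thesis using M1_coercive[of z] K by simp
  qed
  ultimately have "(1 / h) * q z + c / K * q z \<le> (1 / h) * rip (M0 y) z" by linarith
  then have "h * ((1 / h) * q z + c / K * q z) \<le> h * ((1 / h) * rip (M0 y) z)" using h by (intro mult_left_mono) auto
  then have "\<theta> * q z \<le> rip (M0 y) z" using h by (simp add: \<theta>_def algebra_simps)
  moreover have "2 * rip (M0 y) z \<le> (1 / \<theta>) * q y + q z / (1 / \<theta>)"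
    unfolding q_def by (rule M0_Young) (use \<theta> in simp)
  ultimately have "\<theta> * q z \<le> q y / \<theta>" by (simp add: mult.commute)
  then have "q z \<le> q y / \<theta>\<^sup>2" using \<theta> by (simp add: field_simps power2_eq_square)
  then show ?thesis by (simp add: z_def q_def \<theta>_def)
qed

lemma form_P_le: "rip (M0 (P n y)) (P n y) \<le> rip (M0 (R y)) (R y) / ((1 + h * c / K)\<^sup>2) ^ n"
proof (induction n)
  case 0
  then show ?case by (simp add: P_0)
next
  case (Suc n)
  have "rip (M0 (P (Suc n) y)) (P (Suc n) y) \<le> rip (M0 (P n y)) (P n y) / (1 + h * c / K)\<^sup>2"
    unfolding P_Suc by (rule form_Q_le)
  also have "\<dots> \<le> rip (M0 (R y)) (R y) / ((1 + h * c / K)\<^sup>2) ^ n / (1 + h * c / K)\<^sup>2"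
    by (intro divide_right_mono Suc) simp
  finally show ?case by (simp add: mult.commute)
qed

lemma res_le:
  obtains C where "C \<ge> 0" "\<And>N f t. norm (res N f t) \<le> C / (1 + h * c / K) ^ N * norm (f (t - real (Suc N) * h))"
proof -
  obtain B where B: "B > 0" "\<And>y. norm (R y) \<le> norm y * B" using bounded_linear.pos_bounded[OF R] by blast
  define \<theta> where "\<theta> = 1 + h * c / K"
  have \<theta>: "\<theta> > 0" using h c K by (auto simp: \<theta>_def intro!: add_pos_pos divide_pos_pos mult_pos_pos)
  have le: "norm (M0 (P N y)) \<le> K * B / \<theta> ^ N * norm y" for N y
  proof (rule power2_le_imp_le)
    have "(norm (M0 (P N y)))\<^sup>2 \<le> K * rip (M0 (P N y)) (P N y)" by (rule norm_M0_sq_le)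
    also have "\<dots> \<le> K * (rip (M0 (R y)) (R y) / (\<theta>\<^sup>2) ^ N)"
      using K form_P_le[of N y] by (intro mult_left_mono) (auto simp: \<theta>_def)
    also have "\<dots> \<le> K * (K * (norm y * B)\<^sup>2 / (\<theta>\<^sup>2) ^ N)"
    proof (intro mult_left_mono divide_right_mono)
      have "rip (M0 (R y)) (R y) \<le> K * (norm (R y))\<^sup>2" by (rule M0_le)
      also have "\<dots> \<le> K * (norm y * B)\<^sup>2" using K by (intro mult_left_mono power_mono B) auto
      finally show "rip (M0 (R y)) (R y) \<le> K * (norm y * B)\<^sup>2" .
    qed (use K \<theta> in auto)
    also have "\<dots> = (K * B / \<theta> ^ N * norm y)\<^sup>2"
      by (simp add: power2_eq_square power_mult_distrib field_simps)
    finally show "(norm (M0 (P N y)))\<^sup>2 \<le> (K * B / \<theta> ^ N * norm y)\<^sup>2" .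
    show "0 \<le> K * B / \<theta> ^ N * norm y" using K B \<theta> by simp
  qed
  have "norm (res N f t) \<le> (K * B / h) / \<theta> ^ N * norm (f (t - real (Suc N) * h))" for N f t
  proof -
    define y where "y = f (t - real (Suc N) * h)"
    have "norm (res N f t) = (1 / h) * norm (M0 (P N y))" unfolding res_def y_def using h by simp
    also have "\<dots> \<le> (1 / h) * (K * B / \<theta> ^ N * norm y)" using h by (intro mult_left_mono le) auto
    also have "\<dots> = (K * B / h) / \<theta> ^ N * norm y" by simp
    finally show ?thesis unfolding y_def .
  qed
  then show thesis using that[of "K * B / h"] K B h unfolding \<theta>_def by simp
qed

lemma nk_res_le:
  assumes d: "defect \<mu> h < c"
  obtains \<eta> where "\<eta> \<longlonglongrightarrow> 0" "\<And>N f. ccont f \<Longrightarrow> nk (ew \<mu>) (res N f) \<le> \<eta> N * nk (ew \<mu>) f"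
proof -
  obtain C where C: "C \<ge> 0" "\<And>N f t. norm (res N f t) \<le> C / (1 + h * c / K) ^ N * norm (f (t - real (Suc N) * h))"
    using res_le by blast
  define \<theta> where "\<theta> = 1 + h * c / K"
  have \<theta>: "\<theta> > 0" using h c K by (auto simp: \<theta>_def intro!: add_pos_pos divide_pos_pos mult_pos_pos)
  define e where "e = exp (- \<mu> * h)"
  define \<eta> where "\<eta> N = C * e * (e / \<theta>) ^ N" for N
  have "e < \<theta>"
  proof -
    have "K * ((e - 1) / h) \<le> defect \<mu> h" unfolding defect_def e_def using K by (intro mult_left_mono) auto
    then have "K * ((e - 1) / h) < c" using d by linarith
    then show ?thesis using K h by (simp add: \<theta>_def field_simps)
  qed
  then have "(\<lambda>N. (e / \<theta>) ^ N) \<longlonglongrightarrow> 0" using \<theta> by (intro LIMSEQ_realpow_zero) (auto simp: e_def)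
  then have "\<eta> \<longlonglongrightarrow> 0" unfolding \<eta>_def[abs_def] using tendsto_mult_right_zero by blast
  moreover have "nk (ew \<mu>) (res N f) \<le> \<eta> N * nk (ew \<mu>) f" if f: "ccont f" for N f
  proof -
    have "nk (ew \<mu>) (res N f) \<le> C / \<theta> ^ N * nk (ew \<mu>) (\<lambda>t. f (t - real (Suc N) * h))"
      using C \<theta> by (intro ew.nk_mono ew.ccont_L2k ccont_res ccont_shift f) (auto simp: \<theta>_def)
    also have "\<dots> = C / \<theta> ^ N * (e ^ Suc N * nk (ew \<mu>) f)"
      unfolding nk_shift e_def exp_of_nat_mult[symmetric] by (simp add: algebra_simps)
    also have "\<dots> = \<eta> N * nk (ew \<mu>) f" by (simp add: \<eta>_def power_divide)
    finally show ?thesis .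
  qed
  ultimately show thesis by (rule that)
qed

lemma nk_sol_le:
  assumes f: "ccont f" and \<delta>: "\<delta> > 0" "defect \<mu> h \<le> c - \<delta>"
  shows "\<delta> * nk (ew \<mu>) (sol N f) \<le> nk (ew \<mu>) f + nk (ew \<mu>) (res N f)"
proof -
  have "\<delta> * nk (ew \<mu>) (sol N f) \<le> nk (ew \<mu>) (\<lambda>t. f t - res N f t)"
  proof (rule energy_estimate[where w = "\<lambda>t. M0 (dq h (sol N f) t)" and a = "\<lambda>t. A (sol N f t)"])
    show "AE t in lborel. f t - res N f t = M0 (dq h (sol N f) t) + M1 (sol N f t) + A (sol N f t)"
      using euler_equation by simp
    show "AE t in lborel. 0 \<le> rip (A (sol N f t)) (sol N f t)" using A_mono[OF sol_DA] by simp
    have "- (c - \<delta>) * (nk (ew \<mu>) (sol N f))\<^sup>2 \<le> - defect \<mu> h * (nk (ew \<mu>) (sol N f))\<^sup>2"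
      using \<delta> by (intro mult_right_mono) auto
    then show "- (c - \<delta>) * (nk (ew \<mu>) (sol N f))\<^sup>2 \<le> ipk (ew \<mu>) (\<lambda>t. M0 (dq h (sol N f) t)) (sol N f)"
      using ipk_M0_dq_ge_defect[OF ew.ccont_L2k[OF ccont_sol[OF f]] h] by (rule order_trans)
  qed (intro ew.ccont_L2k ccont_sol ccont_bounded_linear[OF M0] ccont_dq ccont_A_sol ccont_diff ccont_res f)+
  also have "\<dots> \<le> nk (ew \<mu>) f + nk (ew \<mu>) (res N f)"
    by (intro ew.nk_triangle_sub ew.ccont_L2k ccont_res f)
  finally show ?thesis .
qed

lemma eventually_sol_approximates:
  assumes f: "test_fun f" and f': "\<And>t. (f has_vector_derivative f' t) (at t)" "test_fun f'"
    and \<delta>: "\<delta> > 0" "defect \<mu> h \<le> c - \<delta>" and h1: "h \<le> 1"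
    and C: "\<And>s. 0 < s \<Longrightarrow> s \<le> 1 \<Longrightarrow> nk (ew \<mu>) (dq s (dq s f)) \<le> C"
    and B: "\<And>x. norm (M0 x) \<le> norm x * B" "B \<ge> 0" and e: "B * (h / 2 * (2 * C / \<delta>)) < e"
  shows "\<forall>\<^sub>F N in sequentially.
    nk (ew \<mu>) (\<lambda>t. (M0 (sol N f' t) + M1 (sol N f t) + A (sol N f t)) - f t) < e"
proof -
  obtain \<eta> where \<eta>: "\<eta> \<longlonglongrightarrow> 0" "\<And>N f. ccont f \<Longrightarrow> nk (ew \<mu>) (res N f) \<le> \<eta> N * nk (ew \<mu>) f"
    using nk_res_le[of \<mu>] \<delta> by auto
  have fc: "ccont f" "ccont f'" using f f' by (auto intro: test_fun_ccont)
  have "(\<lambda>N. B * (h / 2 * (2 * C / \<delta>)) + \<eta> N * nk (ew \<mu>) f) \<longlonglongrightarrow> B * (h / 2 * (2 * C / \<delta>)) + 0 * nk (ew \<mu>) f"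
    by (intro tendsto_intros \<eta>)
  then have ev: "\<forall>\<^sub>F N in sequentially. B * (h / 2 * (2 * C / \<delta>)) + \<eta> N * nk (ew \<mu>) f < e"
    by (rule order_tendstoD(2)) (use e in simp)
  have ev1: "\<forall>\<^sub>F N in sequentially. \<eta> N < 1" by (rule order_tendstoD(2)[OF \<eta>(1)]) simp
  show ?thesis
    using ev ev1
  proof eventually_elim
    case (elim N)
    have second: "nk (ew \<mu>) (dq s (dq s (sol N f))) \<le> 2 * C / \<delta>" if s: "0 < s" "s \<le> h" for s
    proof -
      define g where "g = dq s (dq s f)"
      have g: "ccont g" unfolding g_def by (intro ccont_dq fc)
      have "\<delta> * nk (ew \<mu>) (sol N g) \<le> nk (ew \<mu>) g + \<eta> N * nk (ew \<mu>) g"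
        using nk_sol_le[OF g \<delta>, of N] \<eta>(2)[OF g, of N] by linarith
      also have "\<dots> \<le> nk (ew \<mu>) g + 1 * nk (ew \<mu>) g"
        using elim by (intro add_left_mono mult_right_mono ew.nk_nonneg) auto
      also have "\<dots> \<le> 2 * C" using C[of s] s h1 by (simp add: g_def)
      finally have "nk (ew \<mu>) (sol N g) \<le> 2 * C / \<delta>" using \<delta>(1) by (simp add: field_simps)
      then show ?thesis by (simp add: dq_sol g_def)
    qed
    have "nk (ew \<mu>) (\<lambda>t. dq h (sol N f) t - sol N f' t) \<le> h / 2 * (2 * C / \<delta>)"
      by (rule nk_dq_diff_derivative[OF test_fun_sol[OF f] sol_has_derivative[OF f'(1)] test_fun_sol[OF f'(2)] h second])
    then have d1: "nk (ew \<mu>) (\<lambda>t. sol N f' t - dq h (sol N f) t) \<le> h / 2 * (2 * C / \<delta>)"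
      using ew.nk_diff_commute[of \<mu> "sol N f'" "dq h (sol N f)"] by simp
    have dc: "ccont (\<lambda>t. sol N f' t - dq h (sol N f) t)" by (intro ccont_diff ccont_sol ccont_dq fc)
    have "(\<lambda>t. (M0 (sol N f' t) + M1 (sol N f t) + A (sol N f t)) - f t) =
      (\<lambda>t. M0 (sol N f' t - dq h (sol N f) t) - res N f t)"
    proof
      fix t
      have "f t = M0 (dq h (sol N f) t) + M1 (sol N f t) + A (sol N f t) + res N f t"
        unfolding euler_equation by simp
      then show "(M0 (sol N f' t) + M1 (sol N f t) + A (sol N f t)) - f t = M0 (sol N f' t - dq h (sol N f) t) - res N f t"
        by (simp add: linear_simps[OF M0] algebra_simps)
    qed
    then have "nk (ew \<mu>) (\<lambda>t. (M0 (sol N f' t) + M1 (sol N f t) + A (sol N f t)) - f t) =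
      nk (ew \<mu>) (\<lambda>t. M0 (sol N f' t - dq h (sol N f) t) - res N f t)" by simp
    also have "\<dots> \<le> nk (ew \<mu>) (\<lambda>t. M0 (sol N f' t - dq h (sol N f) t)) + nk (ew \<mu>) (res N f)"
      by (intro ew.nk_triangle_sub ew.ccont_L2k ccont_bounded_linear[OF M0] dc ccont_res fc)
    also have "nk (ew \<mu>) (\<lambda>t. M0 (sol N f' t - dq h (sol N f) t)) \<le> B * nk (ew \<mu>) (\<lambda>t. sol N f' t - dq h (sol N f) t)"
      by (rule ew.nk_mono) (use B dc in \<open>auto intro!: ew.ccont_L2k ccont_bounded_linear[OF M0] simp: mult.commute\<close>)
    also have "\<dots> \<le> B * (h / 2 * (2 * C / \<delta>))" using B d1 by (intro mult_left_mono) auto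
    also have "nk (ew \<mu>) (res N f) \<le> \<eta> N * nk (ew \<mu>) f" by (rule \<eta>(2)[OF fc(1)])
    finally show ?case using elim by linarith
  qed
qed

end

section \<open>The closure of the evolutionary operator\<close>

context weight
begin

lemma ipk_abs_le:
  fixes f g :: "real \<Rightarrow> 'a::chilbert"
  assumes "f \<in> L2k k" "g \<in> L2k k"
  shows "\<bar>ipk k f g\<bar> \<le> nk k f * nk k g"
  using ipk_CS[OF assms] ipk_CS[OF L2k_scaleR[OF assms(1), of "-1"] assms(2)]
  unfolding ipk_scaleR_left nk_scaleR by simp

lemma ipk_tendsto:
  fixes f g :: "real \<Rightarrow> 'a::chilbert"
  assumes fn: "\<And>n. fn n \<in> L2k k" and f: "f \<in> L2k k" and gn: "\<And>n. gn n \<in> L2k k" and g: "g \<in> L2k k"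
    and limf: "(\<lambda>n. nk k (\<lambda>t. fn n t - f t)) \<longlonglongrightarrow> 0" and limg: "(\<lambda>n. nk k (\<lambda>t. gn n t - g t)) \<longlonglongrightarrow> 0"
  shows "(\<lambda>n. ipk k (fn n) (gn n)) \<longlonglongrightarrow> ipk k f g"
proof -
  define a b where "a n = nk k (\<lambda>t. fn n t - f t)" and "b n = nk k (\<lambda>t. gn n t - g t)" for n
  have le: "norm (ipk k (fn n) (gn n) - ipk k f g) \<le> a n * (nk k g + b n) + nk k f * b n" for n
  proof -
    have 1: "ipk k (\<lambda>t. fn n t - f t) (gn n) = ipk k (fn n) (gn n) - ipk k f (gn n)"
      by (rule ipk_diff_left[OF fn f gn])
    have 2: "ipk k (\<lambda>t. gn n t - g t) f = ipk k (gn n) f - ipk k g f"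
      by (rule ipk_diff_left[OF gn g f])
    have 3: "\<bar>ipk k (\<lambda>t. fn n t - f t) (gn n)\<bar> \<le> a n * nk k (gn n)"
      unfolding a_def by (rule ipk_abs_le[OF L2k_diff[OF fn f] gn])
    have 4: "\<bar>ipk k (\<lambda>t. gn n t - g t) f\<bar> \<le> b n * nk k f"
      unfolding b_def by (rule ipk_abs_le[OF L2k_diff[OF gn g] f])
    have "nk k (gn n) \<le> nk k g + b n" using nk_triangle_rev[OF gn g, of n] unfolding b_def by linarith
    then have "a n * nk k (gn n) \<le> a n * (nk k g + b n)"
      unfolding a_def by (intro mult_left_mono nk_nonneg)
    then show ?thesis
      using 3 4 unfolding 1 2 ipk_commute[of "gn n" f] ipk_commute[of g f] real_norm_def mult.commute[of "nk k f"] by linarith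
  qed
  have "(\<lambda>n. a n * (nk k g + b n) + nk k f * b n) \<longlonglongrightarrow> 0 * (nk k g + 0) + nk k f * 0"
    unfolding a_def b_def by (intro tendsto_intros limf limg)
  then have "(\<lambda>n. ipk k (fn n) (gn n) - ipk k f g) \<longlonglongrightarrow> 0"
    by (intro Lim_null_comparison[of "\<lambda>n. ipk k (fn n) (gn n) - ipk k f g" "\<lambda>n. a n * (nk k g + b n) + nk k f * b n"]) (use le in auto)
  then show ?thesis by (simp add: LIM_zero_iff)
qed

lemma nk_tendsto:
  fixes f :: "real \<Rightarrow> 'a::chilbert"
  assumes fn: "\<And>n. fn n \<in> L2k k" and f: "f \<in> L2k k" and lim: "(\<lambda>n. nk k (\<lambda>t. fn n t - f t)) \<longlonglongrightarrow> 0"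
  shows "(\<lambda>n. nk k (fn n)) \<longlonglongrightarrow> nk k f"
proof -
  have "(\<lambda>n. nk k (fn n) - nk k f) \<longlonglongrightarrow> 0"
    by (rule Lim_null_comparison[OF _ lim]) (use nk_triangle_rev[OF fn f] in auto)
  then show ?thesis by (simp add: LIM_zero_iff)
qed

end

definition op_lin :: "((real \<Rightarrow> 'a::chilbert) \<times> (real \<Rightarrow> 'a)) set \<Rightarrow> bool" where
  "op_lin G \<longleftrightarrow> (\<forall>u v u' v' r. (u, v) \<in> G \<longrightarrow> (u', v') \<in> G \<longrightarrow>
     ((\<lambda>t. u t + r *\<^sub>R u' t), (\<lambda>t. v t + r *\<^sub>R v' t)) \<in> G)"

lemma gclosE:
  assumes "(u, v) \<in> gclos \<rho> G"
  obtains un vn where "u \<in> L2k (ew \<rho>)" "v \<in> L2k (ew \<rho>)" "\<And>n. (un n, vn n) \<in> G"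
    "(\<lambda>n. nk (ew \<rho>) (\<lambda>t. un n t - u t)) \<longlonglongrightarrow> 0" "(\<lambda>n. nk (ew \<rho>) (\<lambda>t. vn n t - v t)) \<longlonglongrightarrow> 0"
proof -
  obtain s where "u \<in> L2k (ew \<rho>)" "v \<in> L2k (ew \<rho>)" "\<And>n. s n \<in> G"
    "(\<lambda>n. nk (ew \<rho>) (\<lambda>t. fst (s n) t - u t)) \<longlonglongrightarrow> 0" "(\<lambda>n. nk (ew \<rho>) (\<lambda>t. snd (s n) t - v t)) \<longlonglongrightarrow> 0"
    using assms unfolding gclos_def L2w_ew normw_ew by blast
  then show thesis by (intro that[of "\<lambda>n. fst (s n)" "\<lambda>n. snd (s n)"]) auto
qed

lemma gclosI:
  assumes "u \<in> L2k (ew \<rho>)" "v \<in> L2k (ew \<rho>)" "\<And>n. (un n, vn n) \<in> G"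
    "(\<lambda>n. nk (ew \<rho>) (\<lambda>t. un n t - u t)) \<longlonglongrightarrow> 0" "(\<lambda>n. nk (ew \<rho>) (\<lambda>t. vn n t - v t)) \<longlonglongrightarrow> 0"
  shows "(u, v) \<in> gclos \<rho> G"
  unfolding gclos_def L2w_ew normw_ew using assms by (auto intro!: exI[of _ "\<lambda>n. (un n, vn n)"])

lemma nk_lin_comb_tendsto:
  fixes u u' :: "real \<Rightarrow> 'a::chilbert"
  assumes L: "u \<in> L2k (ew \<rho>)" "u' \<in> L2k (ew \<rho>)" "\<And>n. un n \<in> L2k (ew \<rho>)" "\<And>n. un' n \<in> L2k (ew \<rho>)"
    and lim: "(\<lambda>n. nk (ew \<rho>) (\<lambda>t. un n t - u t)) \<longlonglongrightarrow> 0" "(\<lambda>n. nk (ew \<rho>) (\<lambda>t. un' n t - u' t)) \<longlonglongrightarrow> 0"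
  shows "(\<lambda>n. nk (ew \<rho>) (\<lambda>t. (un n t + r *\<^sub>R un' n t) - (u t + r *\<^sub>R u' t))) \<longlonglongrightarrow> 0"
proof (rule Lim_null_comparison)
  have "(\<lambda>n. nk (ew \<rho>) (\<lambda>t. un n t - u t) + \<bar>r\<bar> * nk (ew \<rho>) (\<lambda>t. un' n t - u' t)) \<longlonglongrightarrow> 0 + \<bar>r\<bar> * 0"
    by (intro tendsto_intros lim)
  then show "(\<lambda>n. nk (ew \<rho>) (\<lambda>t. un n t - u t) + \<bar>r\<bar> * nk (ew \<rho>) (\<lambda>t. un' n t - u' t)) \<longlonglongrightarrow> 0" by simp
  have "nk (ew \<rho>) (\<lambda>t. (un n t + r *\<^sub>R un' n t) - (u t + r *\<^sub>R u' t)) \<le>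
    nk (ew \<rho>) (\<lambda>t. un n t - u t) + \<bar>r\<bar> * nk (ew \<rho>) (\<lambda>t. un' n t - u' t)" for n
  proof -
    have "(\<lambda>t. (un n t + r *\<^sub>R un' n t) - (u t + r *\<^sub>R u' t)) = (\<lambda>t. (un n t - u t) + r *\<^sub>R (un' n t - u' t))"
      by (simp add: algebra_simps)
    then show ?thesis
      using ew.nk_triangle[OF ew.L2k_diff[OF L(3) L(1)] ew.L2k_scaleR[OF ew.L2k_diff[OF L(4) L(2)]], of n r n]
      unfolding ew.nk_scaleR by simp
  qed
  then show "\<forall>\<^sub>F n in sequentially. norm (nk (ew \<rho>) (\<lambda>t. (un n t + r *\<^sub>R un' n t) - (u t + r *\<^sub>R u' t)))
    \<le> nk (ew \<rho>) (\<lambda>t. un n t - u t) + \<bar>r\<bar> * nk (ew \<rho>) (\<lambda>t. un' n t - u' t)"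
    by (simp add: ew.nk_nonneg)
qed

lemma op_lin_gclos:
  assumes lin: "op_lin G" and L: "G \<subseteq> L2k (ew \<rho>) \<times> L2k (ew \<rho>)"
  shows "op_lin (gclos \<rho> G)"
  unfolding op_lin_def
proof (intro allI impI)
  fix u v u' v' :: "real \<Rightarrow> 'a" and r :: real
  assume a: "(u, v) \<in> gclos \<rho> G" and a': "(u', v') \<in> gclos \<rho> G"
  obtain un vn where 1: "u \<in> L2k (ew \<rho>)" "v \<in> L2k (ew \<rho>)" "\<And>n. (un n, vn n) \<in> G"
    "(\<lambda>n. nk (ew \<rho>) (\<lambda>t. un n t - u t)) \<longlonglongrightarrow> 0" "(\<lambda>n. nk (ew \<rho>) (\<lambda>t. vn n t - v t)) \<longlonglongrightarrow> 0"
    using gclosE[OF a] by blast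
  obtain un' vn' where 2: "u' \<in> L2k (ew \<rho>)" "v' \<in> L2k (ew \<rho>)" "\<And>n. (un' n, vn' n) \<in> G"
    "(\<lambda>n. nk (ew \<rho>) (\<lambda>t. un' n t - u' t)) \<longlonglongrightarrow> 0" "(\<lambda>n. nk (ew \<rho>) (\<lambda>t. vn' n t - v' t)) \<longlonglongrightarrow> 0"
    using gclosE[OF a'] by blast
  have Ln: "un n \<in> L2k (ew \<rho>)" "vn n \<in> L2k (ew \<rho>)" "un' n \<in> L2k (ew \<rho>)" "vn' n \<in> L2k (ew \<rho>)" for n
    using 1(3)[of n] 2(3)[of n] L by auto
  show "((\<lambda>t. u t + r *\<^sub>R u' t), (\<lambda>t. v t + r *\<^sub>R v' t)) \<in> gclos \<rho> G"
  proof (rule gclosI)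
    show "((\<lambda>t. un n t + r *\<^sub>R un' n t), (\<lambda>t. vn n t + r *\<^sub>R vn' n t)) \<in> G" for n
      using lin 1(3) 2(3) unfolding op_lin_def by blast
  qed (rule ew.L2k_add[OF 1(1) ew.L2k_scaleR[OF 2(1)]] ew.L2k_add[OF 1(2) ew.L2k_scaleR[OF 2(2)]]
      nk_lin_comb_tendsto[OF 1(1) 2(1) Ln(1) Ln(3) 1(4) 2(4)]
      nk_lin_comb_tendsto[OF 1(2) 2(2) Ln(2) Ln(4) 1(5) 2(5)])+
qed

definition tgraph :: "((real \<Rightarrow> 'a::chilbert) \<times> (real \<Rightarrow> 'a)) set" where
  "tgraph = {(\<phi>, \<psi>). test_fun \<phi> \<and> test_fun \<psi> \<and> (\<forall>t. (\<phi> has_vector_derivative \<psi> t) (at t))}"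

lemma dgraph_tgraph: "dgraph \<rho> = gclos \<rho> tgraph"
proof -
  have "{(\<phi>, \<lambda>t. vector_derivative \<phi> (at t)) | \<phi> :: real \<Rightarrow> 'a. test_fun \<phi>} = tgraph"
  proof (intro set_eqI iffI)
    fix z :: "(real \<Rightarrow> 'a) \<times> (real \<Rightarrow> 'a)"
    assume "z \<in> {(\<phi>, \<lambda>t. vector_derivative \<phi> (at t)) | \<phi>. test_fun \<phi>}"
    then obtain \<phi> where \<phi>: "test_fun \<phi>" "z = (\<phi>, \<lambda>t. vector_derivative \<phi> (at t))" by blast
    obtain \<psi> where \<psi>: "test_fun \<psi>" "\<And>t. (\<phi> has_vector_derivative \<psi> t) (at t)"
      using test_fun_derivative[OF \<phi>(1)] by blast
    then have "(\<lambda>t. vector_derivative \<phi> (at t)) = \<psi>" using vector_derivative_at by blast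
    then show "z \<in> tgraph" using \<phi> \<psi> by (auto simp: tgraph_def)
  next
    fix z :: "(real \<Rightarrow> 'a) \<times> (real \<Rightarrow> 'a)"
    assume "z \<in> tgraph"
    then obtain \<phi> \<psi> where "z = (\<phi>, \<psi>)" "test_fun \<phi>" "\<And>t. (\<phi> has_vector_derivative \<psi> t) (at t)"
      by (auto simp: tgraph_def)
    moreover from this have "(\<lambda>t. vector_derivative \<phi> (at t)) = \<psi>" using vector_derivative_at by blast
    ultimately show "z \<in> {(\<phi>, \<lambda>t. vector_derivative \<phi> (at t)) | \<phi>. test_fun \<phi>}" by blast
  qed
  then show ?thesis by (simp add: dgraph_def)
qed

lemma tgraph_L2k: "tgraph \<subseteq> L2k (ew \<rho>) \<times> L2k (ew \<rho>)"
  by (auto simp: tgraph_def intro: ew.ccont_L2k test_fun_ccont)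

lemma op_lin_tgraph: "op_lin tgraph"
  unfolding op_lin_def tgraph_def
  by (auto intro!: test_fun_add test_fun_scaleR has_vector_derivative_add
      bounded_linear.has_vector_derivative[OF bounded_linear_scaleR_right])

lemma op_lin_dgraph: "op_lin (dgraph \<rho>)"
  unfolding dgraph_tgraph by (rule op_lin_gclos[OF op_lin_tgraph tgraph_L2k])

definition k2 :: "real \<Rightarrow> real \<Rightarrow> real \<Rightarrow> real" where
  "k2 \<rho> \<mu> t = ew \<rho> t + ew \<mu> t"

interpretation k2: weight "k2 \<rho> \<mu>" for \<rho> \<mu>
proof
  show "continuous_on UNIV (k2 \<rho> \<mu>)"
    unfolding k2_def[abs_def] by (intro continuous_on_add ew.k_cont)
  show "k2 \<rho> \<mu> t > 0" for t unfolding k2_def by (intro add_pos_pos ew.k_pos)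
qed

lemma L2k_k2_iff: "f \<in> L2k (k2 \<rho> \<mu>) \<longleftrightarrow> f \<in> L2k (ew \<rho>) \<and> f \<in> L2k (ew \<mu>)"
proof
  assume f: "f \<in> L2k (k2 \<rho> \<mu>)"
  have le: "(norm (f t))\<^sup>2 * ew \<rho> t \<le> (norm (f t))\<^sup>2 * k2 \<rho> \<mu> t" "(norm (f t))\<^sup>2 * ew \<mu> t \<le> (norm (f t))\<^sup>2 * k2 \<rho> \<mu> t" for t
    using ew.k_nonneg[of \<rho> t] ew.k_nonneg[of \<mu> t] by (auto simp: k2_def intro!: mult_left_mono)
  show "f \<in> L2k (ew \<rho>) \<and> f \<in> L2k (ew \<mu>)"
    using ew.L2k_bound[OF k2.L2k_meas[OF f] k2.L2k_int[OF f] AE_I2[OF le(1)]]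
      ew.L2k_bound[OF k2.L2k_meas[OF f] k2.L2k_int[OF f] AE_I2[OF le(2)]] by (rule conjI)
next
  assume f: "f \<in> L2k (ew \<rho>) \<and> f \<in> L2k (ew \<mu>)"
  have "integrable lborel (\<lambda>t. (norm (f t))\<^sup>2 * ew \<rho> t + (norm (f t))\<^sup>2 * ew \<mu> t)"
    using f by (intro Bochner_Integration.integrable_add ew.L2k_int) auto
  moreover have "f \<in> borel_measurable borel" using f ew.L2k_meas by blast
  ultimately show "f \<in> L2k (k2 \<rho> \<mu>)"
    unfolding L2k_def k2_def distrib_left by simp
qed

lemma nk_k2_sq:
  assumes "f \<in> L2k (ew \<rho>)" "f \<in> L2k (ew \<mu>)"
  shows "(nk (k2 \<rho> \<mu>) f)\<^sup>2 = (nk (ew \<rho>) f)\<^sup>2 + (nk (ew \<mu>) f)\<^sup>2"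
  unfolding ew.nk_sq k2.nk_sq k2_def distrib_left
  by (rule Bochner_Integration.integral_add[OF ew.L2k_int[OF assms(1)] ew.L2k_int[OF assms(2)]])

lemma nk_k2_bounds:
  assumes "f \<in> L2k (ew \<rho>)" "f \<in> L2k (ew \<mu>)"
  shows "nk (ew \<rho>) f \<le> nk (k2 \<rho> \<mu>) f" "nk (ew \<mu>) f \<le> nk (k2 \<rho> \<mu>) f"
    "nk (k2 \<rho> \<mu>) f \<le> nk (ew \<rho>) f + nk (ew \<mu>) f"
proof -
  show "nk (ew \<rho>) f \<le> nk (k2 \<rho> \<mu>) f"
    by (rule power2_le_imp_le[OF _ k2.nk_nonneg]) (simp add: nk_k2_sq[OF assms])
  show "nk (ew \<mu>) f \<le> nk (k2 \<rho> \<mu>) f"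
    by (rule power2_le_imp_le[OF _ k2.nk_nonneg]) (simp add: nk_k2_sq[OF assms])
  have "0 \<le> nk (ew \<rho>) f * nk (ew \<mu>) f" by (intro mult_nonneg_nonneg ew.nk_nonneg)
  then have "(nk (k2 \<rho> \<mu>) f)\<^sup>2 \<le> (nk (ew \<rho>) f + nk (ew \<mu>) f)\<^sup>2"
    using nk_k2_sq[OF assms] by (simp add: power2_sum mult.commute)
  then show "nk (k2 \<rho> \<mu>) f \<le> nk (ew \<rho>) f + nk (ew \<mu>) f"
    by (rule power2_le_imp_le) (intro add_nonneg_nonneg ew.nk_nonneg)
qed

context evo
begin

abbreviation closure_T :: "real \<Rightarrow> ((real \<Rightarrow> 'a) \<times> (real \<Rightarrow> 'a)) set" where
  "closure_T \<rho> \<equiv> gclos \<rho> (Tgraph \<rho> M0 M1 DA A)"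

lemma dgraph_M0_nonneg:
  assumes rho: "\<rho> > 0" and u: "u \<in> L2k (ew \<rho>)" and w: "(\<lambda>t. M0 (u t), w) \<in> dgraph \<rho>"
  shows "w \<in> L2k (ew \<rho>)" "ipk (ew \<rho>) w u \<ge> 0"
proof -
  obtain \<phi> \<psi> where M0u: "(\<lambda>t. M0 (u t)) \<in> L2k (ew \<rho>)" and wL: "w \<in> L2k (ew \<rho>)" and "\<And>n. (\<phi> n, \<psi> n) \<in> tgraph"
    and lim: "(\<lambda>n. nk (ew \<rho>) (\<lambda>t. \<phi> n t - M0 (u t))) \<longlonglongrightarrow> 0" "(\<lambda>n. nk (ew \<rho>) (\<lambda>t. \<psi> n t - w t)) \<longlonglongrightarrow> 0"
    using gclosE[OF w[unfolded dgraph_tgraph]] by blast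
  then have t: "\<And>n. test_fun (\<phi> n)" "\<And>n. test_fun (\<psi> n)" "\<And>n t. (\<phi> n has_vector_derivative \<psi> n t) (at t)"
    by (auto simp: tgraph_def)
  have tL: "\<phi> n \<in> L2k (ew \<rho>)" "\<psi> n \<in> L2k (ew \<rho>)" for n using t by (auto intro: ew.ccont_L2k test_fun_ccont)
  show "w \<in> L2k (ew \<rho>)" by (rule wL)
  have close: "nk (ew \<rho>) (\<lambda>t. dq h (\<phi> n) t - M0 (dq h u t)) \<le> nk (ew \<rho>) (\<lambda>t. \<psi> n t - w t)" if h: "0 < h" "h \<le> 1" for n h
  proof (rule LIMSEQ_le)
    have dM: "M0 (dq h u t) = dq h (\<lambda>t. M0 (u t)) t" for t by (rule dq_bounded_linear[OF M0, symmetric])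
    have "(\<lambda>m. nk (ew \<rho>) (\<lambda>t. dq h (\<phi> m) t - M0 (dq h u t))) \<longlonglongrightarrow> 0"
    proof (rule Lim_null_comparison)
      show "\<forall>\<^sub>F m in sequentially. norm (nk (ew \<rho>) (\<lambda>t. dq h (\<phi> m) t - M0 (dq h u t))) \<le> (1 + exp (- \<rho> * h)) / h * nk (ew \<rho>) (\<lambda>t. \<phi> m t - M0 (u t))"
        using nk_dq_le[OF ew.L2k_diff[OF tL(1) M0u] h(1)] unfolding dq_diff[abs_def] dM by (simp add: ew.nk_nonneg dq_diff[abs_def])
      show "(\<lambda>m. (1 + exp (- \<rho> * h)) / h * nk (ew \<rho>) (\<lambda>t. \<phi> m t - M0 (u t))) \<longlonglongrightarrow> 0"
        using tendsto_mult[OF tendsto_const lim(1), of "(1 + exp (- \<rho> * h)) / h"] by simp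
    qed
    then have "(\<lambda>m. nk (ew \<rho>) (\<lambda>t. (dq h (\<phi> n) t - dq h (\<phi> m) t) - (dq h (\<phi> n) t - M0 (dq h u t)))) \<longlonglongrightarrow> 0"
      by (simp add: ew.nk_diff_commute[of \<rho> "\<lambda>t. M0 (dq h u t)"])
    then show "(\<lambda>m. nk (ew \<rho>) (\<lambda>t. dq h (\<phi> n) t - dq h (\<phi> m) t)) \<longlonglongrightarrow> nk (ew \<rho>) (\<lambda>t. dq h (\<phi> n) t - M0 (dq h u t))"
      by (rule ew.nk_tendsto[rotated 2]) (intro ew.L2k_diff L2k_dq tL ew.L2k_bounded_linear[OF _ M0] u)+
    have "(\<lambda>m. nk (ew \<rho>) (\<lambda>t. (\<psi> n t - \<psi> m t) - (\<psi> n t - w t))) \<longlonglongrightarrow> 0"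
      using lim(2) by (simp add: ew.nk_diff_commute[of \<rho> w])
    then show "(\<lambda>m. nk (ew \<rho>) (\<lambda>t. \<psi> n t - \<psi> m t)) \<longlonglongrightarrow> nk (ew \<rho>) (\<lambda>t. \<psi> n t - w t)"
      by (rule ew.nk_tendsto[rotated 2]) (intro ew.L2k_diff tL wL)+
    have "nk (ew \<rho>) (\<lambda>t. dq h (\<phi> n) t - dq h (\<phi> m) t) \<le> nk (ew \<rho>) (\<lambda>t. \<psi> n t - \<psi> m t)" for m
    proof -
      have "((\<lambda>t. \<phi> n t + (-1) *\<^sub>R \<phi> m t), (\<lambda>t. \<psi> n t + (-1) *\<^sub>R \<psi> m t)) \<in> tgraph"
        using op_lin_tgraph t unfolding op_lin_def tgraph_def by blast
      then have "nk (ew \<rho>) (dq h (\<lambda>t. \<phi> n t - \<phi> m t)) \<le> nk (ew \<rho>) (\<lambda>t. \<psi> n t - \<psi> m t)"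
        using rho h by (intro nk_dq_le_derivative) (auto simp: tgraph_def)
      then show ?thesis by (simp add: dq_diff[abs_def])
    qed
    then show "\<exists>N. \<forall>m\<ge>N. nk (ew \<rho>) (\<lambda>t. dq h (\<phi> n) t - dq h (\<phi> m) t) \<le> nk (ew \<rho>) (\<lambda>t. \<psi> n t - \<psi> m t)" by blast
  qed
  have lower: "ipk (ew \<rho>) w u \<ge> - (2 * nk (ew \<rho>) (\<lambda>t. \<psi> n t - w t)) * nk (ew \<rho>) u" for n
  proof -
    define s :: "nat \<Rightarrow> real" where "s j = 1 / 2 ^ j" for j
    have s: "s \<longlonglongrightarrow> 0" "\<And>j. 0 < s j" "\<And>j. s j \<le> 1"
      unfolding s_def using dyadic_tendsto_0[of 1] by (auto simp: field_simps)
    have "ipk (ew \<rho>) w u \<ge> - (2 * nk (ew \<rho>) (\<lambda>t. \<psi> n t - w t) + nk (ew \<rho>) (\<lambda>t. dq (s j) (\<phi> n) t - \<psi> n t)) * nk (ew \<rho>) u" for j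
    proof -
      define d1 d2 d3 where "d1 t = \<psi> n t - w t" and "d2 t = dq (s j) (\<phi> n) t - \<psi> n t"
        and "d3 t = dq (s j) (\<phi> n) t - M0 (dq (s j) u t)" for t
      have Md: "(\<lambda>t. M0 (dq (s j) u t)) \<in> L2k (ew \<rho>)" by (intro ew.L2k_bounded_linear[OF _ M0] L2k_dq u)
      have dL: "d1 \<in> L2k (ew \<rho>)" "d2 \<in> L2k (ew \<rho>)" "d3 \<in> L2k (ew \<rho>)"
        unfolding d1_def[abs_def] d2_def[abs_def] d3_def[abs_def]
        by (rule ew.L2k_diff[OF tL(2) wL] ew.L2k_diff[OF L2k_dq[OF tL(1)] tL(2)] ew.L2k_diff[OF L2k_dq[OF tL(1)] Md])+
      have w': "w = (\<lambda>t. ((M0 (dq (s j) u t) + d3 t) - d2 t) - d1 t)"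
        by (simp add: d1_def d2_def d3_def)
      have "ipk (ew \<rho>) w u = ipk (ew \<rho>) (\<lambda>t. M0 (dq (s j) u t)) u + ipk (ew \<rho>) d3 u - ipk (ew \<rho>) d2 u - ipk (ew \<rho>) d1 u"
        by (subst w')
          (use ew.ipk_diff_left[OF ew.L2k_diff[OF ew.L2k_add[OF Md dL(3)] dL(2)] dL(1) u]
            ew.ipk_diff_left[OF ew.L2k_add[OF Md dL(3)] dL(2) u] ew.ipk_add_left[OF Md dL(3) u] in simp)
      moreover have "ipk (ew \<rho>) (\<lambda>t. M0 (dq (s j) u t)) u \<ge> 0"
      proof -
        have "0 \<le> (1 - exp (- \<rho> * s j)) / s j * ipk (ew \<rho>) (\<lambda>t. M0 (u t)) u"
          using rho s(2)[of j] ipk_M0_bounds(1)[OF u] by (intro mult_nonneg_nonneg divide_nonneg_nonneg) auto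
        then show ?thesis using ipk_M0_dq_ge[OF u s(2)] by (rule order_trans)
      qed
      moreover have "\<bar>ipk (ew \<rho>) d3 u\<bar> \<le> nk (ew \<rho>) d1 * nk (ew \<rho>) u"
      proof -
        have "\<bar>ipk (ew \<rho>) d3 u\<bar> \<le> nk (ew \<rho>) d3 * nk (ew \<rho>) u" by (rule ew.ipk_abs_le[OF dL(3) u])
        also have "\<dots> \<le> nk (ew \<rho>) d1 * nk (ew \<rho>) u"
          using close[OF s(2) s(3), of j n] unfolding d1_def[abs_def] d3_def[abs_def] by (intro mult_right_mono ew.nk_nonneg)
        finally show ?thesis .
      qed
      moreover have "\<bar>ipk (ew \<rho>) d2 u\<bar> \<le> nk (ew \<rho>) d2 * nk (ew \<rho>) u" "\<bar>ipk (ew \<rho>) d1 u\<bar> \<le> nk (ew \<rho>) d1 * nk (ew \<rho>) u"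
        by (rule ew.ipk_abs_le[OF dL(2) u] ew.ipk_abs_le[OF dL(1) u])+
      ultimately have "ipk (ew \<rho>) w u \<ge> - (nk (ew \<rho>) d1 * nk (ew \<rho>) u) - nk (ew \<rho>) d2 * nk (ew \<rho>) u - nk (ew \<rho>) d1 * nk (ew \<rho>) u"
        by linarith
      then show ?thesis unfolding d1_def[abs_def] d2_def[abs_def] by (simp add: algebra_simps)
    qed
    moreover have "(\<lambda>j. - (2 * nk (ew \<rho>) (\<lambda>t. \<psi> n t - w t) + nk (ew \<rho>) (\<lambda>t. dq (s j) (\<phi> n) t - \<psi> n t)) * nk (ew \<rho>) u)
      \<longlonglongrightarrow> - (2 * nk (ew \<rho>) (\<lambda>t. \<psi> n t - w t) + 0) * nk (ew \<rho>) u"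
      by (intro tendsto_intros nk_dq_test_fun_tendsto[OF t(1) t(3) t(2) s])
    ultimately have "- (2 * nk (ew \<rho>) (\<lambda>t. \<psi> n t - w t) + 0) * nk (ew \<rho>) u \<le> ipk (ew \<rho>) w u"
      by (intro LIMSEQ_le_const2[of _ _ "ipk (ew \<rho>) w u"]) blast+
    then show ?thesis by simp
  qed
  have "(\<lambda>n. - (2 * nk (ew \<rho>) (\<lambda>t. \<psi> n t - w t)) * nk (ew \<rho>) u) \<longlonglongrightarrow> - (2 * 0) * nk (ew \<rho>) u"
    by (intro tendsto_intros lim)
  then have "- (2 * 0) * nk (ew \<rho>) u \<le> ipk (ew \<rho>) w u"
    by (rule LIMSEQ_le_const2) (use lower in blast)
  then show "ipk (ew \<rho>) w u \<ge> 0" by simp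
qed

lemma Tgraph_L2k: "Tgraph \<rho> M0 M1 DA A \<subseteq> L2k (ew \<rho>) \<times> L2k (ew \<rho>)"
  by (auto simp: Tgraph_def L2w_ew)

lemma op_lin_Tgraph: "op_lin (Tgraph \<rho> M0 M1 DA A)"
  unfolding op_lin_def
proof (intro allI impI)
  fix u f u' f' :: "real \<Rightarrow> 'a" and r :: real
  assume "(u, f) \<in> Tgraph \<rho> M0 M1 DA A" "(u', f') \<in> Tgraph \<rho> M0 M1 DA A"
  then obtain w a w' a' where
    L: "u \<in> L2k (ew \<rho>)" "f \<in> L2k (ew \<rho>)" "u' \<in> L2k (ew \<rho>)" "f' \<in> L2k (ew \<rho>)" and
    d: "((\<lambda>t. M0 (u t)), w) \<in> dgraph \<rho>" "((\<lambda>t. M0 (u' t)), w') \<in> dgraph \<rho>" and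
    La: "a \<in> L2k (ew \<rho>)" "a' \<in> L2k (ew \<rho>)" and
    A1: "AE t in lborel. u t \<in> DA \<and> a t = A (u t)" and A2: "AE t in lborel. u' t \<in> DA \<and> a' t = A (u' t)" and
    E1: "AE t in lborel. f t = w t + M1 (u t) + a t" and E2: "AE t in lborel. f' t = w' t + M1 (u' t) + a' t"
    unfolding Tgraph_def Agraph_def L2w_ew by auto
  have "((\<lambda>t. M0 (u t) + r *\<^sub>R M0 (u' t)), (\<lambda>t. w t + r *\<^sub>R w' t)) \<in> dgraph \<rho>"
    using op_lin_dgraph d unfolding op_lin_def by blast
  then have "((\<lambda>t. M0 (u t + r *\<^sub>R u' t)), (\<lambda>t. w t + r *\<^sub>R w' t)) \<in> dgraph \<rho>"
    by (simp add: linear_simps[OF M0])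
  moreover have "AE t in lborel. u t + r *\<^sub>R u' t \<in> DA \<and> a t + r *\<^sub>R a' t = A (u t + r *\<^sub>R u' t)"
    using A1 A2 by eventually_elim (auto simp: A_add A_scaleR subspace_add[OF subspace_DA] subspace_scale[OF subspace_DA])
  moreover have "AE t in lborel. f t + r *\<^sub>R f' t = (w t + r *\<^sub>R w' t) + M1 (u t + r *\<^sub>R u' t) + (a t + r *\<^sub>R a' t)"
    using E1 E2 by eventually_elim (simp add: linear_simps[OF M1] algebra_simps)
  ultimately show "((\<lambda>t. u t + r *\<^sub>R u' t), (\<lambda>t. f t + r *\<^sub>R f' t)) \<in> Tgraph \<rho> M0 M1 DA A"
    unfolding Tgraph_def Agraph_def L2w_ew
    by (intro CollectI case_prodI conjI exI[of _ "\<lambda>t. w t + r *\<^sub>R w' t"] exI[of _ "\<lambda>t. a t + r *\<^sub>R a' t"])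
      (assumption | rule ew.L2k_add ew.L2k_scaleR L La)+
qed

lemma Tgraph_accretive:
  assumes rho: "\<rho> > 0" and T: "(u, f) \<in> Tgraph \<rho> M0 M1 DA A"
  shows "c * (nk (ew \<rho>) u)\<^sup>2 \<le> ipk (ew \<rho>) f u" "c * nk (ew \<rho>) u \<le> nk (ew \<rho>) f"
proof -
  obtain w a where
    L: "u \<in> L2k (ew \<rho>)" "f \<in> L2k (ew \<rho>)" and d: "((\<lambda>t. M0 (u t)), w) \<in> dgraph \<rho>" and
    La: "a \<in> L2k (ew \<rho>)" and A1: "AE t in lborel. u t \<in> DA \<and> a t = A (u t)" and
    E1: "AE t in lborel. f t = w t + M1 (u t) + a t"
    using T unfolding Tgraph_def Agraph_def L2w_ew by auto
  have a: "AE t in lborel. rip (a t) (u t) \<ge> 0" using A1 by (rule eventually_mono) (auto simp: A_mono)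
  have w: "w \<in> L2k (ew \<rho>)" "- (c - c) * (nk (ew \<rho>) u)\<^sup>2 \<le> ipk (ew \<rho>) w u"
    using dgraph_M0_nonneg[OF rho L(1) d] by auto
  show "c * (nk (ew \<rho>) u)\<^sup>2 \<le> ipk (ew \<rho>) f u" by (rule energy_inequality[OF L(1) w(1) La L(2) E1 a w(2)])
  show "c * nk (ew \<rho>) u \<le> nk (ew \<rho>) f" by (rule energy_estimate[OF L(1) w(1) La L(2) E1 a w(2)])
qed

lemma closure_T_estimate:
  assumes rho: "\<rho> > 0" and T: "(u, f) \<in> closure_T \<rho>"
  shows "c * nk (ew \<rho>) u \<le> nk (ew \<rho>) f"
proof -
  obtain un fn where 1: "u \<in> L2k (ew \<rho>)" "f \<in> L2k (ew \<rho>)" "\<And>n. (un n, fn n) \<in> Tgraph \<rho> M0 M1 DA A"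
    "(\<lambda>n. nk (ew \<rho>) (\<lambda>t. un n t - u t)) \<longlonglongrightarrow> 0" "(\<lambda>n. nk (ew \<rho>) (\<lambda>t. fn n t - f t)) \<longlonglongrightarrow> 0"
    using gclosE[OF T] by blast
  have Ln: "un n \<in> L2k (ew \<rho>)" "fn n \<in> L2k (ew \<rho>)" for n using 1(3)[of n] Tgraph_L2k by auto
  show ?thesis
  proof (rule LIMSEQ_le)
    show "(\<lambda>n. c * nk (ew \<rho>) (un n)) \<longlonglongrightarrow> c * nk (ew \<rho>) u"
      by (intro tendsto_intros ew.nk_tendsto[OF Ln(1) 1(1) 1(4)])
    show "(\<lambda>n. nk (ew \<rho>) (fn n)) \<longlonglongrightarrow> nk (ew \<rho>) f" by (rule ew.nk_tendsto[OF Ln(2) 1(2) 1(5)])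
    show "\<exists>N. \<forall>n\<ge>N. c * nk (ew \<rho>) (un n) \<le> nk (ew \<rho>) (fn n)" using Tgraph_accretive(2)[OF rho 1(3)] by blast
  qed
qed

definition core :: "(real \<Rightarrow> 'a) \<Rightarrow> (real \<Rightarrow> 'a) \<Rightarrow> bool" where
  "core u u' \<longleftrightarrow> test_fun u \<and> test_fun u' \<and> (\<forall>t. (u has_vector_derivative u' t) (at t)) \<and>
     (\<forall>t. u t \<in> DA) \<and> ccont (\<lambda>t. A (u t))"

definition Tc :: "(real \<Rightarrow> 'a) \<Rightarrow> (real \<Rightarrow> 'a) \<Rightarrow> real \<Rightarrow> 'a" where
  "Tc u u' t = M0 (u' t) + M1 (u t) + A (u t)"

lemma coreD:
  assumes "core u u'"
  shows "ccont u" "ccont u'" "test_fun u" "test_fun u'" "\<And>t. (u has_vector_derivative u' t) (at t)"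
    "\<And>t. u t \<in> DA" "ccont (\<lambda>t. A (u t))" "ccont (\<lambda>t. M0 (u' t))"
  using assms test_fun_ccont ccont_bounded_linear[OF M0] unfolding core_def by blast+

lemma ccont_Tc: "core u u' \<Longrightarrow> ccont (Tc u u')"
  unfolding Tc_def[abs_def] using coreD[of u u'] by (intro ccont_add ccont_bounded_linear[OF M1]) auto

lemma core_lin:
  assumes "core u u'" "core v v'"
  shows "core (\<lambda>t. u t + r *\<^sub>R v t) (\<lambda>t. u' t + r *\<^sub>R v' t)"
    "Tc (\<lambda>t. u t + r *\<^sub>R v t) (\<lambda>t. u' t + r *\<^sub>R v' t) = (\<lambda>t. Tc u u' t + r *\<^sub>R Tc v v' t)"
proof -
  note u = coreD[OF assms(1)] and v = coreD[OF assms(2)]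
  have A: "A (u t + r *\<^sub>R v t) = A (u t) + r *\<^sub>R A (v t)" for t
    by (simp add: A_add A_scaleR u v subspace_scale[OF subspace_DA])
  have "ccont (\<lambda>t. A (u t) + r *\<^sub>R A (v t))"
    by (intro ccont_add u ccont_bounded_linear[OF bounded_linear_scaleR_right v(7)])
  then show "core (\<lambda>t. u t + r *\<^sub>R v t) (\<lambda>t. u' t + r *\<^sub>R v' t)"
    unfolding core_def A
    by (auto intro!: test_fun_add test_fun_scaleR u v has_vector_derivative_add subspace_add[OF subspace_DA] subspace_scale[OF subspace_DA]
      bounded_linear.has_vector_derivative[OF bounded_linear_scaleR_right])
  show "Tc (\<lambda>t. u t + r *\<^sub>R v t) (\<lambda>t. u' t + r *\<^sub>R v' t) = (\<lambda>t. Tc u u' t + r *\<^sub>R Tc v v' t)"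
    unfolding Tc_def A by (simp add: linear_simps[OF M0] linear_simps[OF M1] algebra_simps)
qed

lemma core_Tgraph:
  assumes "core u u'"
  shows "(u, Tc u u') \<in> Tgraph \<rho> M0 M1 DA A"
proof -
  note u = coreD[OF assms]
  have "((\<lambda>t. M0 (u t)), (\<lambda>t. M0 (u' t))) \<in> tgraph"
    unfolding tgraph_def using u by (auto intro!: test_fun_bounded_linear[OF M0] bounded_linear.has_vector_derivative[OF M0])
  then have "((\<lambda>t. M0 (u t)), (\<lambda>t. M0 (u' t))) \<in> dgraph \<rho>"
    unfolding dgraph_tgraph using tgraph_L2k[of \<rho>]
    by (intro gclosI[where un = "\<lambda>_. \<lambda>t. M0 (u t)" and vn = "\<lambda>_. \<lambda>t. M0 (u' t)"]) (auto simp: ew.nk_zero)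
  moreover have "u \<in> L2k (ew \<rho>)" "Tc u u' \<in> L2k (ew \<rho>)" "(\<lambda>t. A (u t)) \<in> L2k (ew \<rho>)"
    using u ccont_Tc[OF assms] by (auto intro: ew.ccont_L2k)
  ultimately show ?thesis
    unfolding Tgraph_def Agraph_def L2w_ew using u(6)
    by (intro CollectI case_prodI conjI exI[of _ "\<lambda>t. M0 (u' t)"] exI[of _ "\<lambda>t. A (u t)"] AE_I2)
      (simp_all add: Tc_def)
qed

lemma core_estimate:
  assumes u: "core u u'" and \<delta>: "\<forall>\<^sub>F h in at_right 0. defect \<mu> h \<le> c - \<delta>"
  shows "\<delta> * nk (ew \<mu>) u \<le> nk (ew \<mu>) (Tc u u')"
proof -
  note uu = coreD[OF u]
  have uL: "u \<in> L2k (ew \<mu>)" "(\<lambda>t. M0 (u' t)) \<in> L2k (ew \<mu>)" using uu by (auto intro: ew.ccont_L2k)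
  obtain b where b: "b > 0" "\<And>h. 0 < h \<Longrightarrow> h < b \<Longrightarrow> defect \<mu> h \<le> c - \<delta>"
    using \<delta> unfolding eventually_at_right_field by auto
  define b' where "b' = min b 1 / 2"
  define s where "s j = b' / 2 ^ j" for j :: nat
  have b': "b' > 0" using b(1) by (simp add: b'_def)
  have s: "s \<longlonglongrightarrow> 0" "\<And>j. 0 < s j" "\<And>j. s j \<le> b'"
    unfolding s_def using dyadic_tendsto_0[of b'] b' by (auto simp: field_simps)
  have sb: "s j < b" "s j \<le> 1" for j using s(3)[of j] b unfolding b'_def by linarith+
  have lim: "(\<lambda>j. nk (ew \<mu>) (\<lambda>t. dq (s j) (\<lambda>t. M0 (u t)) t - M0 (u' t))) \<longlonglongrightarrow> 0"
    by (rule nk_dq_test_fun_tendsto)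
      (use uu s sb in \<open>auto intro!: test_fun_bounded_linear[OF M0] bounded_linear.has_vector_derivative[OF M0]\<close>)
  have "(\<lambda>j. ipk (ew \<mu>) (\<lambda>t. M0 (dq (s j) u t)) u) \<longlonglongrightarrow> ipk (ew \<mu>) (\<lambda>t. M0 (u' t)) u"
    by (rule ew.ipk_tendsto)
      (use uL lim dq_bounded_linear[OF M0] in \<open>auto intro!: ew.L2k_bounded_linear[OF _ M0] L2k_dq simp: ew.nk_zero\<close>)
  moreover have "- (c - \<delta>) * (nk (ew \<mu>) u)\<^sup>2 \<le> ipk (ew \<mu>) (\<lambda>t. M0 (dq (s j) u t)) u" for j
  proof -
    have "- (c - \<delta>) * (nk (ew \<mu>) u)\<^sup>2 \<le> - defect \<mu> (s j) * (nk (ew \<mu>) u)\<^sup>2"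
      using b(2)[OF s(2) sb(1), of j] by (intro mult_right_mono) auto
    then show ?thesis using ipk_M0_dq_ge_defect[OF uL(1) s(2)] by (rule order_trans)
  qed
  ultimately have w: "- (c - \<delta>) * (nk (ew \<mu>) u)\<^sup>2 \<le> ipk (ew \<mu>) (\<lambda>t. M0 (u' t)) u"
    by (intro LIMSEQ_le_const) blast+
  show ?thesis
    by (rule energy_estimate[where w = "\<lambda>t. M0 (u' t)" and a = "\<lambda>t. A (u t)", OF _ _ _ _ _ _ w])
      (use uu ccont_Tc[OF u] in \<open>auto intro: ew.ccont_L2k A_mono simp: Tc_def\<close>)
qed

lemma core_approximation:
  assumes f: "test_fun f" and mu: "\<mu> > - (c / K)" "\<nu> > - (c / K)" and e: "e > 0"
  obtains u u' where "core u u'" "nk (ew \<mu>) (\<lambda>t. Tc u u' t - f t) < e" "nk (ew \<nu>) (\<lambda>t. Tc u u' t - f t) < e"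
proof -
  obtain f' where f': "test_fun f'" "\<And>t. (f has_vector_derivative f' t) (at t)" using test_fun_derivative[OF f] by blast
  obtain B where B: "B > 0" "\<And>x. norm (M0 x) \<le> norm x * B" using bounded_linear.pos_bounded[OF M0] by blast
  have small: "\<forall>\<^sub>F h in at_right 0. B * (h / 2 * (2 * C / \<delta>)) < e" for C \<delta>
  proof -
    have "((\<lambda>h. B * (h / 2 * (2 * C / \<delta>))) \<longlongrightarrow> B * (0 / 2 * (2 * C / \<delta>))) (at_right 0)"
      by (intro tendsto_mult tendsto_divide tendsto_const tendsto_ident_at) auto
    then show ?thesis by (rule order_tendstoD(2)) (use e in simp)
  qed
  obtain \<delta>1 where d1: "\<delta>1 > 0" "\<forall>\<^sub>F h in at_right 0. defect \<mu> h \<le> c - \<delta>1" using eventually_defect[OF mu(1)] by blast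
  obtain \<delta>2 where d2: "\<delta>2 > 0" "\<forall>\<^sub>F h in at_right 0. defect \<nu> h \<le> c - \<delta>2" using eventually_defect[OF mu(2)] by blast
  obtain C1 where C1: "\<And>s. 0 < s \<Longrightarrow> s \<le> 1 \<Longrightarrow> nk (ew \<mu>) (dq s (dq s f)) \<le> C1" using nk_second_dq_bounded[OF f] by blast
  obtain C2 where C2: "\<And>s. 0 < s \<Longrightarrow> s \<le> 1 \<Longrightarrow> nk (ew \<nu>) (dq s (dq s f)) \<le> C2" using nk_second_dq_bounded[OF f] by blast
  have "\<forall>\<^sub>F h in at_right (0::real). 0 < h \<and> h \<le> 1"
    unfolding eventually_at_right_field by (intro exI[of _ 1]) auto
  then have "\<forall>\<^sub>F h in at_right 0. (0 < h \<and> h \<le> 1) \<and> defect \<mu> h \<le> c - \<delta>1 \<and> defect \<nu> h \<le> c - \<delta>2 \<and>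
      B * (h / 2 * (2 * C1 / \<delta>1)) < e \<and> B * (h / 2 * (2 * C2 / \<delta>2)) < e"
    using d1(2) d2(2) small[of C1 \<delta>1] small[of C2 \<delta>2] by eventually_elim blast
  then obtain h where h: "0 < h" "h \<le> 1" "defect \<mu> h \<le> c - \<delta>1" "defect \<nu> h \<le> c - \<delta>2"
    "B * (h / 2 * (2 * C1 / \<delta>1)) < e" "B * (h / 2 * (2 * C2 / \<delta>2)) < e"
    using eventually_happens[of _ "at_right (0::real)"] trivial_limit_at_right_real by blast
  obtain R where "euler DA A M0 M1 c K h R" using exists_euler[OF h(1)] by blast
  then interpret eu: euler DA A M0 M1 c K h R .
  have "\<forall>\<^sub>F N in sequentially. nk (ew \<mu>) (\<lambda>t. (M0 (eu.sol N f' t) + M1 (eu.sol N f t) + A (eu.sol N f t)) - f t) < e \<and>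
    nk (ew \<nu>) (\<lambda>t. (M0 (eu.sol N f' t) + M1 (eu.sol N f t) + A (eu.sol N f t)) - f t) < e"
    using B by (intro eventually_conj eu.eventually_sol_approximates[OF f f'(2) f'(1) d1(1) h(3) h(2) C1 _ _ h(5)]
        eu.eventually_sol_approximates[OF f f'(2) f'(1) d2(1) h(4) h(2) C2 _ _ h(6)]) auto
  then obtain N where N: "nk (ew \<mu>) (\<lambda>t. (M0 (eu.sol N f' t) + M1 (eu.sol N f t) + A (eu.sol N f t)) - f t) < e"
    "nk (ew \<nu>) (\<lambda>t. (M0 (eu.sol N f' t) + M1 (eu.sol N f t) + A (eu.sol N f t)) - f t) < e"
    using eventually_happens[of _ sequentially] by auto
  have "core (eu.sol N f) (eu.sol N f')"
    unfolding core_def using eu.test_fun_sol[OF f] eu.test_fun_sol[OF f'(1)] eu.sol_has_derivative[OF f'(2)]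
      eu.sol_DA eu.ccont_A_sol[OF test_fun_ccont[OF f]] by blast
  then show thesis by (rule that) (use N in \<open>simp_all add: Tc_def\<close>)
qed

lemma closure_T_surj:
  assumes rho: "\<rho> > 0" and mu: "\<mu> > - (c / K)" and f: "f \<in> L2k (ew \<rho>)" "f \<in> L2k (ew \<mu>)"
  obtains u where "u \<in> L2k (ew \<mu>)" "(u, f) \<in> closure_T \<rho>"
proof -
  have rho': "\<rho> > - (c / K)" using rho c K by (simp add: order_less_trans[of _ 0])
  have fk: "f \<in> L2k (k2 \<rho> \<mu>)" using f L2k_k2_iff by blast
  have "\<exists>u u'. core u u' \<and> nk (ew \<rho>) (\<lambda>t. Tc u u' t - f t) < 2 / real (Suc n) \<and> nk (ew \<mu>) (\<lambda>t. Tc u u' t - f t) < 2 / real (Suc n)" for n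
  proof -
    define e where "e = 1 / real (Suc n)"
    have e: "e > 0" by (simp add: e_def)
    have "\<exists>g\<in>{g. test_fun g}. nk (k2 \<rho> \<mu>) (\<lambda>t. f t - g t) < e"
      by (rule k2.L2k_dense[OF _ _ _ _ closure_UNIV fk e])
        (auto intro: k2.ccont_L2k test_fun_ccont test_fun_add test_fun_scaleR test_fun_bump_scaleR)
    then obtain g where g: "test_fun g" "nk (k2 \<rho> \<mu>) (\<lambda>t. f t - g t) < e" by blast
    have gL: "g \<in> L2k (ew \<alpha>)" for \<alpha> by (rule ew.ccont_L2k[OF test_fun_ccont[OF g(1)]])
    have d: "nk (ew \<rho>) (\<lambda>t. g t - f t) < e" "nk (ew \<mu>) (\<lambda>t. g t - f t) < e"
      using g(2) nk_k2_bounds(1,2)[OF ew.L2k_diff[OF f(1) gL] ew.L2k_diff[OF f(2) gL]] ew.nk_diff_commute[of \<rho> f g] ew.nk_diff_commute[of \<mu> f g]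
      by linarith+
    obtain u u' where u: "core u u'" "nk (ew \<rho>) (\<lambda>t. Tc u u' t - g t) < e" "nk (ew \<mu>) (\<lambda>t. Tc u u' t - g t) < e"
      using core_approximation[OF g(1) rho' mu e] by blast
    have TL: "Tc u u' \<in> L2k (ew \<alpha>)" for \<alpha> by (rule ew.ccont_L2k[OF ccont_Tc[OF u(1)]])
    have "nk (ew \<rho>) (\<lambda>t. Tc u u' t - f t) < 2 * e" "nk (ew \<mu>) (\<lambda>t. Tc u u' t - f t) < 2 * e"
      using ew.nk_triangle_diff[OF TL gL f(1)] ew.nk_triangle_diff[OF TL gL f(2)] u d by linarith+
    then show ?thesis using u(1) unfolding e_def by auto
  qed
  then obtain u u' where u: "\<And>n. core (u n) (u' n)"
    "\<And>n. nk (ew \<rho>) (\<lambda>t. Tc (u n) (u' n) t - f t) < 2 / real (Suc n)"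
    "\<And>n. nk (ew \<mu>) (\<lambda>t. Tc (u n) (u' n) t - f t) < 2 / real (Suc n)"
    by metis
  have uL: "u n \<in> L2k (ew \<alpha>)" for n \<alpha> by (rule ew.ccont_L2k[OF coreD(1)[OF u(1)]])
  have uk: "u n \<in> L2k (k2 \<rho> \<mu>)" for n using uL L2k_k2_iff by blast
  have TL: "Tc (u n) (u' n) \<in> L2k (ew \<alpha>)" for n \<alpha> by (rule ew.ccont_L2k[OF ccont_Tc[OF u(1)]])
  obtain \<delta>1 where d1: "\<delta>1 > 0" "\<forall>\<^sub>F h in at_right 0. defect \<rho> h \<le> c - \<delta>1" using eventually_defect[OF rho'] by blast
  obtain \<delta>2 where d2: "\<delta>2 > 0" "\<forall>\<^sub>F h in at_right 0. defect \<mu> h \<le> c - \<delta>2" using eventually_defect[OF mu] by blast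
  have diff: "\<delta> * nk (ew \<alpha>) (\<lambda>t. u m t - u n t) \<le> nk (ew \<alpha>) (\<lambda>t. Tc (u m) (u' m) t - Tc (u n) (u' n) t)"
    if "\<forall>\<^sub>F h in at_right 0. defect \<alpha> h \<le> c - \<delta>" for m n \<alpha> \<delta>
    using core_estimate[OF core_lin(1)[OF u(1) u(1)] that, of m "-1" n] unfolding core_lin(2)[OF u(1) u(1)] by simp
  have tri: "nk (ew \<alpha>) (\<lambda>t. Tc (u m) (u' m) t - Tc (u n) (u' n) t) \<le> nk (ew \<alpha>) (\<lambda>t. Tc (u m) (u' m) t - f t) + nk (ew \<alpha>) (\<lambda>t. Tc (u n) (u' n) t - f t)"
    if "f \<in> L2k (ew \<alpha>)" for m n \<alpha>
    using ew.nk_triangle_diff[OF TL that TL, of m n] ew.nk_diff_commute[of \<alpha> f "Tc (u n) (u' n)"] by simp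
  define D where "D = 1 / \<delta>1 + 1 / \<delta>2"
  have D: "D > 0" unfolding D_def using d1 d2 by (intro add_pos_pos) auto
  have cau: "nk (k2 \<rho> \<mu>) (\<lambda>t. u m t - u n t) \<le> D * (4 / real (Suc N))" if "m \<ge> N" "n \<ge> N" for m n N
  proof -
    have le: "2 / real (Suc m) + 2 / real (Suc n) \<le> 4 / real (Suc N)"
      using frac_le[of 2 2 "real (Suc N)" "real (Suc m)"] frac_le[of 2 2 "real (Suc N)" "real (Suc n)"] that by simp
    define N4 where "N4 = 4 / real (Suc N)"
    have "\<delta>1 * nk (ew \<rho>) (\<lambda>t. u m t - u n t) \<le> N4"
      using diff[OF d1(2), of m n] tri[OF f(1), of m n] u(2)[of m] u(2)[of n] le unfolding N4_def by linarith
    then have 1: "nk (ew \<rho>) (\<lambda>t. u m t - u n t) \<le> 1 / \<delta>1 * N4"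
      using d1(1) by (simp add: pos_le_divide_eq mult.commute)
    have "\<delta>2 * nk (ew \<mu>) (\<lambda>t. u m t - u n t) \<le> N4"
      using diff[OF d2(2), of m n] tri[OF f(2), of m n] u(3)[of m] u(3)[of n] le unfolding N4_def by linarith
    then have 2: "nk (ew \<mu>) (\<lambda>t. u m t - u n t) \<le> 1 / \<delta>2 * N4"
      using d2(1) by (simp add: pos_le_divide_eq mult.commute)
    show ?thesis
      using 1 2 nk_k2_bounds(3)[OF ew.L2k_diff[OF uL[of m \<rho>] uL[of n \<rho>]] ew.L2k_diff[OF uL[of m \<mu>] uL[of n \<mu>]]]
      unfolding D_def N4_def[symmetric] distrib_right by linarith
  qed
  have "\<exists>N. \<forall>m\<ge>N. \<forall>n\<ge>N. nk (k2 \<rho> \<mu>) (\<lambda>t. u m t - u n t) < e" if e: "e > 0" for e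
  proof -
    obtain N where N: "1 / real (Suc N) < e / (4 * D)" using nat_approx_posE[of "e / (4 * D)"] e D by auto
    then have "D * (4 / real (Suc N)) < e" using D by (simp add: field_simps)
    then show ?thesis using cau by (meson le_less_trans)
  qed
  then obtain v where v: "v \<in> L2k (k2 \<rho> \<mu>)" "(\<lambda>n. nk (k2 \<rho> \<mu>) (\<lambda>t. u n t - v t)) \<longlonglongrightarrow> 0"
    using k2.L2k_complete[of u \<rho> \<mu>, OF uk] by blast
  have vL: "v \<in> L2k (ew \<rho>)" "v \<in> L2k (ew \<mu>)" using v(1) L2k_k2_iff by blast+
  have "(v, f) \<in> closure_T \<rho>"
  proof (rule gclosI[OF vL(1) f(1) core_Tgraph[OF u(1)]])
    show "(\<lambda>n. nk (ew \<rho>) (\<lambda>t. u n t - v t)) \<longlonglongrightarrow> 0"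
      by (rule Lim_null_comparison[OF _ v(2)])
        (use nk_k2_bounds(1)[OF ew.L2k_diff[OF uL vL(1)] ew.L2k_diff[OF uL vL(2)]] in \<open>auto simp: ew.nk_nonneg\<close>)
    have "(\<lambda>n. 2 / real (Suc n)) \<longlonglongrightarrow> 0"
      using tendsto_mult[OF tendsto_const LIMSEQ_inverse_real_of_nat, of 2] by (simp add: divide_inverse)
    then show "(\<lambda>n. nk (ew \<rho>) (\<lambda>t. Tc (u n) (u' n) t - f t)) \<longlonglongrightarrow> 0"
      by (rule Lim_null_comparison[rotated]) (use less_imp_le[OF u(2)] in \<open>simp add: ew.nk_nonneg\<close>)
  qed
  then show thesis using vL(2) that by blast
qed

text \<open>An accretive operator with dense domain is closable: perturb the approximating sequence by
  \<open>s y\<close> with \<open>y\<close> in the domain and let \<open>s \<rightarrow> 0\<close>.\<close>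

lemma closure_T_single_valued_0:
  assumes rho: "\<rho> > 0" and T: "((\<lambda>_. 0), p) \<in> closure_T \<rho>"
  shows "AE t in lborel. p t = 0"
proof -
  obtain xn pn where 1: "p \<in> L2k (ew \<rho>)" "\<And>n. (xn n, pn n) \<in> Tgraph \<rho> M0 M1 DA A"
    "(\<lambda>n. nk (ew \<rho>) (\<lambda>t. xn n t - 0)) \<longlonglongrightarrow> 0" "(\<lambda>n. nk (ew \<rho>) (\<lambda>t. pn n t - p t)) \<longlonglongrightarrow> 0"
    using gclosE[OF T] by blast
  have Ln: "xn n \<in> L2k (ew \<rho>)" "pn n \<in> L2k (ew \<rho>)" for n using 1(2)[of n] Tgraph_L2k by auto
  have pos: "ipk (ew \<rho>) p y \<ge> 0" if y: "core y y'" for y y'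
  proof -
    define q where "q = Tc y y'"
    have yL: "y \<in> L2k (ew \<rho>)" "q \<in> L2k (ew \<rho>)"
      unfolding q_def using coreD(1)[OF y] ccont_Tc[OF y] by (auto intro: ew.ccont_L2k)
    have key: "ipk (ew \<rho>) p y + s * ipk (ew \<rho>) q y \<ge> 0" if s: "s > 0" for s
    proof -
      have "0 \<le> ipk (ew \<rho>) (\<lambda>t. pn n t + s *\<^sub>R q t) (\<lambda>t. xn n t + s *\<^sub>R y t)" for n
      proof -
        have "((\<lambda>t. xn n t + s *\<^sub>R y t), (\<lambda>t. pn n t + s *\<^sub>R q t)) \<in> Tgraph \<rho> M0 M1 DA A"
          using op_lin_Tgraph 1(2) core_Tgraph[OF y] unfolding op_lin_def q_def by blast
        from Tgraph_accretive(1)[OF rho this] show ?thesis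
          using c by (meson less_imp_le mult_nonneg_nonneg order_trans zero_le_power2)
      qed
      moreover have "(\<lambda>n. ipk (ew \<rho>) (\<lambda>t. pn n t + s *\<^sub>R q t) (\<lambda>t. xn n t + s *\<^sub>R y t)) \<longlonglongrightarrow>
        ipk (ew \<rho>) (\<lambda>t. p t + s *\<^sub>R q t) (\<lambda>t. s *\<^sub>R y t)"
      proof (rule ew.ipk_tendsto)
        show "(\<lambda>n. nk (ew \<rho>) (\<lambda>t. pn n t + s *\<^sub>R q t - (p t + s *\<^sub>R q t))) \<longlonglongrightarrow> 0" using 1(4) by simp
        show "(\<lambda>n. nk (ew \<rho>) (\<lambda>t. xn n t + s *\<^sub>R y t - s *\<^sub>R y t)) \<longlonglongrightarrow> 0" using 1(3) by simp
      qed (intro ew.L2k_add ew.L2k_scaleR Ln yL 1(1))+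
      ultimately have "0 \<le> ipk (ew \<rho>) (\<lambda>t. p t + s *\<^sub>R q t) (\<lambda>t. s *\<^sub>R y t)"
        by (intro LIMSEQ_le_const) blast+
      also have "\<dots> = s * ipk (ew \<rho>) (\<lambda>t. p t + s *\<^sub>R q t) y"
        unfolding ew.ipk_commute[of \<rho> "\<lambda>t. p t + s *\<^sub>R q t"] by (rule ew.ipk_scaleR_left)
      also have "ipk (ew \<rho>) (\<lambda>t. p t + s *\<^sub>R q t) y = ipk (ew \<rho>) p y + s * ipk (ew \<rho>) q y"
        unfolding ew.ipk_add_left[OF 1(1) ew.L2k_scaleR[OF yL(2)] yL(1)] ew.ipk_scaleR_left ..
      finally show ?thesis using s by (simp add: zero_le_mult_iff)
    qed
    have "(\<lambda>n. ipk (ew \<rho>) p y + inverse (real (Suc n)) * ipk (ew \<rho>) q y) \<longlonglongrightarrow> ipk (ew \<rho>) p y + 0 * ipk (ew \<rho>) q y"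
      by (intro tendsto_intros LIMSEQ_inverse_real_of_nat)
    then have "0 \<le> ipk (ew \<rho>) p y + 0 * ipk (ew \<rho>) q y"
      by (rule LIMSEQ_le_const) (use key in auto)
    then show ?thesis by simp
  qed
  have neg: "ipk (ew \<rho>) y p \<le> 0" if y: "core y y'" for y y'
  proof -
    have "core (\<lambda>t. y t + (-2) *\<^sub>R y t) (\<lambda>t. y' t + (-2) *\<^sub>R y' t)" by (rule core_lin(1)[OF y y])
    from pos[OF this] have "0 \<le> ipk (ew \<rho>) (\<lambda>t. y t + (-2) *\<^sub>R y t) p" by (simp only: ew.ipk_commute)
    also have "\<dots> = ipk (ew \<rho>) y p + (-2) * ipk (ew \<rho>) y p"
      unfolding ew.ipk_scaleR_left[symmetric]
      by (rule ew.ipk_add_left[OF _ ew.L2k_scaleR 1(1)]) (intro ew.ccont_L2k coreD(1)[OF y])+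
    finally show ?thesis by simp
  qed
  have dense: "\<exists>y\<in>{y. \<exists>y'. core y y'}. nk (ew \<rho>) (\<lambda>t. p t - y t) < e" if e: "e > 0" for e
  proof (rule ew.L2k_dense[OF _ _ _ _ dense_domain 1(1) e])
    show "{y. \<exists>y'. core y y'} \<subseteq> L2k (ew \<rho>)" using coreD(1) by (auto intro: ew.ccont_L2k)
    show "(\<lambda>t. f t + g t) \<in> {y. \<exists>y'. core y y'}" if "f \<in> {y. \<exists>y'. core y y'}" "g \<in> {y. \<exists>y'. core y y'}" for f g
      using that core_lin(1)[of f _ g _ 1] by auto
    show "(\<lambda>t. r *\<^sub>R f t) \<in> {y. \<exists>y'. core y y'}" if f: "f \<in> {y. \<exists>y'. core y y'}" for f r
    proof -
      obtain f' where "core f f'" using f by blast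
      from core_lin(1)[OF this this, of "r - 1"] show ?thesis by (auto simp: algebra_simps)
    qed
    show "(\<lambda>t. bump a b n t *\<^sub>R x) \<in> {y. \<exists>y'. core y y'}" if x: "x \<in> DA" for a b n x
    proof -
      obtain y' where y': "test_fun y'" "\<And>t. ((\<lambda>t. bump a b n t *\<^sub>R x) has_vector_derivative y' t) (at t)"
        using test_fun_derivative[OF test_fun_bump_scaleR] by blast
      moreover have "ccont (\<lambda>t. A (bump a b n t *\<^sub>R x))"
        unfolding A_scaleR[OF x] by (rule test_fun_ccont[OF test_fun_bump_scaleR])
      ultimately show ?thesis
        unfolding core_def using test_fun_bump_scaleR subspace_scale[OF subspace_DA x] by blast
    qed
  qed
  have "\<forall>n. \<exists>y y'. core y y' \<and> nk (ew \<rho>) (\<lambda>t. p t - y t) < inverse (real (Suc n))"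
    using dense[of "inverse (real (Suc _))"] by simp
  then obtain y where y: "\<And>n. \<exists>y'. core (y n) y'" "\<And>n. nk (ew \<rho>) (\<lambda>t. p t - y n t) < inverse (real (Suc n))" by metis
  have yL: "y n \<in> L2k (ew \<rho>)" for n using y(1)[of n] coreD(1) by (auto intro: ew.ccont_L2k)
  have "(\<lambda>n. nk (ew \<rho>) (\<lambda>t. y n t - p t)) \<longlonglongrightarrow> 0"
    by (rule Lim_null_comparison[OF _ LIMSEQ_inverse_real_of_nat])
      (use less_imp_le[OF y(2)] in \<open>simp add: ew.nk_nonneg ew.nk_diff_commute[of \<rho> _ p]\<close>)
  then have "(\<lambda>n. ipk (ew \<rho>) (y n) p) \<longlonglongrightarrow> ipk (ew \<rho>) p p"
    by (intro ew.ipk_tendsto yL 1(1)) (simp_all add: ew.nk_zero)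
  then have "ipk (ew \<rho>) p p \<le> 0" by (rule LIMSEQ_le_const2) (use y(1) neg in blast)
  then have "nk (ew \<rho>) p = 0" unfolding ew.ipk_self by simp
  then show ?thesis by (rule ew.nk_eq_0_AE[OF 1(1)])
qed

lemma closure_T_diff:
  assumes "(u, f) \<in> closure_T \<rho>" "(v, g) \<in> closure_T \<rho>"
  shows "((\<lambda>t. u t - v t), (\<lambda>t. f t - g t)) \<in> closure_T \<rho>"
proof -
  have "((\<lambda>t. u t + (-1) *\<^sub>R v t), (\<lambda>t. f t + (-1) *\<^sub>R g t)) \<in> closure_T \<rho>"
    using op_lin_gclos[OF op_lin_Tgraph Tgraph_L2k] assms unfolding op_lin_def by blast
  then show ?thesis by simp
qed

lemma closure_T_inj:
  assumes rho: "\<rho> > 0" and "(u, f) \<in> closure_T \<rho>" "(v, g) \<in> closure_T \<rho>"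
    and eq: "AE t in lborel. f t = g t"
  shows "AE t in lborel. u t = v t"
proof -
  have d: "((\<lambda>t. u t - v t), (\<lambda>t. f t - g t)) \<in> closure_T \<rho>"
    by (rule closure_T_diff[OF assms(2,3)])
  have L: "(\<lambda>t. u t - v t) \<in> L2k (ew \<rho>)" "(\<lambda>t. f t - g t) \<in> L2k (ew \<rho>)" using gclosE[OF d] by blast+
  have "nk (ew \<rho>) (\<lambda>t. f t - g t) = nk (ew \<rho>) (\<lambda>_. 0 :: 'a)"
    by (rule ew.nk_cong_AE[OF ew.L2k_meas[OF L(2)]]) (use eq in \<open>auto elim!: eventually_mono\<close>)
  then have "c * nk (ew \<rho>) (\<lambda>t. u t - v t) \<le> 0" using closure_T_estimate[OF rho d] by (simp add: ew.nk_zero)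
  then have "nk (ew \<rho>) (\<lambda>t. u t - v t) = 0"
    using c ew.nk_nonneg[of \<rho> "\<lambda>t. u t - v t"] by (simp add: mult_le_0_iff)
  from ew.nk_eq_0_AE[OF L(1) this] show ?thesis by simp
qed

lemma bdd_invertible_closure_T:
  assumes rho: "\<rho> > 0"
  shows "bdd_invertible \<rho> (closure_T \<rho>)"
  unfolding bdd_invertible_def
proof (intro conjI allI impI ballI)
  fix u f g assume "(u, f) \<in> closure_T \<rho> \<and> (u, g) \<in> closure_T \<rho>"
  then have "((\<lambda>t. u t - u t), (\<lambda>t. f t - g t)) \<in> closure_T \<rho>"
    using closure_T_diff by blast
  then have "((\<lambda>_. 0), (\<lambda>t. f t - g t)) \<in> closure_T \<rho>" by simp
  from closure_T_single_valued_0[OF rho this] show "AE t in lborel. f t = g t" by simp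
next
  fix u v f g
  assume "(u, f) \<in> closure_T \<rho> \<and> (v, g) \<in> closure_T \<rho> \<and> (AE t in lborel. f t = g t)"
  then show "AE t in lborel. u t = v t" using closure_T_inj[OF rho] by blast
next
  fix f :: "real \<Rightarrow> 'a" assume "f \<in> L2w \<rho>"
  then have f: "f \<in> L2k (ew \<rho>)" by (simp add: L2w_ew)
  have "\<rho> > - (c / K)" using rho c K by (simp add: order_less_trans[of _ 0])
  then show "\<exists>u. (u, f) \<in> closure_T \<rho>" using closure_T_surj[OF rho _ f f] by blast
next
  have "normw \<rho> u \<le> (1 / c) * normw \<rho> f" if "(u, f) \<in> closure_T \<rho>" for u f
    using closure_T_estimate[OF rho that] c by (simp add: normw_ew field_simps)
  then show "\<exists>K. \<forall>(u, f)\<in>closure_T \<rho>. normw \<rho> u \<le> K * normw \<rho> f" by blast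
qed

lemma exp_stable_closure_T:
  assumes rho: "\<rho> > 0"
  shows "exp_stable \<rho> (closure_T \<rho>) (c / K)"
  unfolding exp_stable_def
proof (intro conjI allI impI)
  show "0 < c / K" using c K by simp
  fix \<nu> u f \<mu>
  assume a: "0 \<le> \<nu> \<and> \<nu> < c / K \<and> f \<in> L2w (- \<nu>) \<and> f \<in> L2w \<rho> \<and> (u, f) \<in> closure_T \<rho>"
    and mu: "- \<nu> < \<mu> \<and> \<mu> \<le> \<rho>"
  have f: "f \<in> L2k (ew (- \<nu>))" "f \<in> L2k (ew \<rho>)" using a by (auto simp: L2w_ew)
  have le: "ew \<mu> t \<le> ew (- \<nu>) t + ew \<rho> t" for t
  proof (cases "t \<ge> 0")
    case True
    then have "(- \<nu>) * t \<le> \<mu> * t" using mu by (intro mult_right_mono) auto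
    then have "ew \<mu> t \<le> ew (- \<nu>) t" by (simp add: ew_def)
    then show ?thesis using ew.k_nonneg[of \<rho> t] by linarith
  next
    case False
    then have "\<rho> * t \<le> \<mu> * t" using mu by (intro mult_right_mono_neg) auto
    then have "ew \<mu> t \<le> ew \<rho> t" by (simp add: ew_def)
    then show ?thesis using ew.k_nonneg[of "- \<nu>" t] by linarith
  qed
  have fmu: "f \<in> L2k (ew \<mu>)"
  proof (rule ew.L2k_bound[OF ew.L2k_meas[OF f(2)]])
    show "integrable lborel (\<lambda>t. (norm (f t))\<^sup>2 * ew (- \<nu>) t + (norm (f t))\<^sup>2 * ew \<rho> t)"
      by (intro Bochner_Integration.integrable_add ew.L2k_int f)
    show "AE t in lborel. (norm (f t))\<^sup>2 * ew \<mu> t \<le> (norm (f t))\<^sup>2 * ew (- \<nu>) t + (norm (f t))\<^sup>2 * ew \<rho> t"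
      unfolding distrib_left[symmetric] by (intro AE_I2 mult_left_mono le) auto
  qed
  have "\<mu> > - (c / K)" using a mu by linarith
  then obtain v where v: "v \<in> L2k (ew \<mu>)" "(v, f) \<in> closure_T \<rho>"
    using closure_T_surj[OF rho _ f(2) fmu] by blast
  have uc: "(u, f) \<in> closure_T \<rho>" using a by blast
  have "u \<in> L2k (ew \<rho>)" using gclosE[OF uc] by blast
  then have "u \<in> borel_measurable borel" by (rule ew.L2k_meas)
  moreover have "AE t in lborel. v t = u t" by (rule closure_T_inj[OF rho v(2) uc]) simp
  ultimately show "u \<in> L2w \<mu>" unfolding L2w_ew by (rule ew.L2k_cong_AE[OF v(1)])
qed

end

lemma bounded_clinear_bounded_linear:
  assumes "bounded_clinear M"
  shows "bounded_linear M"
proof -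
  obtain B where "\<And>x. norm (M x) \<le> norm x * B" using assms unfolding bounded_clinear_def by blast
  moreover have "M (r *\<^sub>R x) = r *\<^sub>R M x" for r x
    using assms unfolding bounded_clinear_def scaleC_of_real[symmetric] by blast
  ultimately show ?thesis
    using assms unfolding bounded_clinear_def by (intro bounded_linear_intro[of M B]) auto
qed

theorem theorem4p1:
  fixes M0 M1 :: "'a::chilbert \<Rightarrow> 'a"
    and DA :: "'a set" and A :: "'a \<Rightarrow> 'a"
    and c \<rho> :: real
  assumes "linear_op DA A" and "maximal_monotone DA A"
    and "bounded_clinear M0" and "bounded_clinear M1"
    and "M0 \<noteq> (\<lambda>x. 0)"
    and "\<forall>x y. cinner (M0 x) y = cinner x (M0 y)"
    and "\<exists>d>0. \<forall>x\<in>range M0. Re (cinner (M0 x) x) \<ge> d * (norm x)\<^sup>2"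
    and "c > 0" and "\<forall>x. Re (cinner (M1 x) x) \<ge> c * (norm x)\<^sup>2"
    and "\<rho> > 0"
  shows "bdd_invertible \<rho> (gclos \<rho> (Tgraph \<rho> M0 M1 DA A)) \<and>
         exp_stable \<rho> (gclos \<rho> (Tgraph \<rho> M0 M1 DA A)) (c / onorm M0)"
proof -
  have M0: "bounded_linear M0" and M1: "bounded_linear M1"
    using assms(3,4) by (auto intro: bounded_clinear_bounded_linear)
  have sa: "rip (M0 x) y = rip x (M0 y)" for x y using assms(6) by (simp add: rip_def)
  obtain d where d: "d > 0" "\<And>x. x \<in> range M0 \<Longrightarrow> rip (M0 x) x \<ge> d * (norm x)\<^sup>2"
    using assms(7) unfolding rip_def by blast
  have "rip (M0 x) x \<ge> 0" if "x \<in> range M0" for x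
    using order_trans[OF _ d(2)[OF that]] d(1) by simp
  then have nonneg: "rip (M0 x) x \<ge> 0" for x by (rule selfadjoint_nonneg_of_range[OF M0 sa])
  have le: "rip (M0 x) x \<le> onorm M0 * (norm x)\<^sup>2" for x
  proof -
    have "rip (M0 x) x \<le> norm (M0 x) * norm x" using rip_Cauchy_Schwarz[of "M0 x" x] by linarith
    also have "\<dots> \<le> (onorm M0 * norm x) * norm x" by (intro mult_right_mono onorm[OF M0]) simp
    finally show ?thesis by (simp add: power2_eq_square mult.assoc)
  qed
  have "onorm M0 > 0" using onorm_pos_lt[OF M0] assms(5) by auto
  then interpret evo DA A M0 M1 c "onorm M0"
    using linear_maximal_monotoneI[OF assms(1,2)] M0 M1 sa nonneg le assms(8,9)
    by (intro evo.intro evo_axioms.intro) (auto simp: rip_def)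
  show ?thesis using bdd_invertible_closure_T exp_stable_closure_T assms(10) by blast
qed

end
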